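(* Let $G$ be a finite group. There is an equivalence of categories $$\Omega_G\;\simeq\;\int^{\mathcal O_G^{\mathrm{op}}}\left(\int_{\mathcal F_{(-),*}^{\mathrm{op}}}\mathcal T^{\underline{(-)}}\right),$$ where $\Omega_G$ is the equivariant dendroidal category and the right-hand side is the Grothendieck construction of the pseudofunctor $\mathcal O_G^{\mathrm{op}}\to\mathrm{Cat}$, $G/H\mapsto\int_{\mathcal F_{G/H,*}^{\mathrm{op}}}\mathcal T^{\underline{G/H}}$.
   Context: Trees. A tree is a finite (connected) graph with no cycles in which each end of an edge may or may not be attached to a vertex; an unattached end is a loose end. One loose end is chosen as the root; the other loose ends are the leaves. Trees are non-planar. The stick tree has one edge and no vertices; its edge carries both the root and the unique leaf. Leaves and root are identified with the edges carrying them. $E(T),V(T),\ell(T)$ are the sets of edges, vertices, leaves. Each vertex has one outgoing edge (towards the root) and a possibly empty set of incoming edges; a stump is a vertex with no incoming edges. A corolla is a tree with exactly one vertex. A subtree $S'$ of $S$ is a tree whose vertices and edges are subsets of those of $S$ such that if $v\in V(S')$ then all incoming edges of $v$ are in $S'$. The dendroidal category $\Omega$ has trees as objects; a morphism $f\colon T\to S$ is a function $E(T)\to E(S)$ such that for each vertex $v$ of $T$ with outgoing edge $e_0$ and incoming edges $e_1,\dots,e_n$ there is a subtree of $S$ with root $f(e_0)$ and (exactly the $n$ distinct) leaves $f(e_1),\dots,f(e_n)$. Forests and $\Omega_G$. $\mathcal F$ is the category of finite sets $\underline n=\{1,\dots,n\}$, $n\ge1$. The category $\Phi$ of forests has objects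 $(\underline n,(T_i)_{i=1}^n)$ with $T_i\in\Omega$; a morphism $(\underline n,(T_i))\to(\underline m,(S_j))$ is a pair $(\varphi,(f_i))$ with $\varphi\colon\underline n\to\underline m$ a function and $f_i\colon T_i\to S_{\varphi(i)}$ in $\Omega$. For a category $\mathcal C$, $\mathcal C^G=\mathrm{Fun}(BG,\mathcal C)$. $\mathcal O_G$ is the full subcategory of $\mathcal F^G$ on transitive $G$-sets; its objects are thought of as orbits $G/H$, $H\le G$ (equipped with an ordering). $\Omega_G$ is the pullback of $\mathcal O_G\hookrightarrow\mathcal F^G\xleftarrow{r}\Phi^G$, where $r$ sends a forest to its $G$-set of roots; i.e. it is the full subcategory of $\Phi^G$ of $G$-forests whose set of roots is a transitive $G$-set. Oplax functors and Grothendieck constructions. For a small category $\mathcal A$, an oplax functor $(F,\tau)\colon\mathcal A^{\mathrm{op}}\to\mathrm{Cat}$ consists of categories $F(a)$; functors $F(f)\colon F(b)\to F(a)$ for $f\colon a\to b$; natural transformations $\tau_{f,g}\colon F(gf)\Rightarrow F(f)F(g)$ and $\tau_a\colon F(\mathrm{id}_a)\Rightarrow\mathrm{id}_{F(a)}$, with $(\tau_{f,g}F(h))\circ\tau_{gf,h}=(F(f)\tau_{g,h})\circ\tau_{f,hg}$ and $(\tau_aF(f))\circ\tau_{\mathrm{id}_a,f}=\mathrm{id}=(F(f)\tau_b)\circ\tau_{f,\mathrm{id}_b}$. It is a pseudofunctor if all $\tau$'s are natural isomorphisms. For an oplax functor, $\int_{\mathcal A^{\mathrm{op}}}F$ has objects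 $(a,x)$, $x\in F(a)$; morphisms $(a,x)\to(b,y)$ are pairs $(f\colon b\to a,\ \alpha\colon F(f)(x)\to y)$; composite of $(f,\alpha)$ followed by $(g,\beta)$ is $(fg,\beta\circ F(g)(\alpha)\circ(\tau_{g,f})_x)$; identities $(\mathrm{id}_a,(\tau_a)_x)$. For a pseudofunctor, $\int^{\mathcal A^{\mathrm{op}}}F$ has the same objects; morphisms $(a,x)\to(b,y)$ are pairs $(f\colon a\to b,\ \alpha\colon x\to F(f)(y))$; composite of $(f,\alpha)$ followed by $(g,\beta)$ is $(gf,\tau_{f,g}^{-1}\circ F(f)(\beta)\circ\alpha)$; the identity of $(a,x)$ is $\mathrm{id}_a$ together with the canonical map $x\cong F(\mathrm{id}_a)(x)$. Grafting. Let $X_+=X\amalg\{+\}$, $Y_+=Y\amalg\{+\}$ be finite pointed sets, $\varphi\colon Y_+\to X_+$ a pointed function, $T$ a tree with a labeling bijection $X\cong\ell(T)$. The $Y$-labeled tree $\varphi^*(T)$ is obtained from $T$ by grafting, onto the leaf labeled $x$ for each $x\in X$, a corolla with leaves labeled by $\varphi^{-1}(x)$ (a stump if empty), and by grafting the root of $T$ onto a leaf of a further corolla whose other leaves are labeled by $\varphi^{-1}(+)\setminus\{+\}$ and whose root is the new root. $\Omega^{\underline{G/H}}$. $\underline{G/H}$ is the action groupoid: objects are cosets $gH$, morphisms $\overline x\colon gH\to xgH$ for $x,g\in G$. $\Omega^{\underline{G/H}}=\mathrm{Fun}(\underline{G/H},\Omega)$; an object $T$ is a family of trees $T_{gH}$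 with compatible isomorphisms $\overline x\colon T_{gH}\to T_{xgH}$, also viewed as a $G$-forest $\coprod_{G/H}T_{gH}$ with leaf $G$-set $\ell(T)=\coprod_{gH}\ell(T_{gH})$. $\mathcal F_{G/H,*}$: objects are finite $G$-sets $A_+$ with $G$-maps $G/H\to A_+\xrightarrow{\alpha_+}G/H$ composing to the identity; morphisms are $G$-maps over and under $G/H$. $A\subseteq A_+$ is the complement of the image of the section, $\alpha=\alpha_+|_A$. Each fiber $\alpha_+^{-1}(gH)$ is pointed by the image of $gH$ under the section. $\mathcal T^{\underline{G/H}}(A,\alpha)$: objects are pairs $(T,\chi)$ with $T\in\Omega^{\underline{G/H}}$ and $\chi\colon A\to\ell(T)$ a $G$-equivariant bijection such that the leaf $\chi(a)$ lies on $T_{\alpha(a)}$ for all $a\in A$; morphisms are the morphisms of $\Omega^{\underline{G/H}}$ (families $f_{gH}\colon T_{gH}\to S_{gH}$) that preserve leaf labels and roots. Oplax functor $\mathcal T^{\underline{G/H}}\colon\mathcal F_{G/H,*}^{\mathrm{op}}\to\mathrm{Cat}$: $(A_+,\alpha_+)\mapsto\mathcal T^{\underline{G/H}}(A,\alpha)$; a morphism $\varphi\colon(A'_+,\alpha'_+)\to(A_+,\alpha_+)$ is sent to the functor $\varphi^*$ with $\varphi^*(T)_{gH}=(\varphi_{gH})^*(T_{gH})$, where $\varphi_{gH}\colon(\alpha'_+)^{-1}(gH)\to\alpha_+^{-1}(gH)$ is the pointed function of fibers; the $G$-action extends that on $T$ and on new leaves is that of $A'$; on morphisms $\varphi^*(f)$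 acts as $f$ on old edges and preserves the new leaf labels and new roots. Structure maps: $\mathrm{id}^*(T)\to T$ is the identity on edges of $T$ and sends each new leaf (resp. root) to the leaf of $T$ with the same label (resp. root); $(\varphi\gamma)^*(T)\to\gamma^*\varphi^*(T)$ is the identity on edges of $T$ and preserves leaf labels and roots. The pseudofunctor $\mathcal O_G^{\mathrm{op}}\to\mathrm{Cat}$ sends $G/H$ to $\int_{\mathcal F_{G/H,*}^{\mathrm{op}}}\mathcal T^{\underline{G/H}}$ and a $G$-map $q\colon G/H\to G/K$ to the functor $q^*$ that sends $(A_+\xrightarrow{\alpha_+}G/K,T)$ to $(q^*A_+\to G/H,\ q^*T)$, where $q^*A_+=G/H\times_{G/K}A_+$, $(q^*T)_{gH}=T_{q(gH)}$ (precomposition with $\underline{G/H}\to\underline{G/K}$), with the labeling induced from that of $T$, and is defined on morphisms by pullback; the structure isomorphisms are the canonical ones coming from the universal property of pullbacks. *)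

theory Defs
  imports "HOL-Algebra.Group_Action" "HOL-Library.FuncSet"
begin

section \<open>Categories, functors, equivalences\<close>

record ('o, 'a) cat =
  Obj :: "'o set"
  Arr :: "'a set"
  Dom :: "'a \<Rightarrow> 'o"
  Cod :: "'a \<Rightarrow> 'o"
  Ident :: "'o \<Rightarrow> 'a"
  Comp :: "'a \<Rightarrow> 'a \<Rightarrow> 'a"

definition homset :: "('o, 'a) cat \<Rightarrow> 'o \<Rightarrow> 'o \<Rightarrow> 'a set" where
  "homset C a b = {f \<in> Arr C. Dom C f = a \<and> Cod C f = b}"

text \<open>\<open>Comp C g f\<close> is \<open>g\<close> after \<open>f\<close>.\<close>

locale category =
  fixes C :: "('o, 'a) cat"
  assumes Dom_in: "f \<in> Arr C \<Longrightarrow> Dom C f \<in> Obj C"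
    and Cod_in: "f \<in> Arr C \<Longrightarrow> Cod C f \<in> Obj C"
    and Ident_in: "a \<in> Obj C \<Longrightarrow> Ident C a \<in> homset C a a"
    and Comp_in: "f \<in> homset C a b \<Longrightarrow> g \<in> homset C b c \<Longrightarrow> Comp C g f \<in> homset C a c"
    and Comp_Ident_left: "f \<in> homset C a b \<Longrightarrow> Comp C (Ident C b) f = f"
    and Comp_Ident_right: "f \<in> homset C a b \<Longrightarrow> Comp C f (Ident C a) = f"
    and Comp_assoc: "f \<in> homset C a b \<Longrightarrow> g \<in> homset C b c \<Longrightarrow> h \<in> homset C c d \<Longrightarrow>
      Comp C h (Comp C g f) = Comp C (Comp C h g) f"

definition is_inverse :: "('o, 'a) cat \<Rightarrow> 'a \<Rightarrow> 'a \<Rightarrow> bool" where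
  "is_inverse C f g \<longleftrightarrow> f \<in> Arr C \<and> g \<in> homset C (Cod C f) (Dom C f) \<and>
     Comp C g f = Ident C (Dom C f) \<and> Comp C f g = Ident C (Cod C f)"

definition inverse_arr :: "('o, 'a) cat \<Rightarrow> 'a \<Rightarrow> 'a" where
  "inverse_arr C f = (THE g. is_inverse C f g)"

record ('o1, 'a1, 'o2, 'a2) funct =
  Fob :: "'o1 \<Rightarrow> 'o2"
  Far :: "'a1 \<Rightarrow> 'a2"

locale cat_functor = C: category C + D: category D
  for C :: "('o1, 'a1) cat" and D :: "('o2, 'a2) cat" +
  fixes F :: "('o1, 'a1, 'o2, 'a2) funct"
  assumes Fob_in: "a \<in> Obj C \<Longrightarrow> Fob F a \<in> Obj D"
    and Far_in: "f \<in> homset C a b \<Longrightarrow> Far F f \<in> homset D (Fob F a) (Fob F b)"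
    and Far_Ident: "a \<in> Obj C \<Longrightarrow> Far F (Ident C a) = Ident D (Fob F a)"
    and Far_Comp: "f \<in> homset C a b \<Longrightarrow> g \<in> homset C b c \<Longrightarrow>
      Far F (Comp C g f) = Comp D (Far F g) (Far F f)"

definition id_funct :: "('o, 'a, 'o, 'a) funct" where
  "id_funct = \<lparr>Fob = id, Far = id\<rparr>"

definition comp_funct ::
    "('o2, 'a2, 'o3, 'a3) funct \<Rightarrow> ('o1, 'a1, 'o2, 'a2) funct \<Rightarrow> ('o1, 'a1, 'o3, 'a3) funct" where
  "comp_funct K F = \<lparr>Fob = Fob K \<circ> Fob F, Far = Far K \<circ> Far F\<rparr>"

locale nat_trans = F: cat_functor C D F + K: cat_functor C D K
  for C :: "('o1, 'a1) cat" and D :: "('o2, 'a2) cat"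
    and F :: "('o1, 'a1, 'o2, 'a2) funct" and K :: "('o1, 'a1, 'o2, 'a2) funct" +
  fixes \<eta> :: "'o1 \<Rightarrow> 'a2"
  assumes component: "a \<in> Obj C \<Longrightarrow> \<eta> a \<in> homset D (Fob F a) (Fob K a)"
    and naturality: "f \<in> homset C a b \<Longrightarrow> Comp D (\<eta> b) (Far F f) = Comp D (Far K f) (\<eta> a)"

definition nat_iso ::
    "('o1, 'a1) cat \<Rightarrow> ('o2, 'a2) cat \<Rightarrow> ('o1, 'a1, 'o2, 'a2) funct \<Rightarrow>
     ('o1, 'a1, 'o2, 'a2) funct \<Rightarrow> ('o1 \<Rightarrow> 'a2) \<Rightarrow> bool" where
  "nat_iso C D F K \<eta> \<longleftrightarrow> nat_trans C D F K \<eta> \<and> (\<forall>a\<in>Obj C. \<exists>g. is_inverse D (\<eta> a) g)"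

definition equivalent_categories :: "('o1, 'a1) cat \<Rightarrow> ('o2, 'a2) cat \<Rightarrow> bool" where
  "equivalent_categories C D \<longleftrightarrow> category C \<and> category D \<and>
     (\<exists>F K \<eta> \<epsilon>. cat_functor C D F \<and> cat_functor D C K \<and>
        nat_iso C C id_funct (comp_funct K F) \<eta> \<and> nat_iso D D (comp_funct F K) id_funct \<epsilon>)"

definition full_subcat :: "('o, 'a) cat \<Rightarrow> ('o \<Rightarrow> bool) \<Rightarrow> ('o, 'a) cat" where
  "full_subcat C P = C\<lparr>Obj := {a \<in> Obj C. P a}, Arr := {f \<in> Arr C. P (Dom C f) \<and> P (Cod C f)}\<rparr>"

text \<open>Apart from (action) groupoids, all categories below have as arrows triples
  (domain, codomain, datum). In \<open>mk_cat Ob H i c\<close>, \<open>H a b\<close> is the set of data of arrows from \<open>a\<close> to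
  \<open>b\<close>, \<open>i a\<close> the datum of the identity, and \<open>c a b d g f\<close> the datum of the composite of
  \<open>f\<close> from \<open>a\<close> to \<open>b\<close> followed by \<open>g\<close> from \<open>b\<close> to \<open>d\<close>.\<close>

type_synonym ('o, 'd) arr = "'o \<times> 'o \<times> 'd"

abbreviation datum :: "('o, 'd) arr \<Rightarrow> 'd" where
  "datum f \<equiv> snd (snd f)"

definition mk_cat :: "'o set \<Rightarrow> ('o \<Rightarrow> 'o \<Rightarrow> 'd set) \<Rightarrow> ('o \<Rightarrow> 'd) \<Rightarrow>
    ('o \<Rightarrow> 'o \<Rightarrow> 'o \<Rightarrow> 'd \<Rightarrow> 'd \<Rightarrow> 'd) \<Rightarrow> ('o, ('o, 'd) arr) cat" where
  "mk_cat Ob H i c = \<lparr>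
     Obj = Ob,
     Arr = {(a, b, f). a \<in> Ob \<and> b \<in> Ob \<and> f \<in> H a b},
     Dom = (\<lambda>f. fst f),
     Cod = (\<lambda>f. fst (snd f)),
     Ident = (\<lambda>a. (a, a, i a)),
     Comp = (\<lambda>g f. (fst f, fst (snd g), c (fst f) (fst g) (fst (snd g)) (datum g) (datum f)))\<rparr>"

text \<open>Functors and transformations are taken extensional, so that equality of objects and arrows
  of the functor category is equality of functors and natural transformations.\<close>

definition functor_cat :: "('o1, 'a1) cat \<Rightarrow> ('o2, 'a2) cat \<Rightarrow>
    (('o1, 'a1, 'o2, 'a2) funct, (('o1, 'a1, 'o2, 'a2) funct, 'o1 \<Rightarrow> 'a2) arr) cat" where
  "functor_cat C D = mk_cat
     {F. cat_functor C D F \<and> Fob F \<in> extensional (Obj C) \<and> Far F \<in> extensional (Arr C)}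
     (\<lambda>F K. {\<eta>. nat_trans C D F K \<eta> \<and> \<eta> \<in> extensional (Obj C)})
     (\<lambda>F. \<lambda>a\<in>Obj C. Ident D (Fob F a))
     (\<lambda>_ _ _ \<theta> \<eta>. \<lambda>a\<in>Obj C. Comp D (\<theta> a) (\<eta> a))"

section \<open>Grothendieck constructions\<close>

text \<open>The data of an oplax functor from the opposite of a category to categories:
  \<open>Pull F f\<close> is the functor from \<open>Fib F b\<close> to \<open>Fib F a\<close> induced by \<open>f\<close> from \<open>a\<close> to \<open>b\<close>;
  \<open>Tcomp F f g x\<close> is the component at \<open>x\<close> of \<open>\<tau>\<^bsub>f,g\<^esub>\<close>, an arrow from \<open>F(gf)(x)\<close> to \<open>F(f)(F(g)(x))\<close>;
  \<open>Tid F a x\<close> is the component at \<open>x\<close> of \<open>\<tau>\<^bsub>a\<^esub>\<close>, an arrow from \<open>F(id)(x)\<close> to \<open>x\<close>.\<close>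

record ('o, 'a, 'x, 'y) oplax =
  Fib :: "'o \<Rightarrow> ('x, 'y) cat"
  Pull :: "'a \<Rightarrow> ('x, 'y, 'x, 'y) funct"
  Tcomp :: "'a \<Rightarrow> 'a \<Rightarrow> 'x \<Rightarrow> 'y"
  Tid :: "'o \<Rightarrow> 'x \<Rightarrow> 'y"

text \<open>The construction \<open>\<integral>\<^bsub>A\<^esub>F\<close> over the opposite of \<open>A\<close>, whose arrows from \<open>(a,x)\<close> to \<open>(b,y)\<close> are pairs of
  an arrow from \<open>b\<close> to \<open>a\<close> and an arrow from \<open>F(f)(x)\<close> to \<open>y\<close>.\<close>

definition oplax_groth :: "('o, 'a) cat \<Rightarrow> ('o, 'a, 'x, 'y) oplax \<Rightarrow>
    ('o \<times> 'x, ('o \<times> 'x, 'a \<times> 'y) arr) cat" where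
  "oplax_groth A F = mk_cat
     {(a, x). a \<in> Obj A \<and> x \<in> Obj (Fib F a)}
     (\<lambda>(a, x) (b, y). {(f, \<alpha>). f \<in> homset A b a \<and> \<alpha> \<in> homset (Fib F b) (Fob (Pull F f) x) y})
     (\<lambda>(a, x). (Ident A a, Tid F a x))
     (\<lambda>(a, x) (b, y) (c, z) (g, \<beta>) (f, \<alpha>).
        (Comp A f g,
         Comp (Fib F c) \<beta> (Comp (Fib F c) (Far (Pull F g) \<alpha>) (Tcomp F g f x))))"

text \<open>The construction for pseudofunctors, whose arrows from \<open>(a,x)\<close> to \<open>(b,y)\<close> are pairs of
  an arrow from \<open>a\<close> to \<open>b\<close> and an arrow from \<open>x\<close> to \<open>F(f)(y)\<close>.\<close>

definition pseudo_groth :: "('o, 'a) cat \<Rightarrow> ('o, 'a, 'x, 'y) oplax \<Rightarrow>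
    ('o \<times> 'x, ('o \<times> 'x, 'a \<times> 'y) arr) cat" where
  "pseudo_groth A F = mk_cat
     {(a, x). a \<in> Obj A \<and> x \<in> Obj (Fib F a)}
     (\<lambda>(a, x) (b, y). {(f, \<alpha>). f \<in> homset A a b \<and> \<alpha> \<in> homset (Fib F a) x (Fob (Pull F f) y)})
     (\<lambda>(a, x). (Ident A a, inverse_arr (Fib F a) (Tid F a x)))
     (\<lambda>(a, x) (b, y) (c, z) (g, \<beta>) (f, \<alpha>).
        (Comp A g f,
         Comp (Fib F a) (inverse_arr (Fib F a) (Tcomp F f g z))
           (Comp (Fib F a) (Far (Pull F f) \<beta>) \<alpha>)))"

section \<open>Trees and the dendroidal category\<close>

text \<open>A universe from which the edges and vertices of trees and the elements of finite G-sets are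
  drawn. It is infinite, so it contains a copy of every finite set, and it is closed under the
  disjoint unions used in grafting (\<open>Old\<close>, \<open>New\<close>, \<open>NewRoot\<close>) and the products with natural
  numbers used in pullbacks (\<open>Prd\<close>).\<close>

datatype tok = Atom nat | Old tok | New tok | NewRoot | Prd (prd_fst: nat) (prd_snd: tok)

text \<open>Each edge has two ends, the upper one and the lower one; \<open>up T e\<close> and \<open>down T e\<close>
  are the vertices attached to them, \<open>None\<close> standing for a loose end. The last two conditions in
  \<open>is_tree\<close> say that the lower end is the one towards the root: the only loose lower end
  is the root, and each vertex has exactly one outgoing edge, i.e. an edge whose upper end is
  attached to it.\<close>

record tree =
  edges :: "tok set"
  verts :: "tok set"
  up :: "tok \<Rightarrow> tok option"
  down :: "tok \<Rightarrow> tok option"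
  tree_root :: tok

definition incident :: "tree \<Rightarrow> tok \<Rightarrow> tok \<Rightarrow> bool" where
  "incident T e v \<longleftrightarrow> up T e = Some v \<or> down T e = Some v"

definition tree_connected :: "tree \<Rightarrow> bool" where
  "tree_connected T \<longleftrightarrow>
     (\<forall>e\<in>edges T. \<forall>e'\<in>edges T. (e, e') \<in> {(d, d'). \<exists>v. incident T d v \<and> incident T d' v}\<^sup>*)"

definition joins :: "tree \<Rightarrow> tok \<Rightarrow> tok \<Rightarrow> tok \<Rightarrow> bool" where
  "joins T e v w \<longleftrightarrow>
     up T e = Some v \<and> down T e = Some w \<or> up T e = Some w \<and> down T e = Some v"

text \<open>Loops are cycles of length 1, and pairs of parallel edges are cycles of length 2.\<close>

definition has_cycle :: "tree \<Rightarrow> bool" where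
  "has_cycle T \<longleftrightarrow> (\<exists>vs es. vs \<noteq> [] \<and> length es = length vs \<and> distinct vs \<and> distinct es \<and>
     (\<forall>k<length vs. joins T (es ! k) (vs ! k) (vs ! (Suc k mod length vs))))"

definition is_tree :: "tree \<Rightarrow> bool" where
  "is_tree T \<longleftrightarrow> finite (edges T) \<and> finite (verts T) \<and>
     (\<forall>e v. incident T e v \<longrightarrow> e \<in> edges T \<and> v \<in> verts T) \<and>
     tree_connected T \<and> \<not> has_cycle T \<and>
     tree_root T \<in> edges T \<and> (\<forall>e\<in>edges T. down T e = None \<longleftrightarrow> e = tree_root T) \<and>
     (\<forall>v\<in>verts T. \<exists>!e. up T e = Some v)"

definition out_edge :: "tree \<Rightarrow> tok \<Rightarrow> tok" where
  "out_edge T v = (THE e. up T e = Some v)"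

definition in_edges :: "tree \<Rightarrow> tok \<Rightarrow> tok set" where
  "in_edges T v = {e \<in> edges T. down T e = Some v}"

definition leaves :: "tree \<Rightarrow> tok set" where
  "leaves T = {e \<in> edges T. up T e = None}"

definition subtree :: "tree \<Rightarrow> tree \<Rightarrow> bool" where
  "subtree S' S \<longleftrightarrow> is_tree S' \<and> edges S' \<subseteq> edges S \<and> verts S' \<subseteq> verts S \<and>
     (\<forall>e\<in>edges S'. \<forall>v\<in>verts S'. (up S' e = Some v \<longleftrightarrow> up S e = Some v) \<and>
                              (down S' e = Some v \<longleftrightarrow> down S e = Some v)) \<and>
     (\<forall>v\<in>verts S'. in_edges S v \<subseteq> edges S')"

definition tree_map :: "tree \<Rightarrow> tree \<Rightarrow> (tok \<Rightarrow> tok) \<Rightarrow> bool" where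
  "tree_map T S f \<longleftrightarrow> f \<in> edges T \<rightarrow>\<^sub>E edges S \<and>
     (\<forall>v\<in>verts T. inj_on f (in_edges T v) \<and>
        (\<exists>S'. subtree S' S \<and> tree_root S' = f (out_edge T v) \<and> leaves S' = f ` in_edges T v))"

type_synonym tree_arr = "(tree, tok \<Rightarrow> tok) arr"

definition Omega :: "(tree, tree_arr) cat" where
  "Omega = mk_cat {T. is_tree T}
     (\<lambda>T S. {f. tree_map T S f})
     (\<lambda>T. \<lambda>e\<in>edges T. e)
     (\<lambda>T _ _ g f. compose (edges T) g f)"

section \<open>Forests, G-sets and the equivariant dendroidal category\<close>

definition finset_cat :: "(nat, (nat, nat \<Rightarrow> nat) arr) cat" where
  "finset_cat = mk_cat {n. n \<ge> 1}
     (\<lambda>n m. {1..n} \<rightarrow>\<^sub>E {1..m})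
     (\<lambda>n. \<lambda>i\<in>{1..n}. i)
     (\<lambda>n _ _ g f. compose {1..n} g f)"

type_synonym forest = "nat \<times> (nat \<Rightarrow> tree)"
type_synonym forest_arr = "(forest, (nat \<Rightarrow> nat) \<times> (nat \<Rightarrow> tree_arr)) arr"

definition forest_cat :: "(forest, forest_arr) cat" where
  "forest_cat = mk_cat {(n, T). n \<ge> 1 \<and> T \<in> {1..n} \<rightarrow>\<^sub>E Obj Omega}
     (\<lambda>(n, T) (m, S). {(\<phi>, f). \<phi> \<in> {1..n} \<rightarrow>\<^sub>E {1..m} \<and>
                               f \<in> (\<Pi>\<^sub>E i\<in>{1..n}. homset Omega (T i) (S (\<phi> i)))})
     (\<lambda>(n, T). (\<lambda>i\<in>{1..n}. i, \<lambda>i\<in>{1..n}. Ident Omega (T i)))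
     (\<lambda>(n, T) _ _ (\<psi>, g) (\<phi>, f).
        (compose {1..n} \<psi> \<phi>, \<lambda>i\<in>{1..n}. Comp Omega (g (\<phi> i)) (f i)))"

definition roots_funct :: "(forest, forest_arr, nat, (nat, nat \<Rightarrow> nat) arr) funct" where
  "roots_funct = \<lparr>Fob = fst, Far = (\<lambda>f. (fst (fst f), fst (fst (snd f)), fst (datum f)))\<rparr>"

definition BG :: "('g, 'm) monoid_scheme \<Rightarrow> (unit, 'g) cat" where
  "BG G = \<lparr>Obj = {()}, Arr = carrier G, Dom = (\<lambda>_. ()), Cod = (\<lambda>_. ()),
           Ident = (\<lambda>_. \<one>\<^bsub>G\<^esub>), Comp = (\<lambda>x y. x \<otimes>\<^bsub>G\<^esub> y)\<rparr>"

type_synonym 'g ordgset = "(unit, 'g, nat, (nat, nat \<Rightarrow> nat) arr) funct"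
type_synonym 'g ordgset_arr = "('g ordgset, unit \<Rightarrow> (nat, nat \<Rightarrow> nat) arr) arr"

definition points :: "'g ordgset \<Rightarrow> nat set" where
  "points X = {1..Fob X ()}"

definition gact :: "'g ordgset \<Rightarrow> 'g \<Rightarrow> nat \<Rightarrow> nat" where
  "gact X x = datum (Far X x)"

definition gmap :: "'g ordgset_arr \<Rightarrow> nat \<Rightarrow> nat" where
  "gmap p = datum (datum p ())"

definition transitive :: "('g, 'm) monoid_scheme \<Rightarrow> 'g ordgset \<Rightarrow> bool" where
  "transitive G X \<longleftrightarrow> (\<forall>i\<in>points X. \<forall>j\<in>points X. \<exists>x\<in>carrier G. gact X x i = j)"

definition orbit_cat :: "('g, 'm) monoid_scheme \<Rightarrow> ('g ordgset, 'g ordgset_arr) cat" where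
  "orbit_cat G = full_subcat (functor_cat (BG G) finset_cat) (transitive G)"

type_synonym 'g gforest = "(unit, 'g, forest, forest_arr) funct"

definition Omega_G ::
    "('g, 'm) monoid_scheme \<Rightarrow> ('g gforest, ('g gforest, unit \<Rightarrow> forest_arr) arr) cat" where
  "Omega_G G = full_subcat (functor_cat (BG G) forest_cat) (\<lambda>T. transitive G (comp_funct roots_funct T))"

section \<open>Grafting\<close>

text \<open>\<open>graft Xp x0 l Yp y0 \<phi> T\<close> is \<open>\<phi>\<^sup>*(T)\<close>, where \<open>Xp\<close> and \<open>Yp\<close> are finite sets pointed by \<open>x0\<close> and
  \<open>y0\<close>, \<open>\<phi>\<close> is a pointed map from \<open>Yp\<close> to \<open>Xp\<close>, and \<open>l\<close> is the labeling of the leaves of \<open>T\<close> by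
  \<open>Xp - {x0}\<close>. Its edges are \<open>Old e\<close> for \<open>e\<close> an edge of \<open>T\<close>, the new leaves \<open>New y\<close>, and the new root;
  its vertices are those of \<open>T\<close>, the vertex \<open>New x\<close> of the corolla grafted onto the leaf \<open>l x\<close>,
  and the vertex \<open>NewRoot\<close> of the corolla onto which the root of \<open>T\<close> is grafted.\<close>

definition graft :: "tok set \<Rightarrow> tok \<Rightarrow> (tok \<Rightarrow> tok) \<Rightarrow> tok set \<Rightarrow> tok \<Rightarrow> (tok \<Rightarrow> tok) \<Rightarrow> tree \<Rightarrow> tree" where
  "graft Xp x0 l Yp y0 \<phi> T = \<lparr>
     edges = Old ` edges T \<union> New ` (Yp - {y0}) \<union> {NewRoot},
     verts = Old ` verts T \<union> New ` (Xp - {x0}) \<union> {NewRoot},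
     up = (\<lambda>d. case d of
         Old e \<Rightarrow> if e \<in> leaves T then Some (New (inv_into (Xp - {x0}) l e))
                  else map_option Old (up T e)
       | NewRoot \<Rightarrow> Some NewRoot
       | _ \<Rightarrow> None),
     down = (\<lambda>d. case d of
         Old e \<Rightarrow> if e = tree_root T then Some NewRoot else map_option Old (down T e)
       | New y \<Rightarrow> if y \<in> Yp - {y0} then Some (if \<phi> y = x0 then NewRoot else New (\<phi> y)) else None
       | _ \<Rightarrow> None),
     tree_root = NewRoot\<rparr>"

text \<open>The function on the edges of a grafted tree given by \<open>f\<close> on the edges of \<open>T\<close>, by \<open>h\<close> on the new
  leaves, and by \<open>r\<close> on the new root.\<close>

definition on_graft :: "(tok \<Rightarrow> tok) \<Rightarrow> (tok \<Rightarrow> tok) \<Rightarrow> tok \<Rightarrow> tok \<Rightarrow> tok" where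
  "on_graft f h r d = (case d of Old e \<Rightarrow> f e | New y \<Rightarrow> h y | NewRoot \<Rightarrow> r | _ \<Rightarrow> undefined)"

section \<open>The oplax functor of labeled trees over an orbit\<close>

text \<open>Throughout, the orbit \<open>G/H\<close> is an object \<open>X\<close> of the orbit category, i.e. a transitive G-set
  with underlying set \<open>{1..n}\<close>. In the action groupoid,
  the arrow \<open>(x, i)\<close> goes from \<open>i\<close> to its translate by \<open>x\<close>.\<close>

definition action_groupoid :: "('g, 'm) monoid_scheme \<Rightarrow> 'g ordgset \<Rightarrow> (nat, 'g \<times> nat) cat" where
  "action_groupoid G X = \<lparr>
     Obj = points X,
     Arr = carrier G \<times> points X,
     Dom = (\<lambda>(x, i). i),
     Cod = (\<lambda>(x, i). gact X x i),
     Ident = (\<lambda>i. (\<one>\<^bsub>G\<^esub>, i)),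
     Comp = (\<lambda>(y, j) (x, i). (y \<otimes>\<^bsub>G\<^esub> x, i))\<rparr>"

type_synonym 'g treefam = "(nat, 'g \<times> nat, tree, tree_arr) funct"
type_synonym 'g treefam_arr = "('g treefam, nat \<Rightarrow> tree_arr) arr"

definition Omega_orbit :: "('g, 'm) monoid_scheme \<Rightarrow> 'g ordgset \<Rightarrow> ('g treefam, 'g treefam_arr) cat" where
  "Omega_orbit G X = functor_cat (action_groupoid G X) Omega"

text \<open>Finite G-sets \<open>A\<^sub>+\<close> over and under \<open>X\<close>.\<close>

record 'g retr =
  pts :: "tok set"
  ract :: "'g \<Rightarrow> tok \<Rightarrow> tok"
  sect :: "nat \<Rightarrow> tok"
  proj :: "tok \<Rightarrow> nat"

definition is_retr :: "('g, 'm) monoid_scheme \<Rightarrow> 'g ordgset \<Rightarrow> 'g retr \<Rightarrow> bool" where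
  "is_retr G X A \<longleftrightarrow> finite (pts A) \<and> group_action G (pts A) (ract A) \<and>
     ract A \<in> extensional (carrier G) \<and>
     sect A \<in> points X \<rightarrow>\<^sub>E pts A \<and> proj A \<in> pts A \<rightarrow>\<^sub>E points X \<and>
     (\<forall>x\<in>carrier G. \<forall>i\<in>points X. sect A (gact X x i) = ract A x (sect A i)) \<and>
     (\<forall>x\<in>carrier G. \<forall>a\<in>pts A. proj A (ract A x a) = gact X x (proj A a)) \<and>
     (\<forall>i\<in>points X. proj A (sect A i) = i)"

definition retr_map :: "('g, 'm) monoid_scheme \<Rightarrow> 'g ordgset \<Rightarrow> 'g retr \<Rightarrow> 'g retr \<Rightarrow> (tok \<Rightarrow> tok) \<Rightarrow> bool" where
  "retr_map G X A B \<phi> \<longleftrightarrow> \<phi> \<in> pts A \<rightarrow>\<^sub>E pts B \<and>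
     (\<forall>x\<in>carrier G. \<forall>a\<in>pts A. \<phi> (ract A x a) = ract B x (\<phi> a)) \<and>
     (\<forall>a\<in>pts A. proj B (\<phi> a) = proj A a) \<and>
     (\<forall>i\<in>points X. \<phi> (sect A i) = sect B i)"

type_synonym 'g retr_arr = "('g retr, tok \<Rightarrow> tok) arr"

definition retr_cat :: "('g, 'm) monoid_scheme \<Rightarrow> 'g ordgset \<Rightarrow> ('g retr, 'g retr_arr) cat" where
  "retr_cat G X = mk_cat {A. is_retr G X A}
     (\<lambda>A B. {\<phi>. retr_map G X A B \<phi>})
     (\<lambda>A. \<lambda>a\<in>pts A. a)
     (\<lambda>A _ _ \<psi> \<phi>. compose (pts A) \<psi> \<phi>)"

text \<open>\<open>labels X A\<close> is the complement \<open>A\<close> of the section in \<open>A\<^sub>+\<close>.\<close>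

definition labels :: "'g ordgset \<Rightarrow> 'g retr \<Rightarrow> tok set" where
  "labels X A = pts A - sect A ` points X"

definition fiber :: "'g retr \<Rightarrow> nat \<Rightarrow> tok set" where
  "fiber A i = {a \<in> pts A. proj A a = i}"

definition fam_leaves :: "'g ordgset \<Rightarrow> 'g treefam \<Rightarrow> (nat \<times> tok) set" where
  "fam_leaves X T = (SIGMA i:points X. leaves (Fob T i))"

definition leaf_act :: "'g ordgset \<Rightarrow> 'g treefam \<Rightarrow> 'g \<Rightarrow> nat \<times> tok \<Rightarrow> nat \<times> tok" where
  "leaf_act X T x = (\<lambda>(i, e). (gact X x i, datum (Far T (x, i)) e))"

definition labeling :: "('g, 'm) monoid_scheme \<Rightarrow> 'g ordgset \<Rightarrow> 'g retr \<Rightarrow> 'g treefam \<Rightarrow>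
    (tok \<Rightarrow> nat \<times> tok) \<Rightarrow> bool" where
  "labeling G X A T \<chi> \<longleftrightarrow> \<chi> \<in> extensional (labels X A) \<and>
     bij_betw \<chi> (labels X A) (fam_leaves X T) \<and>
     (\<forall>x\<in>carrier G. \<forall>a\<in>labels X A. \<chi> (ract A x a) = leaf_act X T x (\<chi> a)) \<and>
     (\<forall>a\<in>labels X A. fst (\<chi> a) = proj A a)"

type_synonym 'g ltree = "'g treefam \<times> (tok \<Rightarrow> nat \<times> tok)"
type_synonym 'g ltree_arr = "('g ltree, 'g treefam_arr) arr"

definition edge_map :: "'g treefam_arr \<Rightarrow> nat \<Rightarrow> tok \<Rightarrow> tok" where
  "edge_map \<eta> i = datum (datum \<eta> i)"

definition ltree_cat :: "('g, 'm) monoid_scheme \<Rightarrow> 'g ordgset \<Rightarrow> 'g retr \<Rightarrow> ('g ltree, 'g ltree_arr) cat" where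
  "ltree_cat G X A = mk_cat
     {(T, \<chi>). T \<in> Obj (Omega_orbit G X) \<and> labeling G X A T \<chi>}
     (\<lambda>(T, \<chi>) (S, \<psi>). {\<eta> \<in> homset (Omega_orbit G X) T S.
        (\<forall>a\<in>labels X A. edge_map \<eta> (proj A a) (snd (\<chi> a)) = snd (\<psi> a)) \<and>
        (\<forall>i\<in>points X. edge_map \<eta> i (tree_root (Fob T i)) = tree_root (Fob S i))})
     (\<lambda>(T, \<chi>). Ident (Omega_orbit G X) T)
     (\<lambda>_ _ _ \<theta> \<eta>. Comp (Omega_orbit G X) \<theta> \<eta>)"

definition ltree_arr :: "'g ordgset \<Rightarrow> 'g ltree \<Rightarrow> 'g ltree \<Rightarrow> (nat \<Rightarrow> tok \<Rightarrow> tok) \<Rightarrow> 'g ltree_arr" where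
  "ltree_arr X s t k = (s, t, (fst s, fst t,
     \<lambda>i\<in>points X. (Fob (fst s) i, Fob (fst t) i, \<lambda>e\<in>edges (Fob (fst s) i). k i e)))"

definition graft_at :: "'g retr_arr \<Rightarrow> 'g ltree \<Rightarrow> nat \<Rightarrow> tree" where
  "graft_at = (\<lambda>(A', A, \<phi>) (T, \<chi>) i.
     graft (fiber A i) (sect A i) (\<lambda>a. snd (\<chi> a)) (fiber A' i) (sect A' i) \<phi> (Fob T i))"

definition graft_obj :: "('g, 'm) monoid_scheme \<Rightarrow> 'g ordgset \<Rightarrow> 'g retr_arr \<Rightarrow> 'g ltree \<Rightarrow> 'g ltree" where
  "graft_obj G X \<phi> s = (let A' = fst \<phi> in
     (\<lparr>Fob = (\<lambda>i\<in>points X. graft_at \<phi> s i),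
       Far = (\<lambda>(x, i)\<in>carrier G \<times> points X.
         (graft_at \<phi> s i, graft_at \<phi> s (gact X x i),
          \<lambda>e\<in>edges (graft_at \<phi> s i).
            on_graft (\<lambda>e. Old (datum (Far (fst s) (x, i)) e)) (\<lambda>a. New (ract A' x a)) NewRoot e))\<rparr>,
      \<lambda>a\<in>labels X A'. (proj A' a, New a)))"

definition graft_arr :: "('g, 'm) monoid_scheme \<Rightarrow> 'g ordgset \<Rightarrow> 'g retr_arr \<Rightarrow> 'g ltree_arr \<Rightarrow> 'g ltree_arr" where
  "graft_arr G X \<phi> = (\<lambda>(s, t, \<eta>).
     ltree_arr X (graft_obj G X \<phi> s) (graft_obj G X \<phi> t)
       (\<lambda>i. on_graft (\<lambda>e. Old (edge_map \<eta> i e)) New NewRoot))"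

definition ltree_oplax ::
    "('g, 'm) monoid_scheme \<Rightarrow> 'g ordgset \<Rightarrow> ('g retr, 'g retr_arr, 'g ltree, 'g ltree_arr) oplax" where
  "ltree_oplax G X = \<lparr>
     Fib = ltree_cat G X,
     Pull = (\<lambda>\<phi>. \<lparr>Fob = graft_obj G X \<phi>, Far = graft_arr G X \<phi>\<rparr>),
     Tcomp = (\<lambda>\<gamma> \<phi> s.
       ltree_arr X (graft_obj G X (Comp (retr_cat G X) \<phi> \<gamma>) s) (graft_obj G X \<gamma> (graft_obj G X \<phi> s))
         (\<lambda>i. on_graft (\<lambda>e. Old (Old e)) New NewRoot)),
     Tid = (\<lambda>A s.
       ltree_arr X (graft_obj G X (Ident (retr_cat G X) A) s) s
         (\<lambda>i. on_graft (\<lambda>e. e) (\<lambda>a. snd (snd s a)) (tree_root (Fob (fst s) i))))\<rparr>"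

type_synonym 'g gobj = "'g retr \<times> 'g ltree"
type_synonym 'g garr = "('g gobj, 'g retr_arr \<times> 'g ltree_arr) arr"

definition orbit_groth :: "('g, 'm) monoid_scheme \<Rightarrow> 'g ordgset \<Rightarrow> ('g gobj, 'g garr) cat" where
  "orbit_groth G X = oplax_groth (retr_cat G X) (ltree_oplax G X)"

section \<open>The pseudofunctor on the orbit category\<close>

text \<open>In this section \<open>p\<close> is an arrow of the orbit category with domain \<open>fst p\<close>. The pullback of
  \<open>A\<^sub>+\<close> along \<open>p\<close> consists of the pairs \<open>Prd i a\<close> such that \<open>a\<close> lies over \<open>p(i)\<close>.\<close>

definition pb_retr :: "('g, 'm) monoid_scheme \<Rightarrow> 'g ordgset_arr \<Rightarrow> 'g retr \<Rightarrow> 'g retr" where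
  "pb_retr G p A = (let X = fst p; P = {Prd i a | i a. i \<in> points X \<and> a \<in> pts A \<and> proj A a = gmap p i} in
     \<lparr>pts = P,
      ract = (\<lambda>x\<in>carrier G. \<lambda>c\<in>P. Prd (gact X x (prd_fst c)) (ract A x (prd_snd c))),
      sect = (\<lambda>i\<in>points X. Prd i (sect A (gmap p i))),
      proj = (\<lambda>c\<in>P. prd_fst c)\<rparr>)"

definition pb_obj :: "('g, 'm) monoid_scheme \<Rightarrow> 'g ordgset_arr \<Rightarrow> 'g gobj \<Rightarrow> 'g gobj" where
  "pb_obj G p = (\<lambda>(A, T, \<chi>). let X = fst p in
     (pb_retr G p A,
      \<lparr>Fob = (\<lambda>i\<in>points X. Fob T (gmap p i)),
       Far = (\<lambda>(x, i)\<in>carrier G \<times> points X. Far T (x, gmap p i))\<rparr>,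
      \<lambda>c\<in>labels X (pb_retr G p A). (prd_fst c, snd (\<chi> (prd_snd c)))))"

text \<open>The pullback of an arrow consisting of \<open>\<phi>\<close> from \<open>B\<^sub>+\<close> to \<open>A\<^sub>+\<close> and \<open>\<alpha>\<close> from \<open>\<phi>\<^sup>*(T)\<close> to \<open>S\<close>
  consists of the pullback \<open>p\<^sup>*\<phi>\<close> and of the pullback of \<open>\<alpha>\<close>, precomposed with the canonical
  isomorphism from \<open>(p\<^sup>*\<phi>)\<^sup>*(p\<^sup>*T)\<close> to \<open>p\<^sup>*(\<phi>\<^sup>*T)\<close>, which sends the new leaf \<open>Prd i b\<close> to the new
  leaf \<open>b\<close>.\<close>

definition pb_arr :: "('g, 'm) monoid_scheme \<Rightarrow> 'g ordgset_arr \<Rightarrow> 'g garr \<Rightarrow> 'g garr" where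
  "pb_arr G p = (\<lambda>(s, t, ((B, A, \<phi>), \<alpha>)).
     let s' = pb_obj G p s; t' = pb_obj G p t; B' = pb_retr G p B; A' = pb_retr G p A;
         \<phi>' = (B', A', \<lambda>c\<in>pts B'. Prd (prd_fst c) (\<phi> (prd_snd c)))
     in (s', t', (\<phi>', ltree_arr (fst p) (graft_obj G (fst p) \<phi>' (snd s')) (snd t')
          (\<lambda>i e. edge_map (datum \<alpha>) (gmap p i) (on_graft Old (\<lambda>c. New (prd_snd c)) NewRoot e)))))"

text \<open>The arrow from \<open>(A\<^sub>+, T)\<close> to \<open>(B\<^sub>+, T)\<close> given by an isomorphism \<open>f\<close> from \<open>B\<^sub>+\<close> to \<open>A\<^sub>+\<close> compatible
  with the labelings of \<open>T\<close>; its second component sends each new leaf of \<open>f\<^sup>*(T)\<close> to the leaf of \<open>T\<close>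
  with the same label in \<open>B\<close>, as for the structure map from \<open>id\<^sup>*(T)\<close> to \<open>T\<close>.\<close>

definition relabel :: "('g, 'm) monoid_scheme \<Rightarrow> 'g ordgset \<Rightarrow> 'g gobj \<Rightarrow> 'g gobj \<Rightarrow> (tok \<Rightarrow> tok) \<Rightarrow> 'g garr" where
  "relabel G X s t f = (let \<phi> = (fst t, fst s, \<lambda>b\<in>pts (fst t). f b) in
     (s, t, (\<phi>, ltree_arr X (graft_obj G X \<phi> (snd s)) (snd t)
       (\<lambda>i. on_graft (\<lambda>e. e) (\<lambda>b. snd (snd (snd t) b)) (tree_root (Fob (fst (snd t)) i))))))"

definition orbit_pseudo ::
    "('g, 'm) monoid_scheme \<Rightarrow> ('g ordgset, 'g ordgset_arr, 'g gobj, 'g garr) oplax" where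
  "orbit_pseudo G = \<lparr>
     Fib = orbit_groth G,
     Pull = (\<lambda>p. \<lparr>Fob = pb_obj G p, Far = pb_arr G p\<rparr>),
     Tcomp = (\<lambda>p q s.
       relabel G (fst p) (pb_obj G (Comp (orbit_cat G) q p) s) (pb_obj G p (pb_obj G q s))
         (\<lambda>c. Prd (prd_fst c) (prd_snd (prd_snd c)))),
     Tid = (\<lambda>X s.
       relabel G X (pb_obj G (Ident (orbit_cat G) X) s) s (\<lambda>a. Prd (proj (fst s) a) a))\<rparr>"

end

theory Submission
  imports Defs
begin

text \<open>A set of edges is the set of leaves of a subtree with a given root exactly if it is an
  antichain above the root and every leaf above the root lies above one of its elements. In this
  description of the maps of trees, a map out of a grafted tree \<open>\<phi>\<^sup>*(T)\<close>
  that preserves labels and roots is the same thing as a map \<open>k\<close> out of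
  \<open>T\<close>: the map \<open>\<phi>\<close> has to send a label to the unique leaf of
  \<open>T\<close> whose image lies below it, if there is one, and to the base point otherwise.
  Restriction to the old edges therefore makes the Grothendieck construction over an orbit fully
  faithful over the families of trees indexed by the orbit. A map of \<open>G\<close>-forests
  consists of a map \<open>p\<close> of their sets of roots and a map of families into the pullback
  along \<open>p\<close>, so the total construction is fully faithful over
  \<open>\<Omega>\<^sub>G\<close>. It is also surjective on objects, because the leaves of any
  family can be labeled by themselves.\<close>

section \<open>Categories\<close>

text \<open>The obstacle is the coherence hidden in the right-hand side: unit and associativity laws
  of two nested Grothendieck constructions, the inner one over an oplax functor whose structure maps
  are not invertible, the outer one with inverses of structure isomorphisms in its identities and
  composites. None of these laws is checked directly. An arrow of the inner construction is brought
  to a normal form in which only its action \<open>k\<close> on old edges matters; composition then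
  is composition of the \<open>k\<close>, and the laws are inherited from families of trees. The
  base point is what lets \<phi> exist for every \<open>k\<close>: a leaf of the target that lies
  above no \<open>k\<close>-image of a leaf does not lie above the image of the root either, so it
  belongs to the corolla grafted below the root.\<close>

lemma homsetD: "f \<in> homset C a b \<Longrightarrow> f \<in> Arr C \<and> Dom C f = a \<and> Cod C f = b"
  by (simp add: homset_def)

section \<open>Categories presented by data of arrows, full subcategories, functor
  categories\<close>

lemma mk_cat_simps [simp]:
  "Obj (mk_cat Ob H i c) = Ob"
  "Dom (mk_cat Ob H i c) f = fst f"
  "Cod (mk_cat Ob H i c) f = fst (snd f)"
  "Ident (mk_cat Ob H i c) a = (a, a, i a)"
  "Comp (mk_cat Ob H i c) g f =
     (fst f, fst (snd g), c (fst f) (fst g) (fst (snd g)) (datum g) (datum f))"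
  by (simp_all add: mk_cat_def)

lemma homset_mk_cat: "f \<in> homset (mk_cat Ob H i c) a b \<longleftrightarrow>
    a \<in> Ob \<and> b \<in> Ob \<and> (\<exists>d \<in> H a b. f = (a, b, d))"
  by (auto simp: homset_def mk_cat_def)

lemma Arr_mk_cat: "f \<in> Arr (mk_cat Ob H i c) \<longleftrightarrow>
    fst f \<in> Ob \<and> fst (snd f) \<in> Ob \<and> datum f \<in> H (fst f) (fst (snd f))"
  by (auto simp: mk_cat_def split: prod.splits)

text \<open>Arrows carry their domain and codomain, so only the laws for the data remain to be
  assumed.\<close>

lemma category_mk_cat:
  assumes "\<And>a. a \<in> Ob \<Longrightarrow> i a \<in> H a a"
    and "\<And>a b d f g. \<lbrakk>a \<in> Ob; b \<in> Ob; d \<in> Ob; f \<in> H a b; g \<in> H b d\<rbrakk> \<Longrightarrow> c a b d g f \<in> H a d"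
    and "\<And>a b f. \<lbrakk>a \<in> Ob; b \<in> Ob; f \<in> H a b\<rbrakk> \<Longrightarrow> c a b b (i b) f = f"
    and "\<And>a b f. \<lbrakk>a \<in> Ob; b \<in> Ob; f \<in> H a b\<rbrakk> \<Longrightarrow> c a a b f (i a) = f"
    and "\<And>a b d k f g h. \<lbrakk>a \<in> Ob; b \<in> Ob; d \<in> Ob; k \<in> Ob; f \<in> H a b; g \<in> H b d; h \<in> H d k\<rbrakk> \<Longrightarrow>
      c a d k h (c a b d g f) = c a b k (c b d k h g) f"
  shows "category (mk_cat Ob H i c)"
proof
  fix f
  assume f: "f \<in> Arr (mk_cat Ob H i c)"
  then show "Dom (mk_cat Ob H i c) f \<in> Obj (mk_cat Ob H i c)"
    by (simp add: Arr_mk_cat)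
  from f show "Cod (mk_cat Ob H i c) f \<in> Obj (mk_cat Ob H i c)"
    by (simp add: Arr_mk_cat)
qed (use assms in \<open>auto simp: homset_mk_cat\<close>)

lemma category_full_subcat:
  assumes "category C"
  shows "category (full_subcat C P)"
proof -
  interpret category C by fact
  have h: "f \<in> homset (full_subcat C P) a b \<longleftrightarrow> f \<in> homset C a b \<and> P a \<and> P b" for f a b
    by (auto simp: homset_def full_subcat_def)
  show ?thesis
  proof
    show "Dom (full_subcat C P) f \<in> Obj (full_subcat C P)" if "f \<in> Arr (full_subcat C P)" for f
      using that by (simp add: full_subcat_def Dom_in)
    show "Cod (full_subcat C P) f \<in> Obj (full_subcat C P)" if "f \<in> Arr (full_subcat C P)" for f
      using that by (simp add: full_subcat_def Cod_in)
    show "Ident (full_subcat C P) a \<in> homset (full_subcat C P) a a" if "a \<in> Obj (full_subcat C P)" for a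
      using that by (simp add: h) (simp add: full_subcat_def Ident_in)
    show "Comp (full_subcat C P) g f \<in> homset (full_subcat C P) a c"
      if "f \<in> homset (full_subcat C P) a b" "g \<in> homset (full_subcat C P) b c" for f g a b c
      using that by (simp add: h) (auto simp: full_subcat_def intro: Comp_in)
  qed (unfold h, auto simp: full_subcat_def Comp_Ident_left Comp_Ident_right Comp_assoc)
qed

lemma homset_full_subcat:
  "f \<in> homset (full_subcat C P) a b \<longleftrightarrow> f \<in> homset C a b \<and> P a \<and> P b"
  by (auto simp: homset_def full_subcat_def)

lemma full_subcat_simps [simp]:
  "Obj (full_subcat C P) = {a \<in> Obj C. P a}"
  "Dom (full_subcat C P) = Dom C"
  "Cod (full_subcat C P) = Cod C"
  "Ident (full_subcat C P) = Ident C"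
  "Comp (full_subcat C P) = Comp C"
  by (simp_all add: full_subcat_def)

lemma Obj_functor_cat: "F \<in> Obj (functor_cat C D) \<longleftrightarrow>
    cat_functor C D F \<and> Fob F \<in> extensional (Obj C) \<and> Far F \<in> extensional (Arr C)"
  by (simp add: functor_cat_def)

lemma homset_functor_cat: "\<eta> \<in> homset (functor_cat C D) F K \<longleftrightarrow>
    F \<in> Obj (functor_cat C D) \<and> K \<in> Obj (functor_cat C D) \<and>
    (\<exists>\<theta> \<in> extensional (Obj C). \<eta> = (F, K, \<theta>) \<and>
      (\<forall>a\<in>Obj C. \<theta> a \<in> homset D (Fob F a) (Fob K a)) \<and>
      (\<forall>f a b. f \<in> homset C a b \<longrightarrow> Comp D (\<theta> b) (Far F f) = Comp D (Far K f) (\<theta> a)))"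
  by (fastforce simp: functor_cat_def homset_mk_cat nat_trans_def nat_trans_axioms_def)

lemma Ident_functor_cat: "Ident (functor_cat C D) F = (F, F, \<lambda>a\<in>Obj C. Ident D (Fob F a))"
  by (simp add: functor_cat_def)

lemma Comp_functor_cat: "Comp (functor_cat C D) g f =
    (fst f, fst (snd g), \<lambda>a\<in>Obj C. Comp D (datum g a) (datum f a))"
  by (simp add: functor_cat_def)

lemma category_functor_cat:
  assumes "category C" and "category D"
  shows "category (functor_cat C D)"
proof -
  interpret C: category C by fact
  interpret D: category D by fact
  have homob: "a \<in> Obj C \<and> b \<in> Obj C" if "f \<in> homset C a b" for f a b
    using that C.Dom_in C.Cod_in homsetD by metis
  show ?thesis
    unfolding functor_cat_def
  proof ((rule category_mk_cat; clarify?), goal_cases)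
    case (1 F)
    then interpret F: cat_functor C D F by blast
    have "nat_trans C D F F (\<lambda>a\<in>Obj C. Ident D (Fob F a))"
      using F.Fob_in F.Far_in homob
      by unfold_locales
        (auto simp: D.Ident_in D.Comp_Ident_left[OF F.Far_in] D.Comp_Ident_right[OF F.Far_in])
    then show ?case by simp
  next
    case (2 F K M \<eta> \<theta>)
    interpret e: nat_trans C D F K \<eta> by fact
    interpret t: nat_trans C D K M \<theta> by fact
    have "nat_trans C D F M (\<lambda>a\<in>Obj C. Comp D (\<theta> a) (\<eta> a))"
    proof
      show "(\<lambda>a\<in>Obj C. Comp D (\<theta> a) (\<eta> a)) a \<in> homset D (Fob F a) (Fob M a)" if "a \<in> Obj C" for a
        using that D.Comp_in[OF e.component t.component] by simp
      fix f a b
      assume f: "f \<in> homset C a b"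
      then have ab: "a \<in> Obj C" "b \<in> Obj C" using homob by blast+
      have "Comp D (Comp D (\<theta> b) (\<eta> b)) (Far F f) = Comp D (\<theta> b) (Comp D (\<eta> b) (Far F f))"
        using D.Comp_assoc[OF e.F.Far_in[OF f] e.component t.component] ab by simp
      also have "\<dots> = Comp D (\<theta> b) (Comp D (Far K f) (\<eta> a))"
        using e.naturality[OF f] by simp
      also have "\<dots> = Comp D (Comp D (\<theta> b) (Far K f)) (\<eta> a)"
        using D.Comp_assoc[OF e.component e.K.Far_in[OF f] t.component] ab by simp
      also have "\<dots> = Comp D (Comp D (Far M f) (\<theta> a)) (\<eta> a)"
        using t.naturality[OF f] by simp
      also have "\<dots> = Comp D (Far M f) (Comp D (\<theta> a) (\<eta> a))"
        using D.Comp_assoc[OF e.component t.component t.K.Far_in[OF f]] ab by simp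
      finally show "Comp D ((\<lambda>a\<in>Obj C. Comp D (\<theta> a) (\<eta> a)) b) (Far F f) =
          Comp D (Far M f) ((\<lambda>a\<in>Obj C. Comp D (\<theta> a) (\<eta> a)) a)"
        using ab by simp
    qed
    then show ?case by simp
  next
    case (3 F K \<eta>)
    interpret e: nat_trans C D F K \<eta> by fact
    from 3 show ?case
      by (intro extensionalityI[where A = "Obj C"])
        (auto intro: D.Comp_Ident_left e.component)
  next
    case (4 F K \<eta>)
    interpret e: nat_trans C D F K \<eta> by fact
    from 4 show ?case
      by (intro extensionalityI[where A = "Obj C"])
        (auto intro: D.Comp_Ident_right e.component)
  next
    case (5 F K M N \<eta> \<theta> \<kappa>)
    interpret e: nat_trans C D F K \<eta> by fact
    interpret t: nat_trans C D K M \<theta> by fact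
    interpret k: nat_trans C D M N \<kappa> by fact
    show ?case
      by (rule restrict_ext) (simp add: D.Comp_assoc[OF e.component t.component k.component])
  qed
qed

text \<open>\<open>D\<close> is not assumed to be a category: the axioms are inherited from \<open>C\<close>, so that they need not be
  checked for the Grothendieck constructions.\<close>

locale fully_faithful = C: category C
  for C :: "('o1, 'a1) cat" and D :: "('o2, 'a2) cat" and U :: "('o2, 'a2, 'o1, 'a1) funct" +
  assumes D_Dom_in: "f \<in> Arr D \<Longrightarrow> Dom D f \<in> Obj D"
    and D_Cod_in: "f \<in> Arr D \<Longrightarrow> Cod D f \<in> Obj D"
    and D_Ident_in: "a \<in> Obj D \<Longrightarrow> Ident D a \<in> homset D a a"
    and D_Comp_in: "f \<in> homset D a b \<Longrightarrow> g \<in> homset D b c \<Longrightarrow> Comp D g f \<in> homset D a c"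
    and U_ob: "a \<in> Obj D \<Longrightarrow> Fob U a \<in> Obj C"
    and U_bij: "a \<in> Obj D \<Longrightarrow> b \<in> Obj D \<Longrightarrow>
      bij_betw (Far U) (homset D a b) (homset C (Fob U a) (Fob U b))"
    and U_Ident: "a \<in> Obj D \<Longrightarrow> Far U (Ident D a) = Ident C (Fob U a)"
    and U_Comp: "f \<in> homset D a b \<Longrightarrow> g \<in> homset D b c \<Longrightarrow>
      Far U (Comp D g f) = Comp C (Far U g) (Far U f)"
begin

section \<open>Transport of structure along a fully faithful functor\<close>

lemma D_homset_Obj: "f \<in> homset D a b \<Longrightarrow> a \<in> Obj D \<and> b \<in> Obj D"
  using D_Dom_in D_Cod_in homsetD by metis

lemma U_in: "f \<in> homset D a b \<Longrightarrow> Far U f \<in> homset C (Fob U a) (Fob U b)"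
  using U_bij D_homset_Obj by (metis bij_betwE)

lemma U_inj: "f \<in> homset D a b \<Longrightarrow> g \<in> homset D a b \<Longrightarrow> Far U f = Far U g \<Longrightarrow> f = g"
  using U_bij D_homset_Obj by (metis bij_betw_imp_inj_on inj_onD)

lemma U_lift:
  assumes "a \<in> Obj D" "b \<in> Obj D" "h \<in> homset C (Fob U a) (Fob U b)"
  shows "\<exists>f \<in> homset D a b. Far U f = h"
  using U_bij[OF assms(1,2)] assms(3) by (metis bij_betw_imp_surj_on imageE)

text \<open>Each law equates two parallel arrows of \<open>D\<close>; by \<open>U_inj\<close> their
  images may be compared instead, and there \<open>U_Comp\<close> and \<open>U_Ident\<close> turn it
  into the same law of \<open>C\<close>.\<close>

lemma category_D: "category D"
proof
  show "Comp D (Ident D b) f = f" if "f \<in> homset D a b" for f a b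
    using that D_homset_Obj[OF that]
    by (intro U_inj[of _ a b])
      (auto intro: D_Comp_in D_Ident_in simp: U_Comp[OF that D_Ident_in] U_Ident C.Comp_Ident_left[OF U_in])
  show "Comp D f (Ident D a) = f" if "f \<in> homset D a b" for f a b
    using that D_homset_Obj[OF that]
    by (intro U_inj[of _ a b])
      (auto intro: D_Comp_in D_Ident_in simp: U_Comp[OF D_Ident_in that] U_Ident C.Comp_Ident_right[OF U_in])
  show "Comp D h (Comp D g f) = Comp D (Comp D h g) f"
    if f: "f \<in> homset D a b" and g: "g \<in> homset D b c" and h: "h \<in> homset D c d" for f g h a b c d
  proof (rule U_inj[of _ a d])
    show "Far U (Comp D h (Comp D g f)) = Far U (Comp D (Comp D h g) f)"
      using U_Comp[OF D_Comp_in[OF f g] h] U_Comp[OF f D_Comp_in[OF g h]] U_Comp[OF f g] U_Comp[OF g h]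
        C.Comp_assoc[OF U_in[OF f] U_in[OF g] U_in[OF h]] by simp
  qed (use D_Comp_in f g h in blast)+
qed (use D_Dom_in D_Cod_in D_Ident_in D_Comp_in in auto)

text \<open>The preimage of the inverse of \<open>Far U f\<close> is inverse to \<open>f\<close>,
  and it is the only such arrow, so the definite description in \<open>inverse_arr\<close> denotes
  it. This makes the inverses in \<open>pseudo_groth\<close> accessible through their images under
  \<open>U\<close>.\<close>

lemma lift_inverse:
  assumes f: "f \<in> homset D a b" and inv: "is_inverse C (Far U f) h"
  shows "inverse_arr D f \<in> homset D b a" "Far U (inverse_arr D f) = h" "is_inverse D f (inverse_arr D f)"
proof -
  have ab: "a \<in> Obj D" "b \<in> Obj D" using D_homset_Obj[OF f] by auto
  have fD: "f \<in> Arr D" "Dom D f = a" "Cod D f = b" using homsetD[OF f] by auto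
  have UD: "Dom C (Far U f) = Fob U a" "Cod C (Far U f) = Fob U b" using homsetD[OF U_in[OF f]] by auto
  have h: "h \<in> homset C (Fob U b) (Fob U a)" "Comp C h (Far U f) = Ident C (Fob U a)"
      "Comp C (Far U f) h = Ident C (Fob U b)"
    using inv by (auto simp: is_inverse_def UD)
  obtain g where g: "g \<in> homset D b a" "Far U g = h"
    using U_lift[OF ab(2,1) h(1)] by auto
  have g_inv: "is_inverse D f g"
    unfolding is_inverse_def fD
  proof (intro conjI fD g)
    show "Comp D g f = Ident D a"
      by (rule U_inj[OF D_Comp_in[OF f g(1)] D_Ident_in[OF ab(1)]])
        (simp add: U_Comp[OF f g(1)] g h U_Ident ab)
    show "Comp D f g = Ident D b"
      by (rule U_inj[OF D_Comp_in[OF g(1) f] D_Ident_in[OF ab(2)]])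
        (simp add: U_Comp[OF g(1) f] g h U_Ident ab)
  qed
  moreover have "k = g" if "is_inverse D f k" for k
  proof (rule U_inj[of _ b a])
    show k: "k \<in> homset D b a" using that by (simp add: is_inverse_def fD)
    have kf: "Comp D k f = Ident D a" using that by (simp add: is_inverse_def fD)
    have "Far U k = Comp C (Far U k) (Comp C (Far U f) h)"
      using h(3) C.Comp_Ident_right[OF U_in[OF k]] by simp
    also have "\<dots> = Comp C (Comp C (Far U k) (Far U f)) h"
      using C.Comp_assoc[OF h(1) U_in[OF f] U_in[OF k]] .
    also have "\<dots> = h"
      using U_Comp[OF f k] kf C.Comp_Ident_left[OF h(1)] ab by (simp add: U_Ident)
    finally show "Far U k = Far U g" using g by simp
  qed (use g in auto)
  ultimately have "inverse_arr D f = g"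
    unfolding inverse_arr_def by (rule the_equality)
  then show "inverse_arr D f \<in> homset D b a" "Far U (inverse_arr D f) = h"
      "is_inverse D f (inverse_arr D f)"
    using g g_inv by auto
qed

lemma is_inverse_Ident: "a \<in> Obj C \<Longrightarrow> is_inverse C (Ident C a) (Ident C a)"
  using C.Ident_in[of a] C.Comp_Ident_left[OF C.Ident_in] by (auto simp: is_inverse_def homset_def)

text \<open>Surjectivity is strict, so the quasi-inverse \<open>?S\<close> is a section of
  \<open>U\<close>: one of the natural isomorphisms has identities as components, the other has the
  lifts of identities, which are invertible by \<open>lift_inverse\<close>.\<close>

lemma equivalent_if_surj:
  assumes surj: "\<And>c. c \<in> Obj C \<Longrightarrow> \<exists>a\<in>Obj D. Fob U a = c"
  shows "equivalent_categories C D"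
proof -
  interpret D: category D by (rule category_D)
  obtain s where s: "\<And>c. c \<in> Obj C \<Longrightarrow> s c \<in> Obj D \<and> Fob U (s c) = c"
    using surj by metis
  have Cob: "a \<in> Obj C \<and> b \<in> Obj C" if "f \<in> homset C a b" for f a b
    using that C.Dom_in C.Cod_in homsetD by metis
  \<comment> \<open>The lift between the chosen preimages of domain and codomain is unique, so
    functoriality of \<open>t\<close> can be tested after applying \<open>U\<close>.\<close>
  have "\<exists>g. g \<in> homset D (s (Dom C f)) (s (Cod C f)) \<and> Far U g = f" if "f \<in> Arr C" for f
    using U_lift[of "s (Dom C f)" "s (Cod C f)" f] s C.Dom_in C.Cod_in that
    by (auto simp: homset_def)
  then obtain t where "\<And>f. f \<in> Arr C \<Longrightarrow> t f \<in> homset D (s (Dom C f)) (s (Cod C f)) \<and> Far U (t f) = f"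
    by metis
  then have t: "t f \<in> homset D (s a) (s b)" "Far U (t f) = f" if "f \<in> homset C a b" for f a b
    using that by (auto simp: homset_def)
  let ?S = "\<lparr>Fob = s, Far = t\<rparr>"
  have S: "cat_functor C D ?S"
  proof
    show "Far ?S (Ident C a) = Ident D (Fob ?S a)" if "a \<in> Obj C" for a
      using that s t[OF C.Ident_in] by (auto intro!: U_inj[of _ "s a" "s a"] simp: D_Ident_in U_Ident)
    show "Far ?S (Comp C g f) = Comp D (Far ?S g) (Far ?S f)"
      if f: "f \<in> homset C a b" and g: "g \<in> homset C b c" for f g a b c
      using t[OF f] t[OF g] t[OF C.Comp_in[OF f g]] D_Comp_in
      by (auto intro!: U_inj[of _ "s a" "s c"] simp: U_Comp[OF t(1)[OF f] t(1)[OF g]])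
  qed (use s t in auto)
  have U: "cat_functor D C U"
    by unfold_locales (use U_ob U_in U_Ident U_Comp in auto)
  have idC: "cat_functor C C id_funct" and idD: "cat_functor D D id_funct"
    by (unfold_locales; simp add: id_funct_def)+
  have US: "cat_functor C C (comp_funct U ?S)"
    by unfold_locales
      (use s t Cob in \<open>auto simp: comp_funct_def t(2)[OF C.Ident_in] t(2)[OF C.Comp_in]\<close>)
  have SU: "cat_functor D D (comp_funct ?S U)"
  proof -
    interpret S: cat_functor C D ?S by (rule S)
    show ?thesis
      by unfold_locales
        (use S.Fob_in S.Far_in S.Far_Ident S.Far_Comp U_in U_ob in
          \<open>auto simp: comp_funct_def U_Ident U_Comp S.Far_Comp[OF U_in U_in, simplified]\<close>)
  qed
  have "nat_iso C C id_funct (comp_funct U ?S) (Ident C)"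
  proof -
    interpret idC: cat_functor C C id_funct by (rule idC)
    interpret US: cat_functor C C "comp_funct U ?S" by (rule US)
    have "nat_trans C C id_funct (comp_funct U ?S) (Ident C)"
    proof
      show "Ident C a \<in> homset C (Fob id_funct a) (Fob (comp_funct U ?S) a)" if "a \<in> Obj C" for a
        using that s by (simp add: id_funct_def comp_funct_def C.Ident_in)
      show "Comp C (Ident C b) (Far id_funct f) = Comp C (Far (comp_funct U ?S) f) (Ident C a)"
        if "f \<in> homset C a b" for f a b
        using that t[OF that] by (simp add: id_funct_def comp_funct_def C.Comp_Ident_left C.Comp_Ident_right)
    qed
    then show ?thesis
      by (auto simp: nat_iso_def intro: is_inverse_Ident)
  qed
  moreover have "\<exists>\<epsilon>. nat_iso D D (comp_funct ?S U) id_funct \<epsilon>"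
  proof -
    have ex: "\<exists>e. e \<in> homset D (s (Fob U a)) a \<and> Far U e = Ident C (Fob U a)" if "a \<in> Obj D" for a
      using U_lift[of "s (Fob U a)" a "Ident C (Fob U a)"] s[OF U_ob[OF that]] that
        C.Ident_in[OF U_ob[OF that]] by auto
    then obtain e where e: "\<And>a. a \<in> Obj D \<Longrightarrow> e a \<in> homset D (s (Fob U a)) a \<and> Far U (e a) = Ident C (Fob U a)"
      by metis
    interpret idD: cat_functor D D id_funct by (rule idD)
    interpret SU: cat_functor D D "comp_funct ?S U" by (rule SU)
    have "nat_trans D D (comp_funct ?S U) id_funct e"
    proof
      show "e a \<in> homset D (Fob (comp_funct ?S U) a) (Fob id_funct a)" if "a \<in> Obj D" for a
        using e[OF that] by (simp add: id_funct_def comp_funct_def)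
      fix f a b
      assume f: "f \<in> homset D a b"
      then have ab: "a \<in> Obj D" "b \<in> Obj D" using D_homset_Obj by auto
      have ea: "e a \<in> homset D (s (Fob U a)) a" and eb: "e b \<in> homset D (s (Fob U b)) b"
        using e ab by auto
      have tf: "t (Far U f) \<in> homset D (s (Fob U a)) (s (Fob U b))" "Far U (t (Far U f)) = Far U f"
        using t[OF U_in[OF f]] by auto
      have "Comp D (e b) (t (Far U f)) = Comp D f (e a)"
        by (rule U_inj[OF D_Comp_in[OF tf(1) eb] D_Comp_in[OF ea f]])
          (simp add: U_Comp[OF tf(1) eb] U_Comp[OF ea f] tf e ab
            C.Comp_Ident_left[OF U_in[OF f]] C.Comp_Ident_right[OF U_in[OF f]])
      then show "Comp D (e b) (Far (comp_funct ?S U) f) = Comp D (Far id_funct f) (e a)"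
        by (simp add: id_funct_def comp_funct_def)
    qed
    moreover have "\<exists>g. is_inverse D (e a) g" if "a \<in> Obj D" for a
      using e[OF that] lift_inverse(3) is_inverse_Ident[OF U_ob[OF that]] by metis
    ultimately show ?thesis by (auto simp: nat_iso_def)
  qed
  ultimately show ?thesis
    unfolding equivalent_categories_def using S U C.category_axioms category_D by blast
qed

end

section \<open>Trees\<close>

definition step :: "tree \<Rightarrow> (tok \<times> tok) set" where
  "step T = {(e, d). \<exists>v. down T e = Some v \<and> up T d = Some v}"

text \<open>Each step passes a vertex from an incoming edge to the outgoing one, so
  \<open>above T e d\<close> says that \<open>d\<close> lies on the path from \<open>e\<close> down
  to the root; the relation is reflexive.\<close>

abbreviation above :: "tree \<Rightarrow> tok \<Rightarrow> tok \<Rightarrow> bool" where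
  "above T e d \<equiv> (e, d) \<in> (step T)\<^sup>*"

text \<open>Connectedness and absence of cycles are traded for the single demand that every edge
  descends to the root, which supports induction along the descending path.
  \<open>is_tree_iff\<close> shows that both descriptions agree.\<close>

definition rooted :: "tree \<Rightarrow> bool" where
  "rooted T \<longleftrightarrow> finite (edges T) \<and> finite (verts T) \<and>
     (\<forall>e v. incident T e v \<longrightarrow> e \<in> edges T \<and> v \<in> verts T) \<and>
     tree_root T \<in> edges T \<and> (\<forall>e\<in>edges T. down T e = None \<longleftrightarrow> e = tree_root T) \<and>
     (\<forall>v\<in>verts T. \<exists>!e. up T e = Some v) \<and> (\<forall>e\<in>edges T. above T e (tree_root T))"

context
  fixes T :: tree
  assumes T: "rooted T"
begin

lemma rooted_finite: "finite (edges T)"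
  using T by (simp add: rooted_def)

lemma up_in: "up T e = Some v \<Longrightarrow> e \<in> edges T \<and> v \<in> verts T"
  using T by (auto simp: rooted_def incident_def)

lemma down_in: "down T e = Some v \<Longrightarrow> e \<in> edges T \<and> v \<in> verts T"
  using T by (auto simp: rooted_def incident_def)

lemma up_inj: "up T e = Some v \<Longrightarrow> up T d = Some v \<Longrightarrow> e = d"
  using T up_in unfolding rooted_def by blast

lemma up_out_edge: "v \<in> verts T \<Longrightarrow> up T (out_edge T v) = Some v"
  using T unfolding rooted_def out_edge_def by (metis (mono_tags, lifting) theI')

lemma out_edge_eq: "up T e = Some v \<Longrightarrow> out_edge T v = e"
  using up_in up_inj up_out_edge by blast

lemma root_in: "tree_root T \<in> edges T"
  using T by (simp add: rooted_def)

lemma down_None_iff: "e \<in> edges T \<Longrightarrow> down T e = None \<longleftrightarrow> e = tree_root T"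
  using T by (simp add: rooted_def)

lemma step_in: "(e, d) \<in> step T \<Longrightarrow> e \<in> edges T \<and> d \<in> edges T"
  using up_in down_in by (auto simp: step_def)

text \<open>The outgoing edge of a vertex is unique, so descent is deterministic; antisymmetry, the
  chain property and \<open>above_strict\<close> all come from this.\<close>

lemma single_valued_step: "single_valued (step T)"
  using up_inj by (auto simp: step_def single_valued_def)

lemma no_step_root: "(tree_root T, d) \<notin> step T"
  using T by (auto simp: rooted_def step_def)

lemma above_in: "above T e d \<Longrightarrow> d \<in> edges T \<Longrightarrow> e \<in> edges T"
  by (induction rule: converse_rtrancl_induct) (auto dest: step_in)

lemma above_root: "e \<in> edges T \<Longrightarrow> above T e (tree_root T)"
  using T by (simp add: rooted_def)

text \<open>Descent being deterministic, a cycle through \<open>e\<close> would contain every edge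
  on the path from \<open>e\<close> to the root, hence the root itself, from which there is no
  step.\<close>

lemma acyclic_step: "(e, e) \<notin> (step T)\<^sup>+"
proof
  assume e: "(e, e) \<in> (step T)\<^sup>+"
  then have "e \<in> edges T" by (metis step_in tranclD)
  then have "above T e (tree_root T)" by (rule above_root)
  then have "(tree_root T, tree_root T) \<in> (step T)\<^sup>+"
    using e
  proof (induction rule: converse_rtrancl_induct)
    case (step d d')
    then have "(d', d) \<in> (step T)\<^sup>*"
      by (metis single_valued_step single_valuedD tranclD)
    then show ?case using step by (metis rtrancl_into_trancl1)
  qed
  then show False using no_step_root by (metis tranclD)
qed

lemma above_antisym: "above T e d \<Longrightarrow> above T d e \<Longrightarrow> e = d"
  using acyclic_step by (metis rtranclD trancl_rtrancl_trancl)

text \<open>Descent from \<open>e\<close> follows a single path, and both \<open>d\<close> and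
  \<open>d'\<close> lie on it.\<close>

lemma above_chain: "above T e d \<Longrightarrow> above T e d' \<Longrightarrow> above T d d' \<or> above T d' d"
  using single_valued_confluent[OF single_valued_step] by blast

lemma above_strict: "above T e d \<Longrightarrow> e \<noteq> d \<Longrightarrow> (e, d') \<in> step T \<Longrightarrow> above T d' d"
  by (metis converse_rtranclE single_valued_step single_valuedD)

lemma not_above_step: "(e, d) \<in> step T \<Longrightarrow> \<not> above T d e"
  using acyclic_step by (metis rtrancl_into_trancl2)

text \<open>Leaves are minimal here, so induction over this relation treats the incoming edges of a
  vertex before its outgoing edge.\<close>

lemma wf_step: "wf (step T)"
proof (rule finite_acyclic_wf)
  show "finite (step T)"
    by (rule finite_subset[of _ "edges T \<times> edges T"]) (use step_in rooted_finite in auto)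
  show "acyclic (step T)" using acyclic_step by (auto simp: acyclic_def)
qed

lemma above_leaf: "above T d e \<Longrightarrow> up T e = None \<Longrightarrow> d = e"
  by (erule rtranclE) (auto simp: step_def)

lemma in_edges_iff: "v \<in> verts T \<Longrightarrow> e \<in> in_edges T v \<longleftrightarrow> (e, out_edge T v) \<in> step T"
  using up_out_edge down_in by (auto simp: in_edges_def step_def)

lemma step_iff: "(e, d) \<in> step T \<longleftrightarrow> (\<exists>v \<in> verts T. e \<in> in_edges T v \<and> d = out_edge T v)"
  using up_out_edge down_in out_edge_eq by (auto simp: in_edges_def step_def)

lemma out_edge_in: "v \<in> verts T \<Longrightarrow> out_edge T v \<in> edges T"
  using up_in up_out_edge by blast

lemma edge_cases:
  assumes "e \<in> edges T"
  obtains "e \<in> leaves T" | v where "v \<in> verts T" "e = out_edge T v"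
  using assms up_in out_edge_eq by (cases "up T e") (auto simp: leaves_def, metis)

text \<open>In an undirected cycle, both edges at a vertex of maximal depth would be its outgoing edge.\<close>

lemma rooted_no_cycle: "\<not> has_cycle T"
proof
  assume "has_cycle T"
  then obtain vs es where c: "vs \<noteq> []" "length es = length vs" "distinct vs" "distinct es"
      "\<forall>k<length vs. joins T (es ! k) (vs ! k) (vs ! (Suc k mod length vs))"
    unfolding has_cycle_def by auto
  let ?n = "length vs"
  let ?out = "\<lambda>k. out_edge T (vs ! k)"
  have n: "?n > 0" using c by simp
  have fin: "finite (?out ` {..<?n})" by simp
  obtain m where m: "m \<in> ?out ` {..<?n}" "\<And>d. (d, m) \<in> step T \<Longrightarrow> d \<notin> ?out ` {..<?n}"
    using wfE_min[OF wf_step, of "?out 0" "?out ` {..<?n}"] n by blast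
  then obtain k where k: "k < ?n" "m = ?out k" by blast
  \<comment> \<open>An edge of the cycle at \<open>vs ! k\<close> must leave it: if it entered, it
    would be the outgoing edge of a cycle vertex and lie one step above \<open>m\<close>, against
    the choice of \<open>m\<close>.\<close>
  have key: "up T e = Some (vs ! k)" if "joins T e (vs ! k) (vs ! j)" "j < ?n" for e j
  proof (rule ccontr)
    assume "up T e \<noteq> Some (vs ! k)"
    then have "up T e = Some (vs ! j)" "down T e = Some (vs ! k)"
      using that by (auto simp: joins_def)
    then have "out_edge T (vs ! j) = e" "(e, m) \<in> step T"
      using out_edge_eq down_in up_out_edge k by (auto simp: step_def)
    then show False using m(2) that(2) by blast
  qed
  \<comment> \<open>The cyclic predecessor of \<open>k\<close>; for \<open>k = 0\<close> it wraps
    around to the last index.\<close>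
  define j where "j = (if k = 0 then ?n - 1 else k - 1)"
  have j: "j < ?n" "Suc j mod ?n = k" using k n by (auto simp: j_def)
  have "joins T (es ! j) (vs ! j) (vs ! k)" using c(5) j by metis
  then have "joins T (es ! j) (vs ! k) (vs ! j)" by (auto simp: joins_def)
  then have 1: "up T (es ! j) = Some (vs ! k)" using key j by blast
  have sk: "joins T (es ! k) (vs ! k) (vs ! (Suc k mod ?n))" "Suc k mod ?n < ?n" using c(5) k n by auto
  then have 2: "up T (es ! k) = Some (vs ! k)" using key by blast
  \<comment> \<open>The cycle edges before and after \<open>vs ! k\<close> are both its outgoing
    edge, so by distinctness the cycle has length one, and a loop would be a step from an edge to
    itself.\<close>
  have "es ! j = es ! k" using up_inj 1 2 by blast
  then have "j = k" using c(2,4) j k by (simp add: nth_eq_iff_index_eq)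
  then have "Suc k mod ?n = k" using j by simp
  then have "joins T (es ! k) (vs ! k) (vs ! k)" using sk by simp
  then have "(es ! k, es ! k) \<in> step T" by (auto simp: joins_def step_def)
  then show False using acyclic_step by blast
qed

end

text \<open>Forwards, walk from the root along incident edges with the invariant that the current
  edge descends to the root. At a vertex with outgoing edge \<open>o'\<close>, the current edge is
  \<open>o'\<close> or steps to it, so \<open>o'\<close> descends to the root, and the next edge is
  \<open>o'\<close> or steps to it. Backwards, \<open>step\<close> is contained in the symmetric
  incidence relation, so all edges are connected through the root.\<close>

lemma is_tree_iff: "is_tree T \<longleftrightarrow> rooted T"
proof
  assume T: "is_tree T"
  let ?R = "{(d, d'). \<exists>v. incident T d v \<and> incident T d' v}"
  have "above T e (tree_root T)" if "(tree_root T, e) \<in> ?R\<^sup>*" for e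
    using that
  proof (induction rule: rtrancl_induct)
    case (step d e)
    then obtain v where v: "incident T d v" "incident T e v" by auto
    then have vT: "v \<in> verts T" using T by (auto simp: is_tree_def)
    then obtain o' where o: "up T o' = Some v" "\<And>d. up T d = Some v \<Longrightarrow> d = o'"
      using T unfolding is_tree_def by metis
    have "above T o' (tree_root T)"
    proof (cases "up T d = Some v")
      case False
      then have d: "down T d = Some v" using v by (auto simp: incident_def)
      then have "d \<in> edges T" using T unfolding is_tree_def incident_def by metis
      then have "d \<noteq> tree_root T" using d T unfolding is_tree_def by force
      \<comment> \<open>As \<open>d\<close> is not the root, its descent has a first step, which can
        only lead to \<open>o'\<close>.\<close>
      then obtain c where c: "(d, c) \<in> step T" "above T c (tree_root T)"
        using step.IH by (metis converse_rtranclE)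
      then have "c = o'" using d o(2) by (auto simp: step_def)
      then show ?thesis using c by simp
    qed (use step.IH o in auto)
    moreover have "e = o' \<or> (e, o') \<in> step T"
      using v(2) o(2)[of e] o(1) by (auto simp: incident_def step_def)
    ultimately show ?case by (metis converse_rtrancl_into_rtrancl)
  qed simp
  then have "\<forall>e\<in>edges T. above T e (tree_root T)"
    using T by (auto simp: is_tree_def tree_connected_def)
  then show "rooted T" using T by (simp add: is_tree_def rooted_def)
next
  assume T: "rooted T"
  let ?R = "{(d, d'). \<exists>v. incident T d v \<and> incident T d' v}"
  have sub: "step T \<subseteq> ?R" by (auto simp: step_def incident_def)
  have "sym ?R" by (auto simp: sym_def)
  then have "sym (?R\<^sup>*)" by (rule sym_rtrancl)
  moreover have "(e, tree_root T) \<in> ?R\<^sup>*" if "e \<in> edges T" for e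
    using rtrancl_mono[OF sub] above_root[OF T that] by blast
  ultimately have "tree_connected T"
    unfolding tree_connected_def by (meson rtrancl_trans symD)
  then show "is_tree T"
    using T rooted_no_cycle[OF T] by (auto simp: rooted_def is_tree_def)
qed

text \<open>\<open>cover S r L\<close> says that \<open>L\<close> is the set of leaves of a subtree of \<open>S\<close> with root \<open>r\<close>; see
  \<open>subtree_iff_cover\<close>.\<close>

definition cover :: "tree \<Rightarrow> tok \<Rightarrow> tok set \<Rightarrow> bool" where
  "cover S r L \<longleftrightarrow> r \<in> edges S \<and> (\<forall>l\<in>L. above S l r) \<and>
     (\<forall>l\<in>L. \<forall>l'\<in>L. above S l l' \<longrightarrow> l = l') \<and>
     (\<forall>z\<in>leaves S. above S z r \<longrightarrow> (\<exists>l\<in>L. above S z l))"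

section \<open>Subtrees as antichains above a root\<close>

lemma subtree_up:
  assumes S: "rooted S" and sub: "subtree S' S"
  shows "up S' e = Some v \<Longrightarrow> up S e = Some v" "down S' e = Some v \<Longrightarrow> down S e = Some v"
proof -
  have S': "rooted S'" using sub by (simp add: subtree_def is_tree_iff)
  have iff: "(up S' e = Some v \<longleftrightarrow> up S e = Some v) \<and> (down S' e = Some v \<longleftrightarrow> down S e = Some v)"
    if "e \<in> edges S' \<and> v \<in> verts S'"
  proof -
    have "\<forall>e\<in>edges S'. \<forall>v\<in>verts S'. (up S' e = Some v \<longleftrightarrow> up S e = Some v) \<and>
        (down S' e = Some v \<longleftrightarrow> down S e = Some v)"
      using sub unfolding subtree_def by (elim conjE)
    from this[rule_format, OF conjunct1[OF that] conjunct2[OF that]] show ?thesis .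
  qed
  show "up S e = Some v" if "up S' e = Some v"
    using iff[OF up_in[OF S' that], THEN conjunct1, THEN iffD1, OF that] .
  show "down S e = Some v" if "down S' e = Some v"
    using iff[OF down_in[OF S' that], THEN conjunct2, THEN iffD1, OF that] .
qed

lemma subtree_step:
  assumes S: "rooted S" and sub: "subtree S' S"
  shows "step S' \<subseteq> step S"
proof
  fix x
  assume "x \<in> step S'"
  then obtain e d v where x: "x = (e, d)" "down S' e = Some v" "up S' d = Some v"
    by (auto simp: step_def)
  then show "x \<in> step S"
    using subtree_up(1)[OF S sub x(3)] subtree_up(2)[OF S sub x(2)] by (auto simp: step_def)
qed

text \<open>Paths of \<open>S'\<close> are paths of \<open>S\<close>. Since the incoming edges of a
  vertex of \<open>S'\<close> belong to \<open>S'\<close>, a path of \<open>S\<close> that descends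
  to the root of \<open>S'\<close> can enter \<open>S'\<close> only through a leaf of
  \<open>S'\<close>.\<close>

lemma subtree_cover:
  assumes S: "rooted S" and sub: "subtree S' S"
  shows "cover S (tree_root S') (leaves S')"
proof -
  have S': "rooted S'" using sub by (simp add: subtree_def is_tree_iff)
  note mono = subsetD[OF rtrancl_mono[OF subtree_step[OF S sub]]]
  let ?r = "tree_root S'"
  have above_r: "above S e ?r" "above S' e ?r" if "e \<in> edges S'" for e
    using above_root[OF S' that] mono by auto
  have exit: "e \<in> edges S' \<or> (\<exists>l\<in>leaves S'. above S e l)" if "above S e ?r" for e
    using that
  proof (induction rule: converse_rtrancl_induct)
    case base
    then show ?case using root_in[OF S'] by simp
  next
    case (step e d)
    show ?case
    proof (cases "d \<in> edges S'")
      case True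
      obtain v where v: "down S e = Some v" "up S d = Some v" using step(1) by (auto simp: step_def)
      show ?thesis
      proof (cases "v \<in> verts S'")
        case True
        have "e \<in> in_edges S v" using v(1) down_in[OF S] by (auto simp: in_edges_def)
        moreover have "in_edges S v \<subseteq> edges S'" using sub True by (simp add: subtree_def)
        ultimately show ?thesis by blast
      next
        case False
        \<comment> \<open>The vertex above \<open>d\<close> in \<open>S\<close> is missing from
          \<open>S'\<close>, so the upper end of \<open>d\<close> is loose there.\<close>
        have "up S' d \<noteq> Some w" for w
          using subtree_up[OF S sub, of d w] False v(2) up_in[OF S', of d w] by auto
        then have "d \<in> leaves S'" using True by (auto simp: leaves_def)
        then show ?thesis using step(1) by blast
      qed
    qed (use step in \<open>meson converse_rtrancl_into_rtrancl\<close>)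
  qed
  show ?thesis
    unfolding cover_def
  proof (intro conjI ballI impI)
    show "?r \<in> edges S" using root_in[OF S'] sub by (auto simp: subtree_def)
    show "above S l ?r" if "l \<in> leaves S'" for l
      using that above_r by (simp add: leaves_def)
    fix l l'
    assume l: "l \<in> leaves S'" "l' \<in> leaves S'" "above S l l'"
    \<comment> \<open>The descent from \<open>l\<close> to \<open>?r\<close> inside
      \<open>S'\<close> is the one in \<open>S\<close>, so it passes through \<open>l'\<close>. The
      comparison thus holds in \<open>S'\<close>, where a leaf has nothing but itself above
      it.\<close>
    have "l' = ?r \<or> above S' l l'"
    proof -
      have "l \<in> edges S'" using l by (simp add: leaves_def)
      have "above S e l' \<longrightarrow> above S l' ?r \<longrightarrow> l' = ?r \<or> above S' e l'" if "above S' e ?r" for e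
        using that
      proof (induction rule: converse_rtrancl_induct)
        case base
        then show ?case using above_antisym[OF S] by blast
      next
        case (step e d)
        then show ?case
          using above_strict[OF S] subtree_step[OF S sub]
          by (metis converse_rtrancl_into_rtrancl rtrancl.rtrancl_refl subsetD)
      qed
      then show ?thesis using l above_r by (auto simp: leaves_def)
    qed
    then have "above S' l l'" using l above_r by (auto simp: leaves_def)
    then show "l = l'" using above_leaf[OF S'] l by (simp add: leaves_def)
  next
    fix z
    assume z: "z \<in> leaves S" "above S z ?r"
    have "z \<in> leaves S'" if "z \<in> edges S'"
    proof -
      have "up S' z \<noteq> Some w" for w
        using subtree_up[OF S sub, of z w] z(1) by (auto simp: leaves_def)
      then show ?thesis using that by (auto simp: leaves_def)
    qed
    then show "\<exists>l\<in>leaves S'. above S z l" using exit[OF z(2)] by blast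
  qed
qed

text \<open>The subtree is the part of \<open>S\<close> between \<open>r\<close> and
  \<open>L\<close>. Because \<open>L\<close> is an antichain above \<open>r\<close>, all of
  \<open>L\<close> belongs to it; the covering condition ensures that it has no further
  leaves.\<close>

lemma cover_subtree:
  assumes S: "rooted S" and cov: "cover S r L"
  shows "\<exists>S'. subtree S' S \<and> tree_root S' = r \<and> leaves S' = L"
proof -
  \<comment> \<open>An edge above \<open>r\<close> is kept unless it lies strictly above an element
    of \<open>L\<close>; a vertex is kept if its outgoing edge is kept and not in
    \<open>L\<close>.\<close>
  define E where "E = {e. above S e r \<and> (\<forall>l\<in>L. above S e l \<longrightarrow> e = l)}"
  define S' where "S' = \<lparr>edges = E, verts = {v. \<exists>e\<in>E - L. up S e = Some v},
      up = (\<lambda>e. if e \<in> E - L then up S e else None),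
      down = (\<lambda>e. if e \<in> E - {r} then down S e else None), tree_root = r\<rparr>"
  have rS: "r \<in> edges S" and Lr: "\<And>l. l \<in> L \<Longrightarrow> above S l r"
    and anti: "\<And>l l'. l \<in> L \<Longrightarrow> l' \<in> L \<Longrightarrow> above S l l' \<Longrightarrow> l = l'"
    and cover: "\<And>z. z \<in> leaves S \<Longrightarrow> above S z r \<Longrightarrow> \<exists>l\<in>L. above S z l"
    using cov by (auto simp: cover_def)
  have r: "r \<in> E" using above_antisym[OF S] Lr by (auto simp: E_def)
  have LE: "L \<subseteq> E" using Lr anti by (auto simp: E_def)
  have ES: "E \<subseteq> edges S" using above_in[OF S _ rS] by (auto simp: E_def)
  \<comment> \<open>Descending from an edge of \<open>E\<close> other than \<open>r\<close> stays in
    \<open>E\<close> and outside \<open>L\<close>: an element of \<open>L\<close> below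
    \<open>d\<close> would lie strictly below \<open>e\<close>.\<close>
  have stepE: "d \<in> E - L" if "e \<in> E - {r}" "(e, d) \<in> step S" for e d
  proof -
    have dr: "above S d r" using that above_strict[OF S] by (auto simp: E_def)
    have "\<not> above S d l" if "l \<in> L" for l
    proof
      assume "above S d l"
      then show False
        using \<open>e \<in> E - {r}\<close> \<open>(e, d) \<in> step S\<close> that not_above_step[OF S]
        by (auto simp: E_def) (metis converse_rtrancl_into_rtrancl)
    qed
    then show ?thesis using dr by (auto simp: E_def)
  qed
  \<comment> \<open>Conversely, all incoming edges of a kept vertex are kept, as the definition of a
    subtree requires; none of them is \<open>r\<close>, so the cut below \<open>r\<close> does not
    detach them.\<close>
  have below: "e \<in> E" "e \<noteq> r" if "(e, d) \<in> step S" "d \<in> E - L" for e d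
  proof -
    have d: "above S d r" "\<And>l. l \<in> L \<Longrightarrow> \<not> above S d l" using that by (auto simp: E_def)
    then have "above S e r" using that by (meson converse_rtrancl_into_rtrancl)
    moreover have "e = l" if "l \<in> L" "above S e l" for l
      using that d \<open>(e, d) \<in> step S\<close> above_strict[OF S] by blast
    ultimately show "e \<in> E" by (auto simp: E_def)
    show "e \<noteq> r" using that d not_above_step[OF S] by blast
  qed
  have downE: "\<exists>d. down S e = Some v \<and> (e, d) \<in> step S \<and> up S d = Some v \<and> d \<in> E - L"
    if "e \<in> E - {r}" "down S e = Some v" for e v
  proof -
    have "up S (out_edge S v) = Some v" using up_out_edge[OF S] down_in[OF S] that by blast
    then have "(e, out_edge S v) \<in> step S" using that by (auto simp: step_def)
    then show ?thesis using stepE that \<open>up S (out_edge S v) = Some v\<close> by blast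
  qed
  have root': "above S' e r" if "above S e r" "e \<in> E" for e
    using that
  proof (induction rule: converse_rtrancl_induct)
    case (step e d)
    show ?case
    proof (cases "e = r")
      case False
      then have "d \<in> E - L" using stepE step by blast
      moreover from this have "(e, d) \<in> step S'"
        using step False by (auto simp: S'_def step_def)
      ultimately show ?thesis using step by (meson DiffD1 converse_rtrancl_into_rtrancl)
    qed simp
  qed simp
  have "rooted S'"
    unfolding rooted_def
  proof (intro conjI allI impI ballI)
    show "finite (edges S')" using finite_subset[OF ES] rooted_finite[OF S] by (simp add: S'_def)
    have "verts S' \<subseteq> verts S" using up_in[OF S] by (auto simp: S'_def)
    then show "finite (verts S')" using S by (auto simp: rooted_def intro: finite_subset)
    show "tree_root S' \<in> edges S'" using r by (simp add: S'_def)
    show "e \<in> edges S'" if "incident S' e v" for e v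
      using that by (auto simp: S'_def incident_def split: if_splits)
    show "v \<in> verts S'" if "incident S' e v" for e v
      using that downE[of e v] by (auto simp: S'_def incident_def split: if_splits)
    show "(down S' e = None) = (e = tree_root S')" if "e \<in> edges S'" for e
    proof -
      \<comment> \<open>The root of \<open>S\<close> lies above \<open>r\<close> only if it is
        \<open>r\<close>; otherwise its loose lower end would give \<open>S'\<close> a second
        root.\<close>
      have "e = r" if "e = tree_root S" "e \<in> E"
        using that no_step_root[OF S] by (auto simp: E_def elim: converse_rtranclE)
      then show ?thesis
        using that ES down_None_iff[OF S, of e] by (auto simp: S'_def)
    qed
    show "\<exists>!e. up S' e = Some v" if "v \<in> verts S'" for v
      using that up_inj[OF S] by (auto simp: S'_def split: if_splits)
    show "above S' e (tree_root S')" if "e \<in> edges S'" for e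
      using that root'[of e] by (auto simp: S'_def E_def)
  qed
  then have "is_tree S'" by (simp add: is_tree_iff)
  moreover have "in_edges S v \<subseteq> E" if "v \<in> verts S'" for v
    using that below by (fastforce simp: S'_def in_edges_def step_def)
  moreover have "up S' e = Some v \<longleftrightarrow> up S e = Some v" "down S' e = Some v \<longleftrightarrow> down S e = Some v"
    if ev: "e \<in> E" "v \<in> verts S'" for e v
  proof -
    obtain d where d: "d \<in> E - L" "up S d = Some v" using ev by (auto simp: S'_def)
    show "up S' e = Some v \<longleftrightarrow> up S e = Some v"
      using ev d up_inj[OF S] by (auto simp: S'_def)
    have "e \<noteq> r" if "down S e = Some v"
      using that below d by (auto simp: step_def)
    then show "down S' e = Some v \<longleftrightarrow> down S e = Some v"
      using ev by (auto simp: S'_def)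
  qed
  moreover have ESV: "edges S' = E" "verts S' \<subseteq> verts S"
    using up_in[OF S] by (auto simp: S'_def)
  ultimately have "subtree S' S"
    using ES unfolding subtree_def ESV by blast
  moreover have "leaves S' = L"
  proof -
    \<comment> \<open>The covering condition puts an element of \<open>L\<close> below a leaf of
      \<open>S\<close> in \<open>E\<close>, and edges of \<open>E\<close> do not lie strictly above
      elements of \<open>L\<close>.\<close>
    have "z \<in> L" if "z \<in> E" "up S z = None" for z
    proof -
      have "z \<in> leaves S" using that ES by (auto simp: leaves_def)
      then show ?thesis using cover that by (auto simp: E_def)
    qed
    then show ?thesis using LE by (auto simp: leaves_def S'_def)
  qed
  moreover have "tree_root S' = r" by (simp add: S'_def)
  ultimately show ?thesis by (intro exI[of _ S'] conjI)
qed

lemma subtree_iff_cover: "rooted S \<Longrightarrow>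
    (\<exists>S'. subtree S' S \<and> tree_root S' = r \<and> leaves S' = L) \<longleftrightarrow> cover S r L"
  using subtree_cover cover_subtree by blast

section \<open>Maps of trees through the edge order\<close>

lemma tree_map_iff_cover:
  assumes "rooted S"
  shows "tree_map T S f \<longleftrightarrow> f \<in> edges T \<rightarrow>\<^sub>E edges S \<and>
    (\<forall>v\<in>verts T. inj_on f (in_edges T v) \<and> cover S (f (out_edge T v)) (f ` in_edges T v))"
  by (simp add: tree_map_def subtree_iff_cover[OF assms])

lemma tree_map_above:
  assumes T: "rooted T" and S: "rooted S" and f: "tree_map T S f" and ed: "above T e d"
  shows "above S (f e) (f d)"
  using ed
proof (induction rule: rtrancl_induct)
  case (step d d')
  obtain v where v: "v \<in> verts T" "d \<in> in_edges T v" "d' = out_edge T v"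
    using step(2) step_iff[OF T] by auto
  then have "above S (f d) (f d')"
    using f by (auto simp: tree_map_iff_cover[OF S] cover_def)
  then show ?case using step.IH by (meson rtrancl_trans)
qed simp

text \<open>The paths from \<open>e\<close> and \<open>d\<close> down to the root merge;
  \<open>v\<close> is the vertex where they do, and \<open>e1\<close> and \<open>d1\<close> are the
  incoming edges through which they arrive.\<close>

lemma incomparable_branch:
  assumes T: "rooted T" and ed: "e \<in> edges T" "d \<in> edges T" "\<not> above T e d" "\<not> above T d e"
  shows "\<exists>v\<in>verts T. \<exists>e1\<in>in_edges T v. \<exists>d1\<in>in_edges T v. e1 \<noteq> d1 \<and> above T e e1 \<and> above T d d1"
proof -
  have "above T e (tree_root T)" using above_root[OF T] ed by blast
  then show ?thesis
    using ed
  proof (induction rule: converse_rtrancl_induct)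
    case base
    then show ?case using above_root[OF T] by blast
  next
    case (step e e')
    obtain v where v: "v \<in> verts T" "e \<in> in_edges T v" "e' = out_edge T v"
      using step(1) step_iff[OF T] by auto
    show ?case
    proof (cases "above T d e'")
      case True
      \<comment> \<open>The path of \<open>d\<close> arrives at \<open>e'\<close> through
        \<open>d1\<close>; if \<open>d1\<close> were \<open>e\<close>, then \<open>d\<close> would
        lie above \<open>e\<close>.\<close>
      then obtain d1 where d1: "above T d d1" "(d1, e') \<in> step T"
        using step by (metis converse_rtrancl_into_rtrancl rtranclE rtrancl.rtrancl_refl)
      then have "d1 \<in> in_edges T v" using v in_edges_iff[OF T] by simp
      moreover have "e \<noteq> d1" using d1(1) step.prems by blast
      ultimately show ?thesis using v(1,2) d1(1) by blast
    next
      case False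
      moreover have "\<not> above T e' d" using step by (meson converse_rtrancl_into_rtrancl)
      moreover have "e' \<in> edges T" using step_in[OF T] step by blast
      ultimately obtain w e1 d1 where w: "w \<in> verts T" "e1 \<in> in_edges T w" "d1 \<in> in_edges T w"
          "e1 \<noteq> d1" "above T e' e1" "above T d d1"
        using step.IH step.prems(2) by blast
      have "above T e e1" using step(1) w(5) by (rule converse_rtrancl_into_rtrancl)
      then show ?thesis using w by blast
    qed
  qed
qed

text \<open>Incomparable edges separate at a vertex into distinct incoming edges, whose images are
  distinct members of an antichain. Yet both images would lie below \<open>f e\<close>, and the
  edges below a given one form a chain.\<close>

lemma tree_map_incomparable:
  assumes T: "rooted T" and S: "rooted S" and f: "tree_map T S f"
    and ed: "e \<in> edges T" "d \<in> edges T" and fed: "above S (f e) (f d)"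
  shows "above T e d \<or> above T d e"
proof (rule ccontr)
  assume "\<not> ?thesis"
  then obtain v e1 d1 where v: "v \<in> verts T" "e1 \<in> in_edges T v" "d1 \<in> in_edges T v"
      "e1 \<noteq> d1" "above T e e1" "above T d d1"
    using incomparable_branch[OF T ed] by blast
  have ne: "f e1 \<noteq> f d1" and cov: "cover S (f (out_edge T v)) (f ` in_edges T v)"
    using f v by (auto simp: tree_map_iff_cover[OF S] inj_on_def)
  note mono = tree_map_above[OF T S f]
  have "above S (f e) (f e1)" "above S (f e) (f d1)"
    using mono v fed by (auto intro: rtrancl_trans)
  then have "above S (f e1) (f d1) \<or> above S (f d1) (f e1)"
    by (rule above_chain[OF S])
  then show False using ne cov v(2,3) unfolding cover_def by (metis imageI)
qed

text \<open>Climb in \<open>T\<close> from \<open>e\<close>: at each vertex the images of the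
  incoming edges cover the image of the outgoing one, so \<open>z\<close> stays above the image of
  one of them. The climb ends by well-foundedness, and it cannot end at a stump, whose empty cover
  has no leaf above it.\<close>

lemma tree_map_lift_leaf:
  assumes T: "rooted T" and S: "rooted S" and f: "tree_map T S f"
    and e: "e \<in> edges T" and z: "z \<in> leaves S" "above S z (f e)"
  shows "\<exists>y\<in>leaves T. above T y e \<and> above S z (f y)"
  using wf_step[OF T] e z(2)
proof (induction e rule: wf_induct_rule)
  case (less e)
  show ?case
  proof (cases "e \<in> leaves T")
    case False
    then obtain v where v: "v \<in> verts T" "e = out_edge T v"
      using edge_cases[OF T less.prems(1)] by metis
    then have "cover S (f e) (f ` in_edges T v)"
      using f by (simp add: tree_map_iff_cover[OF S])
    then obtain e1 where e1: "e1 \<in> in_edges T v" "above S z (f e1)"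
      using less.prems(2) z unfolding cover_def by blast
    then have "(e1, e) \<in> step T" "e1 \<in> edges T"
      using v in_edges_iff[OF T] by (auto simp: in_edges_def)
    then show ?thesis using less.IH e1(2) by (meson rtrancl.rtrancl_into_rtrancl)
  qed (use less in blast)
qed

text \<open>Maps carry subtrees to subtrees, which is what composition in \<Omega> needs. The
  antichain property comes from reflection of comparability, the covering property from lifting of
  leaves.\<close>

lemma cover_image:
  assumes T: "rooted T" and S: "rooted S" and f: "tree_map T S f" and cov: "cover T r L"
  shows "inj_on f L" "cover S (f r) (f ` L)"
proof -
  have fE: "f \<in> edges T \<rightarrow>\<^sub>E edges S" using f by (simp add: tree_map_def)
  have r: "r \<in> edges T" and LE: "L \<subseteq> edges T"
    using cov above_in[OF T] by (auto simp: cover_def)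
  have anti: "l = l'" if "l \<in> L" "l' \<in> L" "above S (f l) (f l')" for l l'
    using tree_map_incomparable[OF T S f, of l l'] that LE cov by (auto simp: cover_def)
  show "inj_on f L" using anti by (auto simp: inj_on_def)
  show "cover S (f r) (f ` L)"
    unfolding cover_def
  proof (intro conjI ballI impI)
    show "f r \<in> edges S" using r fE by auto
    show "above S l (f r)" if "l \<in> f ` L" for l
      using that cov tree_map_above[OF T S f] by (auto simp: cover_def)
    show "l = l'" if "l \<in> f ` L" "l' \<in> f ` L" "above S l l'" for l l'
      using that anti by auto
    fix z
    assume "z \<in> leaves S" "above S z (f r)"
    then obtain y where y: "y \<in> leaves T" "above T y r" "above S z (f y)"
      using tree_map_lift_leaf[OF T S f r] by blast
    then obtain l where "l \<in> L" "above T y l" using cov by (auto simp: cover_def)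
    then show "\<exists>l\<in>f ` L. above S z l"
      using y tree_map_above[OF T S f] by (meson image_eqI rtrancl_trans)
  qed
qed

lemma tree_map_compose:
  assumes T: "rooted T" and S: "rooted S" and R: "rooted R"
    and f: "tree_map T S f" and g: "tree_map S R g"
  shows "tree_map T R (compose (edges T) g f)"
  unfolding tree_map_iff_cover[OF R]
proof (intro conjI ballI)
  have fE: "f \<in> edges T \<rightarrow>\<^sub>E edges S" and gE: "g \<in> edges S \<rightarrow>\<^sub>E edges R"
    using f g by (simp_all add: tree_map_def)
  then show "compose (edges T) g f \<in> edges T \<rightarrow>\<^sub>E edges R"
    by (auto simp: compose_def)
  fix v
  assume v: "v \<in> verts T"
  have inE: "in_edges T v \<subseteq> edges T" by (auto simp: in_edges_def)
  have fv: "inj_on f (in_edges T v)" "cover S (f (out_edge T v)) (f ` in_edges T v)"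
    using f v by (auto simp: tree_map_iff_cover[OF S])
  note gi = cover_image[OF S R g fv(2)]
  have eq: "compose (edges T) g f e = (g \<circ> f) e" if "e \<in> in_edges T v" for e
    using that inE by (auto simp: compose_def)
  have "inj_on (g \<circ> f) (in_edges T v)" using comp_inj_on[OF fv(1) gi(1)] .
  then show "inj_on (compose (edges T) g f) (in_edges T v)"
    using eq by (auto simp: inj_on_def)
  have "compose (edges T) g f ` in_edges T v = g ` f ` in_edges T v"
    using eq by force
  then show "cover R (compose (edges T) g f (out_edge T v)) (compose (edges T) g f ` in_edges T v)"
    using gi(2) out_edge_in[OF T v] by (simp add: compose_def)
qed

text \<open>The subtree needed at \<open>v\<close> is its corolla. A leaf above the outgoing edge
  arrives through an incoming one, because the outgoing edge is not itself a leaf.\<close>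

lemma tree_map_id:
  assumes T: "rooted T"
  shows "tree_map T T (\<lambda>e\<in>edges T. e)"
  unfolding tree_map_iff_cover[OF T]
proof (intro conjI ballI)
  fix v
  assume v: "v \<in> verts T"
  let ?o = "out_edge T v"
  have inE: "in_edges T v \<subseteq> edges T" by (auto simp: in_edges_def)
  then show "inj_on (\<lambda>e\<in>edges T. e) (in_edges T v)" by (auto simp: inj_on_def)
  have img: "(\<lambda>e\<in>edges T. e) ` in_edges T v = in_edges T v" using inE by force
  have "cover T ?o (in_edges T v)"
    unfolding cover_def
  proof (intro conjI ballI impI)
    show "?o \<in> edges T" using out_edge_in[OF T v] .
    show "above T l ?o" if "l \<in> in_edges T v" for l using that in_edges_iff[OF T v] by blast
    show "l = l'" if "l \<in> in_edges T v" "l' \<in> in_edges T v" "above T l l'" for l l'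
      using that in_edges_iff[OF T v] above_strict[OF T] not_above_step[OF T] by blast
    show "\<exists>l\<in>in_edges T v. above T z l" if "z \<in> leaves T" "above T z ?o" for z
      using that(2)
    proof (cases rule: rtranclE)
      case base
      then show ?thesis using that up_out_edge[OF T v] by (simp add: leaves_def)
    next
      case (step l)
      then show ?thesis using in_edges_iff[OF T v] by blast
    qed
  qed
  then show "cover T ((\<lambda>e\<in>edges T. e) ?o) ((\<lambda>e\<in>edges T. e) ` in_edges T v)"
    using img out_edge_in[OF T v] by simp
qed auto

lemma category_Omega: "category Omega"
  unfolding Omega_def
proof (rule category_mk_cat)
  show "(\<lambda>e\<in>edges T. e) \<in> {f. tree_map T T f}" if "T \<in> {T. is_tree T}" for T
    using that by (simp add: tree_map_id is_tree_iff)
  show "compose (edges T) g f \<in> {f. tree_map T R f}"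
    if "T \<in> {T. is_tree T}" "S \<in> {T. is_tree T}" "R \<in> {T. is_tree T}"
      "f \<in> {f. tree_map T S f}" "g \<in> {f. tree_map S R f}" for T S R f g
    using that tree_map_compose by (simp add: is_tree_iff)
  show "compose (edges T) (\<lambda>e\<in>edges S. e) f = f"
    if "f \<in> {f. tree_map T S f}" for T S f
    using that by (intro extensionalityI[where A = "edges T"])
      (auto simp: tree_map_def compose_def PiE_iff)
  show "compose (edges T) f (\<lambda>e\<in>edges T. e) = f"
    if "f \<in> {f. tree_map T S f}" for T S f
    using that by (intro extensionalityI[where A = "edges T"])
      (auto simp: tree_map_def compose_def PiE_iff)
  show "compose (edges T) h (compose (edges T) g f) = compose (edges T) (compose (edges S) h g) f"
    if "f \<in> {f. tree_map T S f}" for T S f g h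
    using that by (intro extensionalityI[where A = "edges T"])
      (auto simp: tree_map_def compose_def PiE_iff)
qed

section \<open>Grafting\<close>

lemma cover_leaves_above:
  assumes S: "rooted S" and r: "r \<in> edges S"
  shows "cover S r {z \<in> leaves S. above S z r}"
  using r above_leaf[OF S] by (auto simp: cover_def leaves_def)

locale grafting =
  fixes Xp :: "tok set" and x0 :: tok and l :: "tok \<Rightarrow> tok" and Yp :: "tok set" and y0 :: tok
    and \<phi> :: "tok \<Rightarrow> tok" and T :: tree
  assumes T: "rooted T" and l: "bij_betw l (Xp - {x0}) (leaves T)"
    and fin: "finite Yp" and phi: "\<phi> \<in> Yp - {y0} \<rightarrow> Xp"
begin

abbreviation X where "X \<equiv> Xp - {x0}"
abbreviation Y where "Y \<equiv> Yp - {y0}"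
abbreviation P where "P \<equiv> graft Xp x0 l Yp y0 \<phi> T"

lemma graft_simps:
  "edges P = Old ` edges T \<union> New ` Y \<union> {NewRoot}"
  "verts P = Old ` verts T \<union> New ` X \<union> {NewRoot}"
  "tree_root P = NewRoot"
  by (simp_all add: graft_def)

lemma l_in: "x \<in> X \<Longrightarrow> l x \<in> leaves T"
  using l by (auto simp: bij_betw_def)

lemma up_leaf: "e \<in> leaves T \<Longrightarrow> up T e = None"
  by (simp add: leaves_def)

lemma up_Old: "up P d = Some (Old v) \<longleftrightarrow> (\<exists>e. d = Old e \<and> up T e = Some v)"
  using up_leaf by (cases d) (auto simp: graft_def)

lemma inv_l: "e \<in> leaves T \<Longrightarrow> inv_into X l e \<in> X \<and> l (inv_into X l e) = e"
  using l unfolding bij_betw_def by (metis f_inv_into_f inv_into_into)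

lemma inv_l': "x \<in> X \<Longrightarrow> inv_into X l (l x) = x"
  using l unfolding bij_betw_def by (metis inv_into_f_f)

lemma up_New': "up P d = Some (New x) \<longleftrightarrow> (\<exists>e\<in>leaves T. d = Old e \<and> x = inv_into X l e)"
  by (cases d) (auto simp: graft_def)

lemma up_New: "x \<in> X \<Longrightarrow> up P d = Some (New x) \<longleftrightarrow> d = Old (l x)"
  unfolding up_New' using inv_l inv_l' l_in by metis

lemma up_NewRoot: "up P d = Some NewRoot \<longleftrightarrow> d = NewRoot"
  by (cases d) (auto simp: graft_def)

lemma up_not: "up P d \<noteq> Some (Atom n)" "up P d \<noteq> Some (Prd n t)"
  by (cases d; auto simp: graft_def)+

lemma down_root: "down T (tree_root T) = None"
  using down_None_iff[OF T] root_in[OF T] by blast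

lemma down_Old: "down P d = Some (Old v) \<longleftrightarrow> (\<exists>e. d = Old e \<and> down T e = Some v)"
  using down_root by (cases d) (auto simp: graft_def)

lemma down_New: "down P d = Some (New x) \<longleftrightarrow> (\<exists>y\<in>Y. d = New y \<and> \<phi> y = x \<and> x \<noteq> x0)"
  by (cases d) (auto simp: graft_def)

lemma down_NewRoot: "down P d = Some NewRoot \<longleftrightarrow> d = Old (tree_root T) \<or> (\<exists>y\<in>Y. d = New y \<and> \<phi> y = x0)"
  by (cases d) (auto simp: graft_def)

lemma down_not: "down P d \<noteq> Some (Atom n)" "down P d \<noteq> Some (Prd n t)"
  by (cases d; auto simp: graft_def)+

lemma leaves_in: "leaves T \<subseteq> edges T"
  by (auto simp: leaves_def)

lemma step_Old: "(e, d) \<in> step T \<Longrightarrow> (Old e, Old d) \<in> step P"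
  by (auto simp: step_def) (metis up_Old down_Old)

lemma above_Old: "above T e d \<Longrightarrow> above P (Old e) (Old d)"
  by (induction rule: rtrancl_induct) (auto intro: rtrancl_into_rtrancl step_Old)

lemma Old_root: "e \<in> edges T \<Longrightarrow> above P (Old e) NewRoot"
proof -
  assume "e \<in> edges T"
  then have "above P (Old e) (Old (tree_root T))" using above_root[OF T] above_Old by blast
  moreover have "(Old (tree_root T), NewRoot) \<in> step P"
    using up_NewRoot down_NewRoot by (auto simp: step_def)
  ultimately show ?thesis by (rule rtrancl_into_rtrancl)
qed

lemma New_root: "y \<in> Y \<Longrightarrow> above P (New y) NewRoot"
proof (cases "\<phi> y = x0")
  case True
  assume y: "y \<in> Y"
  then have "(New y, NewRoot) \<in> step P"
    using True up_NewRoot down_NewRoot by (auto simp: step_def)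
  then show ?thesis by blast
next
  case False
  assume y: "y \<in> Y"
  then have x: "\<phi> y \<in> X" using False phi by auto
  then have "down P (New y) = Some (New (\<phi> y)) \<and> up P (Old (l (\<phi> y))) = Some (New (\<phi> y))"
    using y False up_New down_New by blast
  then have "(New y, Old (l (\<phi> y))) \<in> step P" by (auto simp: step_def)
  then show ?thesis
    using Old_root[of "l (\<phi> y)"] l_in[OF x] leaves_in by (meson converse_rtrancl_into_rtrancl subsetD)
qed

lemma rooted_graft: "rooted P"
  unfolding rooted_def
proof (intro conjI allI impI ballI)
  have "finite (leaves T)" using rooted_finite[OF T] leaves_in finite_subset by blast
  then have "finite X" using l bij_betw_finite by blast
  then show "finite (verts P)" using T by (simp add: graft_simps rooted_def)
  show "finite (edges P)" using rooted_finite[OF T] fin by (simp add: graft_simps)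
  show "tree_root P \<in> edges P" by (simp add: graft_simps)
  fix e v
  assume ev: "incident P e v"
  show "e \<in> edges P"
    using ev up_in[OF T] down_in[OF T] leaves_in
    by (cases e) (auto simp: incident_def graft_simps, auto simp: graft_def split: if_splits intro: root_in[OF T])
  show "v \<in> verts P"
  proof (cases v)
    case (Old w)
    then show ?thesis
      using ev up_in[OF T] down_in[OF T] by (auto simp: incident_def graft_simps up_Old down_Old)
  next
    case (New x)
    then show ?thesis
      using ev inv_l phi by (auto simp: incident_def graft_simps down_New up_New')
  qed (use ev up_not down_not in \<open>auto simp: incident_def graft_simps\<close>)
next
  show "(down P d = None) = (d = tree_root P)" if d: "d \<in> edges P" for d
    using d down_None_iff[OF T]
    by (cases d) (auto simp: graft_simps, auto simp: graft_def split: if_splits)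
  show "\<exists>!e. up P e = Some v" if "v \<in> verts P" for v
  proof (cases v)
    case (Old w)
    then have "w \<in> verts T" using that by (auto simp: graft_simps)
    then show ?thesis
      using Old up_out_edge[OF T] up_inj[OF T] unfolding Old up_Old by blast
  next
    case (New x)
    then have "x \<in> X" using that by (auto simp: graft_simps)
    then show ?thesis unfolding New by (simp add: up_New)
  qed (use that up_NewRoot in \<open>auto simp: graft_simps\<close>)
  show "above P d (tree_root P)" if "d \<in> edges P" for d
    using that Old_root New_root by (auto simp: graft_simps)
qed

lemma leaves_graft: "leaves P = New ` Y"
proof -
  have "up P (Old e) \<noteq> None" if "e \<in> edges T" for e
    using that by (auto simp: graft_def leaves_def)
  moreover have "up P (New y) = None" for y by (simp add: graft_def)
  moreover have "up P NewRoot \<noteq> None" by (simp add: graft_def)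
  ultimately show ?thesis unfolding leaves_def graft_simps by (auto simp del: not_None_eq)
qed

lemma in_edges_graft:
  "in_edges P (Old v) = Old ` in_edges T v"
  "x \<noteq> x0 \<Longrightarrow> in_edges P (New x) = New ` {y \<in> Y. \<phi> y = x}"
  "in_edges P NewRoot = insert (Old (tree_root T)) (New ` {y \<in> Y. \<phi> y = x0})"
  using root_in[OF T]
  by (auto simp: in_edges_def graft_simps down_Old down_New down_NewRoot)

lemma out_edge_graft:
  "v \<in> verts T \<Longrightarrow> out_edge P (Old v) = Old (out_edge T v)"
  "x \<in> X \<Longrightarrow> out_edge P (New x) = Old (l x)"
  "out_edge P NewRoot = NewRoot"
  using up_out_edge[OF T]
  by (auto intro!: out_edge_eq[OF rooted_graft] simp: up_Old up_New up_NewRoot)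

text \<open>The vertices are tested separately. Old vertices give the condition on \<open>k\<close>.
  At the corolla on \<open>l x\<close> the leaves labeled by the fiber must cover
  \<open>k (l x)\<close>, and a cover by leaves consists of all leaves above. The bottom corolla is
  then in order: its leaves over \<open>x0\<close> are exactly the leaves of \<open>S\<close> that
  do not lie above the image of the root of \<open>T\<close>.\<close>

lemma tree_map_graft_iff:
  assumes S: "rooted S" and l': "bij_betw l' Y (leaves S)"
  shows "tree_map P S (\<lambda>e\<in>edges P. on_graft k l' (tree_root S) e) \<longleftrightarrow>
    tree_map T S (\<lambda>e\<in>edges T. k e) \<and> (\<forall>y\<in>Y. \<forall>x\<in>X. \<phi> y = x \<longleftrightarrow> above S (l' y) (k (l x)))"
    (is "tree_map P S ?h \<longleftrightarrow> tree_map T S ?k \<and> ?compat")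
proof -
  have h: "?h (Old e) = k e" if "e \<in> edges T" for e
    using that by (auto simp: graft_simps on_graft_def)
  have hN: "?h (New y) = l' y" if "y \<in> Y" for y
    using that by (auto simp: graft_simps on_graft_def)
  have hR: "?h NewRoot = tree_root S"
    by (auto simp: graft_simps on_graft_def)
  have l'_inj: "inj_on l' A" if "A \<subseteq> Y" for A
    using l' that by (auto simp: bij_betw_def intro: inj_on_subset)
  have l'_leaf: "l' y \<in> leaves S" if "y \<in> Y" for y using l' that by (auto simp: bij_betw_def)
  then have l'_edge: "l' y \<in> edges S" if "y \<in> Y" for y using that by (auto simp: leaves_def)
  have surj: "\<exists>y\<in>Y. z = l' y" if "z \<in> leaves S" for z using l' that by (auto simp: bij_betw_def)
  have inj_on_New: "inj_on ?h (New ` A)" if "A \<subseteq> Y" for A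
  proof (rule inj_on_imageI)
    have "(?h \<circ> New) y = l' y" if "y \<in> A" for y
      using hN[of y] \<open>A \<subseteq> Y\<close> that unfolding comp_apply by blast
    then show "inj_on (?h \<circ> New) A" using l'_inj[OF that] by (simp add: inj_on_def)
  qed
  have leaf_eq: "a = l' y" if "y \<in> Y" "above S a (l' y)" for a y
    using above_leaf[OF S that(2)] l'_leaf[OF that(1)] by (simp add: leaves_def)
  have l_eq: "y = y'" if "l' y = l' y'" "y \<in> Y" "y' \<in> Y" for y y'
    using l' that by (auto simp: bij_betw_def inj_on_def)
  have inT: "in_edges T v \<subseteq> edges T" for v by (auto simp: in_edges_def)
  have old: "inj_on ?h (in_edges P (Old v)) \<longleftrightarrow> inj_on ?k (in_edges T v)"
      "?h ` in_edges P (Old v) = ?k ` in_edges T v" for v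
  proof -
    have e: "?h (Old d) = ?k d" if "d \<in> in_edges T v" for d
      using that h inT by auto
    show "inj_on ?h (in_edges P (Old v)) \<longleftrightarrow> inj_on ?k (in_edges T v)"
      using e unfolding in_edges_graft by (auto simp: inj_on_def)
    show "?h ` in_edges P (Old v) = ?k ` in_edges T v"
      using e unfolding in_edges_graft image_image by (auto intro!: image_cong)
  qed
  have all: "(\<forall>d\<in>edges P. Q d) \<longleftrightarrow> (\<forall>e\<in>edges T. Q (Old e)) \<and> (\<forall>y\<in>Y. Q (New y)) \<and> Q NewRoot" for Q
    by (auto simp: graft_simps)
  have funcs: "?h \<in> edges P \<rightarrow>\<^sub>E edges S \<longleftrightarrow> ?k \<in> edges T \<rightarrow>\<^sub>E edges S"
  proof -
    have "?h \<in> edges P \<rightarrow>\<^sub>E edges S \<longleftrightarrow> (\<forall>d\<in>edges P. ?h d \<in> edges S)"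
      by (simp only: PiE_iff restrict_extensional simp_thms)
    also have "\<dots> \<longleftrightarrow> (\<forall>e\<in>edges T. k e \<in> edges S)"
      unfolding all
      using l'_edge root_in[OF S] by (simp add: h hN hR del: restrict_apply)
    also have "\<dots> \<longleftrightarrow> ?k \<in> edges T \<rightarrow>\<^sub>E edges S" by (auto simp: PiE_iff)
    finally show ?thesis .
  qed
  let ?V = "\<lambda>v. inj_on ?h (in_edges P v) \<and> cover S (?h (out_edge P v)) (?h ` in_edges P v)"
  have oldV: "?V (Old v) \<longleftrightarrow> inj_on ?k (in_edges T v) \<and> cover S (?k (out_edge T v)) (?k ` in_edges T v)"
    if "v \<in> verts T" for v
    unfolding old using that out_edge_in[OF T] h by (simp add: out_edge_graft)
  have split: "tree_map P S ?h \<longleftrightarrow> tree_map T S ?k \<and> (\<forall>x\<in>X. ?V (New x)) \<and> ?V NewRoot"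
    unfolding tree_map_iff_cover[OF S] funcs
    using oldV by (simp only: graft_simps(2) ball_Un ball_simps) blast
  have newV: "?V (New x) \<longleftrightarrow> cover S (k (l x)) (l' ` {y \<in> Y. \<phi> y = x})" if "x \<in> X" for x
  proof -
    have x: "x \<noteq> x0" "l x \<in> edges T" using that l_in leaves_in by auto
    have "?h ` in_edges P (New x) = l' ` {y \<in> Y. \<phi> y = x}"
      unfolding in_edges_graft(2)[OF x(1)] image_image using hN by (auto intro!: image_cong)
    moreover have "inj_on ?h (in_edges P (New x))"
      unfolding in_edges_graft(2)[OF x(1)] by (rule inj_on_New) auto
    ultimately show ?thesis
      using out_edge_graft(2)[OF that] h[OF x(2)] by simp
  qed
  have rootV: "?V NewRoot \<longleftrightarrow> k (tree_root T) \<notin> l' ` {y \<in> Y. \<phi> y = x0} \<and>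
      cover S (tree_root S) (insert (k (tree_root T)) (l' ` {y \<in> Y. \<phi> y = x0}))"
  proof -
    have "?h ` in_edges P NewRoot = insert (k (tree_root T)) (l' ` {y \<in> Y. \<phi> y = x0})"
      unfolding in_edges_graft image_insert image_image h[OF root_in[OF T]]
      using hN by (auto intro!: arg_cong2[where f = insert] image_cong)
    \<comment> \<open>On the new leaves injectivity is that of \<open>l'\<close>; what can fail is a
      collision with the image of the root of \<open>T\<close>.\<close>
    moreover have "inj_on ?h (in_edges P NewRoot) \<longleftrightarrow> k (tree_root T) \<notin> l' ` {y \<in> Y. \<phi> y = x0}"
    proof -
      have "inj_on ?h (New ` {y \<in> Y. \<phi> y = x0})"
        by (rule inj_on_New) auto
      moreover have "?h ` New ` {y \<in> Y. \<phi> y = x0} = l' ` {y \<in> Y. \<phi> y = x0}"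
        unfolding image_image using hN by (auto intro!: image_cong)
      moreover have "New ` {y \<in> Y. \<phi> y = x0} - {Old (tree_root T)} = New ` {y \<in> Y. \<phi> y = x0}" by auto
      ultimately show ?thesis
        unfolding in_edges_graft inj_on_insert h[OF root_in[OF T]] by simp
    qed
    ultimately show ?thesis using out_edge_graft(3) hR by simp
  qed
  show ?thesis
  proof
    assume "tree_map P S ?h"
    then have k: "tree_map T S ?k" and new: "\<And>x. x \<in> X \<Longrightarrow> cover S (k (l x)) (l' ` {y \<in> Y. \<phi> y = x})"
      using split newV by auto
    have "\<phi> y = x \<longleftrightarrow> above S (l' y) (k (l x))" if "x \<in> X" "y \<in> Y" for x y
    proof
      show "above S (l' y) (k (l x))" if "\<phi> y = x"
        using new[OF \<open>x \<in> X\<close>] that \<open>y \<in> Y\<close> by (auto simp: cover_def)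
      assume "above S (l' y) (k (l x))"
      \<comment> \<open>The cover supplies a leaf from the fiber below \<open>l' y\<close>, and
        comparable leaves coincide.\<close>
      then obtain y' where "y' \<in> Y" "\<phi> y' = x" "above S (l' y) (l' y')"
        using new[OF \<open>x \<in> X\<close>] l'_leaf[OF \<open>y \<in> Y\<close>] unfolding cover_def by blast
      then show "\<phi> y = x" using leaf_eq l_eq \<open>y \<in> Y\<close> by blast
    qed
    then show "tree_map T S ?k \<and> ?compat" using k by blast
  next
    assume "tree_map T S ?k \<and> ?compat"
    then have k: "tree_map T S ?k" and compat: "\<And>y x. y \<in> Y \<Longrightarrow> x \<in> X \<Longrightarrow> \<phi> y = x \<longleftrightarrow> above S (l' y) (k (l x))"
      by auto
    have kE: "k e \<in> edges S" if "e \<in> edges T" for e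
      using k that by (auto simp: tree_map_def PiE_iff)
    have "cover S (k (l x)) (l' ` {y \<in> Y. \<phi> y = x})" if x: "x \<in> X" for x
    proof -
      have "l' ` {y \<in> Y. \<phi> y = x} = {z \<in> leaves S. above S z (k (l x))}"
      proof (intro Set.set_eqI iffI)
        fix z
        assume "z \<in> {z \<in> leaves S. above S z (k (l x))}"
        then obtain y where "y \<in> Y" "z = l' y" "above S (l' y) (k (l x))" using surj by blast
        then show "z \<in> l' ` {y \<in> Y. \<phi> y = x}" using compat[OF _ x] by blast
      qed (use compat[OF _ x] l'_leaf in auto)
      then show ?thesis
        using cover_leaves_above[OF S kE[of "l x"]] l_in[OF x] leaves_in by auto
    qed
    \<comment> \<open>A leaf of \<open>S\<close> above the image of the root lifts to a leaf of
      \<open>T\<close>, whose label must then be \<phi> of it; so a leaf labeled over the base point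
      is not above that image.\<close>
    moreover have top: "\<phi> y \<in> X" if y: "y \<in> Y" and ab: "above S (l' y) (k (tree_root T))" for y
    proof -
      obtain e where e: "e \<in> leaves T" "above S (l' y) (?k e)"
        using tree_map_lift_leaf[OF T S k root_in[OF T] l'_leaf[OF y]] ab root_in[OF T] by auto
      then obtain x where x: "x \<in> X" "e = l x" using l by (auto simp: bij_betw_def)
      then show ?thesis using compat[OF y x(1)] e leaves_in by auto
    qed
    have not_top: "\<not> above S (l' y) (k (tree_root T))" if "y \<in> Y" "\<phi> y = x0" for y
      using top[of y] that by auto
    have "?V NewRoot"
      unfolding rootV unfolding cover_def
    proof (intro conjI ballI impI)
      show "k (tree_root T) \<notin> l' ` {y \<in> Y. \<phi> y = x0}"
      proof
        assume "k (tree_root T) \<in> l' ` {y \<in> Y. \<phi> y = x0}"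
        then obtain y where "y \<in> Y" "\<phi> y = x0" "l' y = k (tree_root T)" by auto
        then show False using not_top[of y] by simp
      qed
      show "tree_root S \<in> edges S" using root_in[OF S] .
      have edges: "e \<in> edges S" if "e \<in> insert (k (tree_root T)) (l' ` {y \<in> Y. \<phi> y = x0})" for e
        using that kE[OF root_in[OF T]] l'_edge by auto
      then show "above S e (tree_root S)" if "e \<in> insert (k (tree_root T)) (l' ` {y \<in> Y. \<phi> y = x0})" for e
        using that above_root[OF S] by blast
      show "e = d" if "e \<in> insert (k (tree_root T)) (l' ` {y \<in> Y. \<phi> y = x0})"
        "d \<in> insert (k (tree_root T)) (l' ` {y \<in> Y. \<phi> y = x0})" "above S e d" for e d
        using that not_top leaf_eq by (elim insertE imageE CollectE conjE) simp_all
      fix z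
      assume "z \<in> leaves S"
      then obtain y where y: "y \<in> Y" "z = l' y" using surj by blast
      show "\<exists>e\<in>insert (k (tree_root T)) (l' ` {y \<in> Y. \<phi> y = x0}). above S z e"
      proof (cases "\<phi> y = x0")
        case False
        then have x: "\<phi> y \<in> X" using phi y by auto
        then have e: "above S (l' y) (k (l (\<phi> y)))" using compat y by blast
        have "l (\<phi> y) \<in> edges T" using l_in[OF x] leaves_in by blast
        then have "above S (k (l (\<phi> y))) (k (tree_root T))"
          using tree_map_above[OF T S k above_root[OF T]] root_in[OF T] by simp
        then show ?thesis using e y by (auto intro: rtrancl_trans)
      qed (use y in auto)
    qed
    ultimately show "tree_map P S ?h" using k split newV by blast
  qed
qed

text \<open>The identity of \<open>P\<close> is itself of the form treated in
  \<open>tree_map_graft_iff\<close>, with \<open>k = Old\<close> and \<open>l' = New\<close>; both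
  facts are read off from it.\<close>

lemma tree_map_Old: "tree_map T P (\<lambda>e\<in>edges T. Old e)"
  and above_New_Old: "y \<in> Y \<Longrightarrow> x \<in> X \<Longrightarrow> \<phi> y = x \<longleftrightarrow> above P (New y) (Old (l x))"
proof -
  have "(\<lambda>e\<in>edges P. on_graft Old New (tree_root P) e) = (\<lambda>e\<in>edges P. e)"
    by (rule restrict_ext) (auto simp: graft_simps on_graft_def)
  then have "tree_map P P (\<lambda>e\<in>edges P. on_graft Old New (tree_root P) e)"
    using tree_map_id[OF rooted_graft] by simp
  moreover have "bij_betw New Y (leaves P)"
    by (auto simp: bij_betw_def inj_on_def leaves_graft)
  ultimately have *: "tree_map T P (\<lambda>e\<in>edges T. Old e) \<and>
      (\<forall>y\<in>Y. \<forall>x\<in>X. \<phi> y = x \<longleftrightarrow> above P (New y) (Old (l x)))"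
    using tree_map_graft_iff[OF rooted_graft] by blast
  then show "tree_map T P (\<lambda>e\<in>edges T. Old e)" by blast
  show "\<phi> y = x \<longleftrightarrow> above P (New y) (Old (l x))" if "y \<in> Y" "x \<in> X"
    using * that by blast
qed

end

section \<open>Families of trees over a G-set\<close>

lemma homset_BG [simp]: "x \<in> homset (BG G) a b \<longleftrightarrow> x \<in> carrier G"
  by (simp add: homset_def BG_def)

lemma BG_simps [simp]:
  "Obj (BG G) = UNIV" "Arr (BG G) = carrier G" "Ident (BG G) a = \<one>\<^bsub>G\<^esub>" "Comp (BG G) y x = y \<otimes>\<^bsub>G\<^esub> x"
  by (auto simp: BG_def)

lemma category_BG: "group G \<Longrightarrow> category (BG G)"
proof -
  assume "group G"
  then interpret group G .
  show ?thesis by unfold_locales (auto simp: m_assoc)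
qed

lemma category_finset: "category finset_cat"
  unfolding finset_cat_def
proof (rule category_mk_cat)
  fix n m k l :: nat and f g h
  assume f: "f \<in> {1..n} \<rightarrow>\<^sub>E {1..m}"
  show "compose {1..n} h (compose {1..n} g f) = compose {1..n} (compose {1..m} h g) f"
    by (rule extensionalityI[where A = "{1..n}"]) (use f in \<open>auto simp: compose_def PiE_iff\<close>)
  show "compose {1..n} (\<lambda>i\<in>{1..m}. i) f = f"
    by (rule extensionalityI[where A = "{1..n}"]) (use f in \<open>auto simp: compose_def PiE_iff\<close>)
  show "compose {1..n} f (\<lambda>i\<in>{1..n}. i) = f"
    by (rule extensionalityI[where A = "{1..n}"]) (use f in \<open>auto simp: compose_def PiE_iff\<close>)
qed (auto simp: compose_def PiE_iff)

lemma homset_finset: "f \<in> homset finset_cat n m \<longleftrightarrow>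
    n \<ge> 1 \<and> m \<ge> 1 \<and> (\<exists>d \<in> {1..n} \<rightarrow>\<^sub>E {1..m}. f = (n, m, d))"
  by (simp add: finset_cat_def homset_mk_cat)

lemma Comp_finset: "Comp finset_cat g f = (fst f, fst (snd g), compose {1..fst f} (datum g) (datum f))"
  by (simp add: finset_cat_def)

lemma homset_Omega: "f \<in> homset Omega T S \<longleftrightarrow> rooted T \<and> rooted S \<and> (\<exists>d. tree_map T S d \<and> f = (T, S, d))"
  by (simp add: Omega_def homset_mk_cat is_tree_iff)

lemma Comp_Omega: "Comp Omega g f = (fst f, fst (snd g), compose (edges (fst f)) (datum g) (datum f))"
  by (simp add: Omega_def)

lemma Ident_Omega: "Ident Omega T = (T, T, \<lambda>e\<in>edges T. e)"
  by (simp add: Omega_def)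

lemma Obj_Omega: "Obj Omega = {T. rooted T}"
  by (simp add: Omega_def is_tree_iff)

text \<open>The edge function of the isomorphism from the tree over \<open>i\<close> to the tree
  over its translate by \<open>x\<close>.\<close>

definition tact :: "'g treefam \<Rightarrow> 'g \<Rightarrow> nat \<Rightarrow> tok \<Rightarrow> tok" where
  "tact T x i = datum (Far T (x, i))"

locale gset = group G for G (structure) +
  fixes X :: "'a ordgset"
  assumes X: "X \<in> Obj (functor_cat (BG G) finset_cat)"
begin

lemma X_functor: "cat_functor (BG G) finset_cat X"
  using X by (simp add: Obj_functor_cat)

lemma Far_X: "x \<in> carrier G \<Longrightarrow>
    Far X x = (Fob X (), Fob X (), gact X x) \<and> gact X x \<in> points X \<rightarrow>\<^sub>E points X"
proof -
  interpret X: cat_functor "BG G" finset_cat X by (rule X_functor)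
  assume "x \<in> carrier G"
  then show ?thesis
    using X.Far_in[of x "()" "()"] by (auto simp: homset_finset gact_def points_def)
qed

lemma gact_in: "x \<in> carrier G \<Longrightarrow> i \<in> points X \<Longrightarrow> gact X x i \<in> points X"
  using Far_X by blast

lemma gact_one: "i \<in> points X \<Longrightarrow> gact X \<one> i = i"
proof -
  interpret X: cat_functor "BG G" finset_cat X by (rule X_functor)
  show "i \<in> points X \<Longrightarrow> gact X \<one> i = i"
    using X.Far_Ident[of "()"] by (simp add: gact_def points_def finset_cat_def)
qed

lemma gact_mult: "x \<in> carrier G \<Longrightarrow> y \<in> carrier G \<Longrightarrow> i \<in> points X \<Longrightarrow>
    gact X (y \<otimes> x) i = gact X y (gact X x i)"
proof -
  interpret X: cat_functor "BG G" finset_cat X by (rule X_functor)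
  assume a: "x \<in> carrier G" "y \<in> carrier G" "i \<in> points X"
  then have "Far X (y \<otimes> x) = Comp finset_cat (Far X y) (Far X x)"
    using X.Far_Comp[of x "()" "()" y "()"] by simp
  then have "gact X (y \<otimes> x) = compose {1..fst (Far X x)} (gact X y) (gact X x)"
    by (simp add: gact_def Comp_finset)
  also have "{1..fst (Far X x)} = points X" using Far_X[OF a(1)] by (simp add: points_def)
  finally show "gact X (y \<otimes> x) i = gact X y (gact X x i)"
    using a by (simp add: compose_def)
qed

lemma gact_inv: "x \<in> carrier G \<Longrightarrow> i \<in> points X \<Longrightarrow> gact X (inv x) (gact X x i) = i"
  using gact_mult[of x "inv x" i] gact_one by simp

lemma homset_groupoid: "f \<in> homset (action_groupoid G X) i j \<longleftrightarrow>
    i \<in> points X \<and> (\<exists>x\<in>carrier G. f = (x, i) \<and> j = gact X x i)"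
  by (auto simp: homset_def action_groupoid_def)

lemma groupoid_simps:
  "Obj (action_groupoid G X) = points X" "Arr (action_groupoid G X) = carrier G \<times> points X"
  "Ident (action_groupoid G X) i = (\<one>, i)" "Comp (action_groupoid G X) (y, j) (x, i) = (y \<otimes> x, i)"
  by (simp_all add: action_groupoid_def)

lemma category_groupoid: "category (action_groupoid G X)"
proof
  fix f
  assume "f \<in> Arr (action_groupoid G X)"
  then show "Dom (action_groupoid G X) f \<in> Obj (action_groupoid G X)"
    "Cod (action_groupoid G X) f \<in> Obj (action_groupoid G X)"
    using gact_in by (auto simp: action_groupoid_def)
next
  fix f g a b c
  assume "f \<in> homset (action_groupoid G X) a b" "g \<in> homset (action_groupoid G X) b c"
  then show "Comp (action_groupoid G X) g f \<in> homset (action_groupoid G X) a c"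
    using gact_mult by (auto simp: homset_groupoid groupoid_simps)
next
  fix f a b
  assume "f \<in> homset (action_groupoid G X) a b"
  then show "Comp (action_groupoid G X) (Ident (action_groupoid G X) b) f = f"
    "Comp (action_groupoid G X) f (Ident (action_groupoid G X) a) = f"
    by (auto simp: homset_groupoid groupoid_simps)
next
  fix f g h a b c d
  assume "f \<in> homset (action_groupoid G X) a b" "g \<in> homset (action_groupoid G X) b c"
    "h \<in> homset (action_groupoid G X) c d"
  then show "Comp (action_groupoid G X) h (Comp (action_groupoid G X) g f) =
      Comp (action_groupoid G X) (Comp (action_groupoid G X) h g) f"
    by (auto simp: homset_groupoid groupoid_simps m_assoc)
next
  fix a
  assume "a \<in> Obj (action_groupoid G X)"
  then show "Ident (action_groupoid G X) a \<in> homset (action_groupoid G X) a a"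
    using gact_one[of a] by (auto simp: homset_groupoid groupoid_simps)
qed

lemma category_Omega_orbit: "category (Omega_orbit G X)"
  unfolding Omega_orbit_def by (rule category_functor_cat[OF category_groupoid category_Omega])

text \<open>Normal form of an extensional functor on the action groupoid; by
  \<open>mk_fam_eq\<close> every family has it, so families are equal if their trees and edge
  functions are.\<close>

definition mk_fam :: "(nat \<Rightarrow> tree) \<Rightarrow> ('a \<Rightarrow> nat \<Rightarrow> tok \<Rightarrow> tok) \<Rightarrow> 'a treefam" where
  "mk_fam F m = \<lparr>Fob = (\<lambda>i\<in>points X. F i),
     Far = (\<lambda>(x, i)\<in>carrier G \<times> points X. (F i, F (gact X x i), m x i))\<rparr>"

lemma mk_fam_in:
  assumes F: "\<And>i. i \<in> points X \<Longrightarrow> rooted (F i)"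
    and m: "\<And>x i. x \<in> carrier G \<Longrightarrow> i \<in> points X \<Longrightarrow> tree_map (F i) (F (gact X x i)) (m x i)"
    and m1: "\<And>i. i \<in> points X \<Longrightarrow> m \<one> i = (\<lambda>e\<in>edges (F i). e)"
    and mm: "\<And>x y i. x \<in> carrier G \<Longrightarrow> y \<in> carrier G \<Longrightarrow> i \<in> points X \<Longrightarrow>
      m (y \<otimes> x) i = compose (edges (F i)) (m y (gact X x i)) (m x i)"
  shows "mk_fam F m \<in> Obj (Omega_orbit G X)"
proof -
  interpret A: category "action_groupoid G X" by (rule category_groupoid)
  interpret O: category Omega by (rule category_Omega)
  have "cat_functor (action_groupoid G X) Omega (mk_fam F m)"
    by unfold_locales
      (auto simp: mk_fam_def homset_groupoid groupoid_simps Obj_Omega F homset_Omega m gact_in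
        gact_one gact_mult Ident_Omega Comp_Omega m1 mm)
  then show ?thesis
    by (simp add: Omega_orbit_def Obj_functor_cat mk_fam_def groupoid_simps)
qed

context
  fixes T
  assumes T: "T \<in> Obj (Omega_orbit G X)"
begin

lemma fam_functor: "cat_functor (action_groupoid G X) Omega T"
  using T by (simp add: Omega_orbit_def Obj_functor_cat)

lemma fam_rooted: "i \<in> points X \<Longrightarrow> rooted (Fob T i)"
proof -
  interpret T: cat_functor "action_groupoid G X" Omega T by (rule fam_functor)
  show "i \<in> points X \<Longrightarrow> rooted (Fob T i)"
    using T.Fob_in by (simp add: groupoid_simps Obj_Omega)
qed

lemma Far_fam: "x \<in> carrier G \<Longrightarrow> i \<in> points X \<Longrightarrow>
    Far T (x, i) = (Fob T i, Fob T (gact X x i), tact T x i) \<and> tree_map (Fob T i) (Fob T (gact X x i)) (tact T x i)"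
proof -
  interpret T: cat_functor "action_groupoid G X" Omega T by (rule fam_functor)
  assume "x \<in> carrier G" "i \<in> points X"
  then show ?thesis
    using T.Far_in[of "(x, i)" i "gact X x i"] by (auto simp: homset_groupoid homset_Omega tact_def)
qed

lemma tact_map: "x \<in> carrier G \<Longrightarrow> i \<in> points X \<Longrightarrow> tree_map (Fob T i) (Fob T (gact X x i)) (tact T x i)"
  using Far_fam by blast

lemma tact_in: "x \<in> carrier G \<Longrightarrow> i \<in> points X \<Longrightarrow> e \<in> edges (Fob T i) \<Longrightarrow>
    tact T x i e \<in> edges (Fob T (gact X x i))"
  using tact_map by (auto simp: tree_map_def)

lemma tact_one': "i \<in> points X \<Longrightarrow> tact T \<one> i = (\<lambda>e\<in>edges (Fob T i). e)"
proof -
  interpret T: cat_functor "action_groupoid G X" Omega T by (rule fam_functor)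
  show "i \<in> points X \<Longrightarrow> tact T \<one> i = (\<lambda>e\<in>edges (Fob T i). e)"
    using T.Far_Ident[of i] by (simp add: groupoid_simps tact_def Ident_Omega)
qed

lemma tact_mult': "x \<in> carrier G \<Longrightarrow> y \<in> carrier G \<Longrightarrow> i \<in> points X \<Longrightarrow>
    tact T (y \<otimes> x) i = compose (edges (Fob T i)) (tact T y (gact X x i)) (tact T x i)"
proof -
  interpret T: cat_functor "action_groupoid G X" Omega T by (rule fam_functor)
  assume a: "x \<in> carrier G" "y \<in> carrier G" "i \<in> points X"
  then have "Far T (y \<otimes> x, i) = Comp Omega (Far T (y, gact X x i)) (Far T (x, i))"
    using T.Far_Comp[of "(x, i)" i "gact X x i" "(y, gact X x i)" "gact X y (gact X x i)"]
    by (auto simp: homset_groupoid groupoid_simps gact_in)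
  then have "tact T (y \<otimes> x) i = compose (edges (fst (Far T (x, i)))) (tact T y (gact X x i)) (tact T x i)"
    by (simp add: tact_def Comp_Omega)
  moreover have "fst (Far T (x, i)) = Fob T i" using Far_fam[OF a(1,3)] by (metis fst_conv)
  ultimately show ?thesis by simp
qed

lemma tact_one: "i \<in> points X \<Longrightarrow> e \<in> edges (Fob T i) \<Longrightarrow> tact T \<one> i e = e"
  by (simp add: tact_one')

lemma tact_mult: "x \<in> carrier G \<Longrightarrow> y \<in> carrier G \<Longrightarrow> i \<in> points X \<Longrightarrow> e \<in> edges (Fob T i) \<Longrightarrow>
    tact T (y \<otimes> x) i e = tact T y (gact X x i) (tact T x i e)"
  by (simp add: tact_mult' compose_def)

lemma tact_inv: "x \<in> carrier G \<Longrightarrow> i \<in> points X \<Longrightarrow> e \<in> edges (Fob T i) \<Longrightarrow>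
    tact T (inv x) (gact X x i) (tact T x i e) = e"
  using tact_mult[of x "inv x" i e] tact_one by simp

lemma tact_inv': "x \<in> carrier G \<Longrightarrow> i \<in> points X \<Longrightarrow> e \<in> edges (Fob T (gact X x i)) \<Longrightarrow>
    tact T x i (tact T (inv x) (gact X x i) e) = e"
  using tact_inv[of "inv x" "gact X x i" e] gact_in gact_inv by simp

lemma tact_above: "x \<in> carrier G \<Longrightarrow> i \<in> points X \<Longrightarrow> above (Fob T i) e d \<Longrightarrow>
    above (Fob T (gact X x i)) (tact T x i e) (tact T x i d)"
  using tree_map_above[OF fam_rooted fam_rooted tact_map] gact_in by blast

text \<open>Carried back by \<open>inv x\<close>, the root of the target lies above the root of the
  source; carried forth again, it lies above the image of that root. Only the root lies below the
  root.\<close>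

lemma tact_root:
  assumes x: "x \<in> carrier G" "i \<in> points X"
  shows "tact T x i (tree_root (Fob T i)) = tree_root (Fob T (gact X x i))"
proof -
  let ?S = "Fob T (gact X x i)"
  have S: "rooted ?S" using fam_rooted gact_in x by blast
  let ?e = "tact T (inv x) (gact X x i) (tree_root ?S)"
  have "?e \<in> edges (Fob T i)"
    using tact_in[of "inv x" "gact X x i" "tree_root ?S"] x gact_in gact_inv root_in[OF S] by simp
  then have "above (Fob T i) ?e (tree_root (Fob T i))"
    using above_root[OF fam_rooted] x by blast
  then have "above ?S (tree_root ?S) (tact T x i (tree_root (Fob T i)))"
    using tact_above[OF x, of ?e] tact_inv'[OF x root_in[OF S]] by simp
  then show ?thesis
    using no_step_root[OF S] by (metis converse_rtranclE)
qed

lemma mk_fam_eq: "T = mk_fam (Fob T) (tact T)"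
proof -
  have ext: "Fob T \<in> extensional (points X)" "Far T \<in> extensional (carrier G \<times> points X)"
    using T by (auto simp: Omega_orbit_def Obj_functor_cat groupoid_simps)
  have "Far T = Far (mk_fam (Fob T) (tact T))"
    by (rule extensionalityI[OF ext(2)]) (auto simp: mk_fam_def Far_fam)
  moreover have "Fob T = Fob (mk_fam (Fob T) (tact T))"
    by (rule extensionalityI[OF ext(1)]) (auto simp: mk_fam_def)
  ultimately show ?thesis by (metis funct.surjective old.unit.exhaust)
qed

end

lemma mk_fam_cong:
  assumes "\<And>i. i \<in> points X \<Longrightarrow> F i = F' i"
    and "\<And>x i. x \<in> carrier G \<Longrightarrow> i \<in> points X \<Longrightarrow> m x i = m' x i"
  shows "mk_fam F m = mk_fam F' m'"
  using assms gact_in by (auto simp: mk_fam_def intro!: restrict_ext)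

lemma mk_fam_simps:
  "i \<in> points X \<Longrightarrow> Fob (mk_fam F m) i = F i"
  "x \<in> carrier G \<Longrightarrow> i \<in> points X \<Longrightarrow> tact (mk_fam F m) x i = m x i"
  by (simp_all add: mk_fam_def tact_def)

text \<open>Normal form of a map of families. The restriction to edges lets \<open>k\<close> be
  given by formulas whose values elsewhere do not matter.\<close>

definition fam_arr :: "'a treefam \<Rightarrow> 'a treefam \<Rightarrow> (nat \<Rightarrow> tok \<Rightarrow> tok) \<Rightarrow> 'a treefam_arr" where
  "fam_arr T S k = (T, S, \<lambda>i\<in>points X. (Fob T i, Fob S i, \<lambda>e\<in>edges (Fob T i). k i e))"

lemma edge_map_fam_arr:
  "i \<in> points X \<Longrightarrow> e \<in> edges (Fob T i) \<Longrightarrow> edge_map (fam_arr T S k) i e = k i e"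
  by (simp add: fam_arr_def edge_map_def)

lemma fam_arr_cong:
  "(\<And>i e. i \<in> points X \<Longrightarrow> e \<in> edges (Fob T i) \<Longrightarrow> k i e = k' i e) \<Longrightarrow> fam_arr T S k = fam_arr T S k'"
  by (auto simp: fam_arr_def intro!: restrict_ext)

text \<open>Naturality at the arrow \<open>(x, i)\<close> of the groupoid, evaluated on edges, is
  equivariance of \<open>k\<close>.\<close>

lemma fam_arr_hom: "fam_arr T S k \<in> homset (Omega_orbit G X) T S \<longleftrightarrow>
    T \<in> Obj (Omega_orbit G X) \<and> S \<in> Obj (Omega_orbit G X) \<and>
    (\<forall>i\<in>points X. tree_map (Fob T i) (Fob S i) (\<lambda>e\<in>edges (Fob T i). k i e)) \<and>
    (\<forall>x\<in>carrier G. \<forall>i\<in>points X. \<forall>e\<in>edges (Fob T i). k (gact X x i) (tact T x i e) = tact S x i (k i e))"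
proof (cases "T \<in> Obj (Omega_orbit G X) \<and> S \<in> Obj (Omega_orbit G X)")
  case TS: True
  let ?m = "\<lambda>i. (Fob T i, Fob S i, \<lambda>e\<in>edges (Fob T i). k i e)"
  have "fam_arr T S k \<in> homset (Omega_orbit G X) T S \<longleftrightarrow>
    (\<forall>i\<in>points X. tree_map (Fob T i) (Fob S i) (\<lambda>e\<in>edges (Fob T i). k i e)) \<and>
    (\<forall>x\<in>carrier G. \<forall>i\<in>points X. Comp Omega (?m (gact X x i)) (Far T (x, i)) = Comp Omega (Far S (x, i)) (?m i))"
    using TS gact_in fam_rooted
    by (auto simp: fam_arr_def Omega_orbit_def homset_functor_cat groupoid_simps homset_groupoid
        homset_Omega)
  moreover have "Comp Omega (?m (gact X x i)) (Far T (x, i)) = Comp Omega (Far S (x, i)) (?m i) \<longleftrightarrow>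
    (\<forall>e\<in>edges (Fob T i). k (gact X x i) (tact T x i e) = tact S x i (k i e))"
    if "x \<in> carrier G" "i \<in> points X" for x i
    using TS Far_fam[OF _ that] tact_in[OF _ that]
    by (auto simp: Comp_Omega compose_def fun_eq_iff restrict_def)
  ultimately show ?thesis using TS by simp
qed (auto simp: Omega_orbit_def homset_functor_cat)

lemma hom_fam_arr:
  assumes "\<eta> \<in> homset (Omega_orbit G X) T S"
  shows "\<eta> = fam_arr T S (edge_map \<eta>)"
proof -
  obtain \<theta> where \<theta>: "\<theta> \<in> extensional (points X)" "\<eta> = (T, S, \<theta>)"
      "\<And>i. i \<in> points X \<Longrightarrow> \<theta> i \<in> homset Omega (Fob T i) (Fob S i)"
    using assms by (auto simp: Omega_orbit_def homset_functor_cat groupoid_simps)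
  have "\<theta> = (\<lambda>i\<in>points X. (Fob T i, Fob S i, \<lambda>e\<in>edges (Fob T i). edge_map \<eta> i e))"
  proof (rule extensionalityI[OF \<theta>(1)])
    fix i
    assume i: "i \<in> points X"
    then obtain d where d: "\<theta> i = (Fob T i, Fob S i, d)" "tree_map (Fob T i) (Fob S i) d"
      using \<theta>(3) by (auto simp: homset_Omega)
    have "d = (\<lambda>e\<in>edges (Fob T i). d e)"
      using d(2) by (auto simp: tree_map_def PiE_iff extensional_restrict)
    then show "\<theta> i = (\<lambda>i\<in>points X. (Fob T i, Fob S i, \<lambda>e\<in>edges (Fob T i). edge_map \<eta> i e)) i"
      using i d \<theta>(2) by (simp add: edge_map_def)
  qed simp
  then show ?thesis using \<theta>(2) by (simp add: fam_arr_def)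
qed

lemma fam_arr_Comp:
  assumes "\<And>i e. i \<in> points X \<Longrightarrow> e \<in> edges (Fob T i) \<Longrightarrow> k i e \<in> edges (Fob S i)"
  shows "Comp (Omega_orbit G X) (fam_arr S R k') (fam_arr T S k) = fam_arr T R (\<lambda>i e. k' i (k i e))"
  using assms
  by (auto simp: fam_arr_def Omega_orbit_def Comp_functor_cat groupoid_simps Comp_Omega compose_def
      intro!: restrict_ext)

lemma fam_arr_Ident: "Ident (Omega_orbit G X) T = fam_arr T T (\<lambda>i e. e)"
  by (auto simp: fam_arr_def Omega_orbit_def Ident_functor_cat groupoid_simps Ident_Omega
      intro!: restrict_ext)

lemma fam_arr_eq_iff: "fam_arr T S k = fam_arr T S k' \<longleftrightarrow>
    (\<forall>i\<in>points X. \<forall>e\<in>edges (Fob T i). k i e = k' i e)"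
  by (metis edge_map_fam_arr fam_arr_cong)

lemma ltree_arr_eq: "ltree_arr X s t k = (s, t, fam_arr (fst s) (fst t) k)"
  by (simp add: ltree_arr_def fam_arr_def)

section \<open>Retractions and labelings\<close>

lemma group_actionI:
  assumes "\<And>x. x \<in> carrier G \<Longrightarrow> r x \<in> E \<rightarrow>\<^sub>E E"
    and "\<And>a. a \<in> E \<Longrightarrow> r \<one> a = a"
    and "\<And>x y a. x \<in> carrier G \<Longrightarrow> y \<in> carrier G \<Longrightarrow> a \<in> E \<Longrightarrow> r (y \<otimes> x) a = r y (r x a)"
  shows "group_action G E r"
proof -
  have bij: "r x \<in> Bij E" if "x \<in> carrier G" for x
  proof -
    have "bij_betw (r x) E E"
    proof (rule bij_betw_byWitness[where f' = "r (inv x)"])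
      show "\<forall>a\<in>E. r (inv x) (r x a) = a" using assms(3)[of x "inv x"] assms(2) that by simp
      show "\<forall>a\<in>E. r x (r (inv x) a) = a" using assms(3)[of "inv x" x] assms(2) that by simp
      show "r x ` E \<subseteq> E" "r (inv x) ` E \<subseteq> E" using assms(1)[of x] assms(1)[of "inv x"] that by auto
    qed
    then show ?thesis using assms(1)[OF that] by (simp add: Bij_def PiE_iff)
  qed
  have "r \<in> hom G (BijGroup E)"
  proof (rule homI)
    show "r x \<in> carrier (BijGroup E)" if "x \<in> carrier G" for x
      using bij that by (simp add: BijGroup_def)
    show "r (y \<otimes> x) = r y \<otimes>\<^bsub>BijGroup E\<^esub> r x" if "y \<in> carrier G" "x \<in> carrier G" for x y
    proof -
      have "r (y \<otimes> x) = compose E (r y) (r x)"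
      proof (rule extensionalityI[where A = E])
        show "r (y \<otimes> x) \<in> extensional E" using assms(1)[of "y \<otimes> x"] that by (simp add: PiE_iff)
      qed (simp_all add: compose_def assms(3) that)
      then show ?thesis using bij that by (simp add: BijGroup_def)
    qed
  qed
  then show ?thesis
    unfolding group_action_def group_hom_def group_hom_axioms_def
    using group_BijGroup is_group by blast
qed

context
  fixes A :: "'a retr"
  assumes A: "is_retr G X A"
begin

lemma retr_facts:
  "finite (pts A)" "group_action G (pts A) (ract A)"
  "ract A \<in> extensional (carrier G)"
  "sect A \<in> points X \<rightarrow>\<^sub>E pts A" "proj A \<in> pts A \<rightarrow>\<^sub>E points X"
  "\<And>x i. x \<in> carrier G \<Longrightarrow> i \<in> points X \<Longrightarrow> sect A (gact X x i) = ract A x (sect A i)"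
  "\<And>x a. x \<in> carrier G \<Longrightarrow> a \<in> pts A \<Longrightarrow> proj A (ract A x a) = gact X x (proj A a)"
  "\<And>i. i \<in> points X \<Longrightarrow> proj A (sect A i) = i"
  using A by (auto simp: is_retr_def)

lemma ract_ext: "x \<in> carrier G \<Longrightarrow> ract A x \<in> pts A \<rightarrow>\<^sub>E pts A"
  using group_action.bij_prop0[OF retr_facts(2)] by (auto simp: Bij_def bij_betw_def PiE_iff)

lemma ract_in: "x \<in> carrier G \<Longrightarrow> a \<in> pts A \<Longrightarrow> ract A x a \<in> pts A"
  using ract_ext by blast

lemma ract_one: "a \<in> pts A \<Longrightarrow> ract A \<one> a = a"
  using group_action.id_eq_one[OF retr_facts(2)] by (metis restrict_apply)

lemma ract_mult: "x \<in> carrier G \<Longrightarrow> y \<in> carrier G \<Longrightarrow> a \<in> pts A \<Longrightarrow>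
    ract A (y \<otimes> x) a = ract A y (ract A x a)"
  using group_action.composition_rule[OF retr_facts(2)] by blast

lemma ract_inv: "x \<in> carrier G \<Longrightarrow> a \<in> pts A \<Longrightarrow> ract A (inv x) (ract A x a) = a"
  using ract_mult[of x "inv x" a] ract_one by simp

lemma ract_inv': "x \<in> carrier G \<Longrightarrow> a \<in> pts A \<Longrightarrow> ract A x (ract A (inv x) a) = a"
  using ract_mult[of "inv x" x a] ract_one by simp

lemma proj_in: "a \<in> pts A \<Longrightarrow> proj A a \<in> points X"
  using retr_facts(5) by blast

lemma sect_in: "i \<in> points X \<Longrightarrow> sect A i \<in> pts A"
  using retr_facts(4) by blast

lemma labels_in: "a \<in> labels X A \<Longrightarrow> a \<in> pts A"
  by (simp add: labels_def)

text \<open>The image of the section is stable under \<open>inv x\<close> as well, so no label is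
  moved into it.\<close>

lemma labels_act: "x \<in> carrier G \<Longrightarrow> a \<in> labels X A \<Longrightarrow> ract A x a \<in> labels X A"
proof -
  assume x: "x \<in> carrier G" and a: "a \<in> labels X A"
  have "ract A x a \<noteq> sect A i" if i: "i \<in> points X" for i
  proof
    assume "ract A x a = sect A i"
    then have "a = sect A (gact X (inv x) i)"
      using ract_inv[OF x labels_in[OF a]] retr_facts(6)[of "inv x" i] x i by simp
    then show False using a gact_in x i by (auto simp: labels_def)
  qed
  then show ?thesis using ract_in[OF x labels_in[OF a]] by (auto simp: labels_def)
qed

lemma fiber_labels: "i \<in> points X \<Longrightarrow> fiber A i - {sect A i} = {a \<in> labels X A. proj A a = i}"
  using retr_facts(8) by (auto simp: fiber_def labels_def)

lemma finite_fiber: "finite (fiber A i)"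
  using retr_facts(1) by (simp add: fiber_def)

lemma pts_cases: "a \<in> pts A \<Longrightarrow> a \<in> labels X A \<or> (a = sect A (proj A a) \<and> proj A a \<in> points X)"
  using retr_facts(8) proj_in by (auto simp: labels_def)

end

context
  fixes A T \<chi>
  assumes A: "is_retr G X A" and T: "T \<in> Obj (Omega_orbit G X)" and lab: "labeling G X A T \<chi>"
begin

lemma labeling_pair: "a \<in> labels X A \<Longrightarrow> \<chi> a = (proj A a, snd (\<chi> a))"
  using lab by (metis labeling_def prod.collapse)

text \<open>A label over \<open>i\<close> names a leaf of the tree over \<open>i\<close>, so a
  labeling of the family restricts to each fiber; \<open>grafting\<close> takes labelings in this
  form.\<close>

lemma labeling_bij: "i \<in> points X \<Longrightarrow> bij_betw (\<lambda>a. snd (\<chi> a)) {a \<in> labels X A. proj A a = i} (leaves (Fob T i))"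
proof -
  assume i: "i \<in> points X"
  have bij: "bij_betw \<chi> (labels X A) (fam_leaves X T)" using lab by (simp add: labeling_def)
  have "inj_on (\<lambda>a. snd (\<chi> a)) {a \<in> labels X A. proj A a = i}"
  proof (rule inj_onI)
    fix a b
    assume "a \<in> {a \<in> labels X A. proj A a = i}" "b \<in> {a \<in> labels X A. proj A a = i}" "snd (\<chi> a) = snd (\<chi> b)"
    then have "\<chi> a = \<chi> b" "a \<in> labels X A" "b \<in> labels X A"
      using labeling_pair by (metis (mono_tags, lifting) mem_Collect_eq)+
    then show "a = b" using bij by (auto simp: bij_betw_def inj_on_def)
  qed
  moreover have "(\<lambda>a. snd (\<chi> a)) ` {a \<in> labels X A. proj A a = i} = leaves (Fob T i)"
  proof (intro Set.set_eqI iffI)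
    fix z
    assume "z \<in> (\<lambda>a. snd (\<chi> a)) ` {a \<in> labels X A. proj A a = i}"
    then obtain a where a: "a \<in> labels X A" "proj A a = i" "z = snd (\<chi> a)" by auto
    then have "\<chi> a = (i, z)" using labeling_pair by metis
    then have "(i, z) \<in> fam_leaves X T" using bij a by (metis bij_betwE)
    then show "z \<in> leaves (Fob T i)" by (simp add: fam_leaves_def)
  next
    fix z
    assume "z \<in> leaves (Fob T i)"
    then have "(i, z) \<in> fam_leaves X T" using i by (simp add: fam_leaves_def)
    then obtain a where a: "a \<in> labels X A" "\<chi> a = (i, z)"
      using bij by (metis bij_betw_imp_surj_on imageE)
    then have "proj A a = i" using labeling_pair by (metis fst_conv)
    then show "z \<in> (\<lambda>a. snd (\<chi> a)) ` {a \<in> labels X A. proj A a = i}" using a by force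
  qed
  ultimately show ?thesis by (simp add: bij_betw_def)
qed

lemma label_leaf: "a \<in> labels X A \<Longrightarrow> snd (\<chi> a) \<in> leaves (Fob T (proj A a))"
  using labeling_bij[of "proj A a"] proj_in[OF A] labels_in[OF A] by (auto simp: bij_betw_def)

lemma label_edge: "a \<in> labels X A \<Longrightarrow> snd (\<chi> a) \<in> edges (Fob T (proj A a))"
  using label_leaf by (auto simp: leaves_def)

lemma label_inj: "a \<in> labels X A \<Longrightarrow> b \<in> labels X A \<Longrightarrow> proj A a = proj A b \<Longrightarrow>
    snd (\<chi> a) = snd (\<chi> b) \<Longrightarrow> a = b"
  using labeling_bij[of "proj A b"] proj_in[OF A] labels_in[OF A] by (auto simp: bij_betw_def inj_on_def)

lemma label_surj: "i \<in> points X \<Longrightarrow> z \<in> leaves (Fob T i) \<Longrightarrow> \<exists>a\<in>labels X A. proj A a = i \<and> snd (\<chi> a) = z"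
proof -
  assume "i \<in> points X" "z \<in> leaves (Fob T i)"
  then have "z \<in> (\<lambda>a. snd (\<chi> a)) ` {a \<in> labels X A. proj A a = i}"
    using bij_betw_imp_surj_on[OF labeling_bij] by simp
  then show ?thesis by auto
qed

lemma label_act: "x \<in> carrier G \<Longrightarrow> a \<in> labels X A \<Longrightarrow>
    snd (\<chi> (ract A x a)) = tact T x (proj A a) (snd (\<chi> a))"
proof -
  assume x: "x \<in> carrier G" and a: "a \<in> labels X A"
  have "\<chi> (ract A x a) = leaf_act X T x (\<chi> a)" using lab x a by (simp add: labeling_def)
  also have "\<chi> a = (proj A a, snd (\<chi> a))" using labeling_pair[OF a] .
  finally show ?thesis by (simp add: leaf_act_def tact_def)
qed

lemma label_above: "a \<in> labels X A \<Longrightarrow> above (Fob T (proj A a)) e (snd (\<chi> a)) \<Longrightarrow> e = snd (\<chi> a)"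
  using above_leaf[OF fam_rooted[OF T proj_in[OF A labels_in[OF A]]]] label_leaf
  by (simp add: leaves_def)

end

text \<open>Converse of \<open>labeling_bij\<close> and \<open>label_act\<close>: equivariant
  fiberwise labelings glue.\<close>

lemma labelingI:
  assumes A: "is_retr G X A" and T: "T \<in> Obj (Omega_orbit G X)"
    and bij: "\<And>i. i \<in> points X \<Longrightarrow> bij_betw l {a \<in> labels X A. proj A a = i} (leaves (Fob T i))"
    and act: "\<And>x a. x \<in> carrier G \<Longrightarrow> a \<in> labels X A \<Longrightarrow> l (ract A x a) = tact T x (proj A a) (l a)"
  shows "labeling G X A T (\<lambda>a\<in>labels X A. (proj A a, l a))"
proof -
  let ?\<chi> = "\<lambda>a\<in>labels X A. (proj A a, l a)"
  have pin: "a \<in> labels X A \<Longrightarrow> proj A a \<in> points X" for a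
    using proj_in[OF A] labels_in[OF A] by blast
  have "bij_betw ?\<chi> (labels X A) (fam_leaves X T)"
    unfolding bij_betw_def
  proof
    show "inj_on ?\<chi> (labels X A)"
    proof (rule inj_onI)
      fix a b
      assume ab: "a \<in> labels X A" "b \<in> labels X A" "?\<chi> a = ?\<chi> b"
      then have "inj_on l {c \<in> labels X A. proj A c = proj A a}"
        using bij[OF pin] by (simp add: bij_betw_def)
      then show "a = b" using ab by (auto simp: inj_on_def)
    qed
    show "?\<chi> ` labels X A = fam_leaves X T"
    proof (intro Set.set_eqI iffI)
      fix z
      assume "z \<in> ?\<chi> ` labels X A"
      then obtain a where a: "a \<in> labels X A" "z = (proj A a, l a)" by auto
      then have "l a \<in> leaves (Fob T (proj A a))"
        using bij[OF pin[OF a(1)]] by (auto simp: bij_betw_def)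
      then show "z \<in> fam_leaves X T" using a pin by (simp add: fam_leaves_def)
    next
      fix z
      assume "z \<in> fam_leaves X T"
      then obtain i e where z: "z = (i, e)" "i \<in> points X" "e \<in> leaves (Fob T i)"
        by (auto simp: fam_leaves_def)
      then have "e \<in> l ` {a \<in> labels X A. proj A a = i}"
        using bij_betw_imp_surj_on[OF bij] by simp
      then obtain a where "a \<in> labels X A" "proj A a = i" "l a = e"
        by auto
      then show "z \<in> ?\<chi> ` labels X A" using z by force
    qed
  qed
  then show ?thesis
    using act labels_act[OF A] retr_facts(7)[OF A] labels_in[OF A]
    by (simp add: labeling_def leaf_act_def tact_def)
qed

lemma Obj_ltree: "(T, \<chi>) \<in> Obj (ltree_cat G X A) \<longleftrightarrow>
    T \<in> Obj (Omega_orbit G X) \<and> labeling G X A T \<chi>"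
  by (simp add: ltree_cat_def)

lemma Obj_orbit_groth: "(A, T, \<chi>) \<in> Obj (orbit_groth G X) \<longleftrightarrow>
    is_retr G X A \<and> T \<in> Obj (Omega_orbit G X) \<and> labeling G X A T \<chi>"
  by (simp add: orbit_groth_def oplax_groth_def ltree_oplax_def Obj_ltree retr_cat_def)

end

section \<open>Grafting families of trees\<close>

locale graft_family = gset G X for G (structure) and X :: "'a ordgset" +
  fixes A :: "'a retr" and T :: "'a treefam" and \<chi> :: "tok \<Rightarrow> nat \<times> tok" and B :: "'a retr"
    and \<phi> :: "tok \<Rightarrow> tok"
  assumes rA: "is_retr G X A" and fT: "T \<in> Obj (Omega_orbit G X)" and labT: "labeling G X A T \<chi>"
    and rB: "is_retr G X B" and mphi: "retr_map G X B A \<phi>"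
begin

lemma phi_facts:
  "\<And>b. b \<in> pts B \<Longrightarrow> \<phi> b \<in> pts A"
  "\<And>x b. x \<in> carrier G \<Longrightarrow> b \<in> pts B \<Longrightarrow> \<phi> (ract B x b) = ract A x (\<phi> b)"
  "\<And>b. b \<in> pts B \<Longrightarrow> proj A (\<phi> b) = proj B b"
  "\<And>i. i \<in> points X \<Longrightarrow> \<phi> (sect B i) = sect A i"
  using mphi by (auto simp: retr_map_def)

abbreviation P :: "nat \<Rightarrow> tree" where
  "P i \<equiv> graft_at (B, A, \<phi>) (T, \<chi>) i"

lemma P_eq: "P i = graft (fiber A i) (sect A i) (\<lambda>a. snd (\<chi> a)) (fiber B i) (sect B i) \<phi> (Fob T i)"
  by (simp add: graft_at_def)

lemma grafting_at:
  assumes "i \<in> points X"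
  shows "grafting (fiber A i) (sect A i) (\<lambda>a. snd (\<chi> a)) (fiber B i) (sect B i) \<phi> (Fob T i)"
proof
  show "rooted (Fob T i)" using fam_rooted[OF fT assms] .
  show "bij_betw (\<lambda>a. snd (\<chi> a)) (fiber A i - {sect A i}) (leaves (Fob T i))"
    using labeling_bij[OF rA fT labT assms] fiber_labels[OF rA assms] by simp
  show "finite (fiber B i)" using finite_fiber[OF rB] .
  show "\<phi> \<in> fiber B i - {sect B i} \<rightarrow> fiber A i"
    using phi_facts by (auto simp: fiber_def)
qed

context
  fixes i
  assumes i: "i \<in> points X"
begin

interpretation g: grafting "fiber A i" "sect A i" "\<lambda>a. snd (\<chi> a)" "fiber B i" "sect B i" \<phi> "Fob T i"
  by (rule grafting_at[OF i])

lemmas fibA = fiber_labels[OF rA i] and fibB = fiber_labels[OF rB i]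

lemma edges_P: "edges (P i) = Old ` edges (Fob T i) \<union> New ` {b \<in> labels X B. proj B b = i} \<union> {NewRoot}"
  using g.graft_simps(1) unfolding P_eq fibB .

lemma ball_P: "(\<forall>e\<in>edges (P i). Q e) \<longleftrightarrow> (\<forall>e\<in>edges (Fob T i). Q (Old e)) \<and>
    (\<forall>b\<in>labels X B. proj B b = i \<longrightarrow> Q (New b)) \<and> Q NewRoot"
  by (auto simp: edges_P)

lemma root_P: "tree_root (P i) = NewRoot"
  using g.graft_simps(3) unfolding P_eq .

lemma rooted_P: "rooted (P i)"
  using g.rooted_graft unfolding P_eq .

lemma leaves_P: "leaves (P i) = New ` {b \<in> labels X B. proj B b = i}"
  using g.leaves_graft unfolding P_eq fibB .

lemma tree_map_P_iff:
  assumes "rooted S" and "bij_betw l' {b \<in> labels X B. proj B b = i} (leaves S)"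
  shows "tree_map (P i) S (\<lambda>e\<in>edges (P i). on_graft k l' (tree_root S) e) \<longleftrightarrow>
    tree_map (Fob T i) S (\<lambda>e\<in>edges (Fob T i). k e) \<and>
    (\<forall>b\<in>labels X B. \<forall>a\<in>labels X A. proj B b = i \<longrightarrow> proj A a = i \<longrightarrow>
      (\<phi> b = a \<longleftrightarrow> above S (l' b) (k (snd (\<chi> a)))))"
proof -
  have "tree_map (P i) S (\<lambda>e\<in>edges (P i). on_graft k l' (tree_root S) e) \<longleftrightarrow>
    tree_map (Fob T i) S (\<lambda>e\<in>edges (Fob T i). k e) \<and>
    (\<forall>b\<in>{b \<in> labels X B. proj B b = i}. \<forall>a\<in>{a \<in> labels X A. proj A a = i}.
      (\<phi> b = a \<longleftrightarrow> above S (l' b) (k (snd (\<chi> a)))))"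
    using g.tree_map_graft_iff[OF assms(1)] assms(2) unfolding P_eq fibA fibB .
  then show ?thesis by auto
qed

lemma above_P:
  "b \<in> labels X B \<Longrightarrow> a \<in> labels X A \<Longrightarrow> proj B b = i \<Longrightarrow> proj A a = i \<Longrightarrow>
    \<phi> b = a \<longleftrightarrow> above (P i) (New b) (Old (snd (\<chi> a)))"
  using g.above_New_Old[of b a] unfolding P_eq fibA fibB by blast

lemma tree_map_Old: "tree_map (Fob T i) (P i) (\<lambda>e\<in>edges (Fob T i). Old e)"
  using g.tree_map_Old unfolding P_eq .

end

definition Pact :: "'a \<Rightarrow> nat \<Rightarrow> tok \<Rightarrow> tok" where
  "Pact x i = (\<lambda>e\<in>edges (P i). on_graft (\<lambda>e. Old (tact T x i e)) (\<lambda>a. New (ract B x a)) NewRoot e)"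

lemma graft_obj_eq: "graft_obj G X (B, A, \<phi>) (T, \<chi>) = (mk_fam P Pact, \<lambda>a\<in>labels X B. (proj B a, New a))"
  by (simp add: graft_obj_def Let_def mk_fam_def Pact_def tact_def)

lemma Pact_simps:
  assumes "i \<in> points X"
  shows "e \<in> edges (Fob T i) \<Longrightarrow> Pact x i (Old e) = Old (tact T x i e)"
    and "b \<in> labels X B \<Longrightarrow> proj B b = i \<Longrightarrow> Pact x i (New b) = New (ract B x b)"
    and "Pact x i NewRoot = NewRoot"
  unfolding Pact_def edges_P[OF assms] by (auto simp: on_graft_def)

lemma edges_P_cases [consumes 2, case_names Old New NewRoot]:
  assumes "e \<in> edges (P i)" "i \<in> points X"
  obtains d where "e = Old d" "d \<in> edges (Fob T i)"
    | b where "e = New b" "b \<in> labels X B" "proj B b = i"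
    | "e = NewRoot"
  using assms by (auto simp: edges_P)

text \<open>Functoriality is checked on the three kinds of edges. That \<open>x\<close> acts by maps
  of trees is an instance of \<open>tree_map_P_iff\<close>: old edges move by \<open>tact\<close>,
  new leaves by \<open>ract\<close>, and the compatibility condition is \<open>above_P\<close> at
  the translated point.\<close>

lemma fam_P: "mk_fam P Pact \<in> Obj (Omega_orbit G X)"
proof (rule mk_fam_in)
  show "rooted (P i)" if "i \<in> points X" for i using rooted_P[OF that] .
  show "Pact \<one> i = (\<lambda>e\<in>edges (P i). e)" if "i \<in> points X" for i
  proof (rule extensionalityI[where A = "edges (P i)"])
    fix e
    assume e: "e \<in> edges (P i)"
    then have "Pact \<one> i e = e"
      using that
      by (cases rule: edges_P_cases)
        (simp_all add: Pact_simps that tact_one[OF fT] ract_one[OF rB labels_in[OF rB]])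
    then show "Pact \<one> i e = (\<lambda>e\<in>edges (P i). e) e" using e by simp
  qed (simp_all add: Pact_def)
  show "Pact (y \<otimes> x) i = compose (edges (P i)) (Pact y (gact X x i)) (Pact x i)"
    if x: "x \<in> carrier G" and y: "y \<in> carrier G" and i: "i \<in> points X" for x y i
  proof (rule extensionalityI[where A = "edges (P i)"])
    fix e
    assume e: "e \<in> edges (P i)"
    note xi = gact_in[OF x i]
    from e i show "Pact (y \<otimes> x) i e = compose (edges (P i)) (Pact y (gact X x i)) (Pact x i) e"
    proof (cases rule: edges_P_cases)
      case (Old d)
      then show ?thesis
        using e tact_in[OF fT x i] by (simp add: compose_def Pact_simps i xi tact_mult[OF fT x y i])
    next
      case (New b)
      then have "ract B x b \<in> labels X B" "proj B (ract B x b) = gact X x i"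
        using labels_act[OF rB x] retr_facts(7)[OF rB x] labels_in[OF rB] by auto
      then show ?thesis
        using e New by (simp add: compose_def Pact_simps i xi ract_mult[OF rB x y labels_in[OF rB]])
    next
      case NewRoot
      then show ?thesis using e by (simp add: compose_def Pact_simps i xi)
    qed
  qed (simp_all add: Pact_def compose_def)
  show "tree_map (P i) (P (gact X x i)) (Pact x i)" if x: "x \<in> carrier G" and i: "i \<in> points X" for x i
  proof -
    note j = gact_in[OF x i]
    have act: "ract B x b \<in> labels X B" "proj B (ract B x b) = gact X x i"
      if "b \<in> labels X B" "proj B b = i" for b
      using that labels_act[OF rB x] retr_facts(7)[OF rB x] labels_in[OF rB] by auto
    have actA: "ract A x b \<in> labels X A" "proj A (ract A x b) = gact X x i"
      if "b \<in> labels X A" "proj A b = i" for b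
      using that labels_act[OF rA x] retr_facts(7)[OF rA x] labels_in[OF rA] by auto
    have bij: "bij_betw (\<lambda>b. New (ract B x b)) {b \<in> labels X B. proj B b = i} (leaves (P (gact X x i)))"
      unfolding leaves_P[OF j]
    proof (rule bij_betw_byWitness[where f' = "\<lambda>e. case e of New b \<Rightarrow> ract B (inv x) b"])
      show "\<forall>a\<in>{b \<in> labels X B. proj B b = i}. (case New (ract B x a) of New b \<Rightarrow> ract B (inv x) b) = a"
        using ract_inv[OF rB x] labels_in[OF rB] by simp
      show "\<forall>a'\<in>New ` {b \<in> labels X B. proj B b = gact X x i}.
          New (ract B x (case a' of New b \<Rightarrow> ract B (inv x) b)) = a'"
        using ract_inv'[OF rB x] labels_in[OF rB] by auto
      show "(\<lambda>b. New (ract B x b)) ` {b \<in> labels X B. proj B b = i} \<subseteq>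
          New ` {b \<in> labels X B. proj B b = gact X x i}"
        using act by auto
      show "(\<lambda>e. case e of New b \<Rightarrow> ract B (inv x) b) ` New ` {b \<in> labels X B. proj B b = gact X x i} \<subseteq>
          {b \<in> labels X B. proj B b = i}"
        using labels_act[OF rB inv_closed[OF x]] retr_facts(7)[OF rB inv_closed[OF x]] labels_in[OF rB]
          gact_inv[OF x i] by auto
    qed
    have "tree_map (Fob T i) (P (gact X x i)) (compose (edges (Fob T i)) (\<lambda>e\<in>edges (Fob T (gact X x i)). Old e) (tact T x i))"
      by (rule tree_map_compose[OF fam_rooted[OF fT i] fam_rooted[OF fT j] rooted_P[OF j] tact_map[OF fT x i] tree_map_Old[OF j]])
    moreover have "compose (edges (Fob T i)) (\<lambda>e\<in>edges (Fob T (gact X x i)). Old e) (tact T x i) =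
        (\<lambda>e\<in>edges (Fob T i). Old (tact T x i e))"
      using tact_in[OF fT x i] by (auto simp: compose_def intro!: restrict_ext)
    moreover have "\<phi> b = a \<longleftrightarrow> above (P (gact X x i)) (New (ract B x b)) (Old (tact T x i (snd (\<chi> a))))"
      if b: "b \<in> labels X B" "proj B b = i" and a: "a \<in> labels X A" "proj A a = i" for a b
    proof -
      \<comment> \<open>Equivariance of \<phi>, and cancellation of \<open>x\<close> by means of
        \<open>inv x\<close>.\<close>
      have "\<phi> b = a \<longleftrightarrow> \<phi> (ract B x b) = ract A x a"
        using phi_facts(1)[of b] phi_facts(2)[OF x, of b] ract_inv[OF rA x, of "\<phi> b"] ract_inv[OF rA x, of a]
          labels_in[OF rB b(1)] labels_in[OF rA a(1)] by metis
      also have "\<dots> \<longleftrightarrow> above (P (gact X x i)) (New (ract B x b)) (Old (snd (\<chi> (ract A x a))))"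
        by (rule above_P[OF j act(1)[OF b] actA(1)[OF a] act(2)[OF b] actA(2)[OF a]])
      also have "snd (\<chi> (ract A x a)) = tact T x i (snd (\<chi> a))"
        using label_act[OF rA fT labT x a(1)] a(2) by simp
      finally show ?thesis .
    qed
    ultimately have "tree_map (P i) (P (gact X x i)) (\<lambda>e\<in>edges (P i).
        on_graft (\<lambda>e. Old (tact T x i e)) (\<lambda>b. New (ract B x b)) (tree_root (P (gact X x i))) e)"
      using tree_map_P_iff[OF i rooted_P[OF j] bij] by simp
    then show ?thesis unfolding root_P[OF j] Pact_def .
  qed
qed

lemma labeling_P: "labeling G X B (mk_fam P Pact) (\<lambda>a\<in>labels X B. (proj B a, New a))"
proof (rule labelingI[OF rB fam_P])
  show "bij_betw New {a \<in> labels X B. proj B a = i} (leaves (Fob (mk_fam P Pact) i))"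
    if "i \<in> points X" for i
    using that leaves_P[OF that] by (auto simp: mk_fam_simps bij_betw_def inj_on_def)
  show "New (ract B x a) = tact (mk_fam P Pact) x (proj B a) (New a)"
    if "x \<in> carrier G" "a \<in> labels X B" for x a
    using that proj_in[OF rB labels_in[OF rB]] by (simp add: mk_fam_simps Pact_simps)
qed

end

section \<open>The Grothendieck construction over an orbit\<close>

context gset
begin

text \<open>The condition of \<open>tree_map_graft_iff\<close> over each point; it determines \<open>\<phi>\<close> from \<open>k\<close>.\<close>

definition compat :: "'a gobj \<Rightarrow> 'a gobj \<Rightarrow> (tok \<Rightarrow> tok) \<Rightarrow> (nat \<Rightarrow> tok \<Rightarrow> tok) \<Rightarrow> bool" where
  "compat = (\<lambda>(A, T, \<chi>) (B, S, \<psi>) \<phi> k. \<forall>b\<in>labels X B. \<forall>a\<in>labels X A. proj B b = proj A a \<longrightarrow>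
     (\<phi> b = a \<longleftrightarrow> above (Fob S (proj B b)) (snd (\<psi> b)) (k (proj B b) (snd (\<chi> a)))))"

text \<open>Normal form of an arrow: preservation of labels and roots forces the values on all new
  edges, so only \<phi> and the action \<open>k\<close> on old edges are left to choose.\<close>

definition mk_garr :: "'a gobj \<Rightarrow> 'a gobj \<Rightarrow> (tok \<Rightarrow> tok) \<Rightarrow> (nat \<Rightarrow> tok \<Rightarrow> tok) \<Rightarrow> 'a garr" where
  "mk_garr s t \<phi> k = (s, t, ((fst t, fst s, \<phi>),
     ltree_arr X (graft_obj G X (fst t, fst s, \<phi>) (snd s)) (snd t)
       (\<lambda>i. on_graft (k i) (\<lambda>b. snd (snd (snd t) b)) (tree_root (Fob (fst (snd t)) i)))))"

text \<open>The arrow part of \<open>old_funct\<close>; it forgets \<phi> and the new edges, and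
  recovers \<open>k\<close> from a normal form.\<close>

definition old_part :: "'a garr \<Rightarrow> 'a treefam_arr" where
  "old_part a = fam_arr (fst (snd (fst a))) (fst (snd (fst (snd a))))
     (\<lambda>i e. edge_map (datum (snd (datum a))) i (Old e))"

lemma compatD: "compat (A, T, \<chi>) (B, S, \<psi>) \<phi> k \<Longrightarrow> b \<in> labels X B \<Longrightarrow> a \<in> labels X A \<Longrightarrow>
    proj B b = proj A a \<Longrightarrow>
    \<phi> b = a \<longleftrightarrow> above (Fob S (proj B b)) (snd (\<psi> b)) (k (proj B b) (snd (\<chi> a)))"
  by (simp add: compat_def)

lemma homset_ltree: "f \<in> homset (ltree_cat G X A) (T, \<chi>) (S, \<psi>) \<longleftrightarrow>
    (T, \<chi>) \<in> Obj (ltree_cat G X A) \<and> (S, \<psi>) \<in> Obj (ltree_cat G X A) \<and>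
    (\<exists>\<eta> \<in> homset (Omega_orbit G X) T S. f = ((T, \<chi>), (S, \<psi>), \<eta>) \<and>
      (\<forall>a\<in>labels X A. edge_map \<eta> (proj A a) (snd (\<chi> a)) = snd (\<psi> a)) \<and>
      (\<forall>i\<in>points X. edge_map \<eta> i (tree_root (Fob T i)) = tree_root (Fob S i)))"
  by (auto simp: ltree_cat_def homset_mk_cat)

lemma homset_orbit_groth: "f \<in> homset (orbit_groth G X) (A, T, \<chi>) (B, S, \<psi>) \<longleftrightarrow>
    (A, T, \<chi>) \<in> Obj (orbit_groth G X) \<and> (B, S, \<psi>) \<in> Obj (orbit_groth G X) \<and>
    (\<exists>\<phi> \<alpha>. f = ((A, T, \<chi>), (B, S, \<psi>), ((B, A, \<phi>), \<alpha>)) \<and> retr_map G X B A \<phi> \<and>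
      \<alpha> \<in> homset (ltree_cat G X B) (graft_obj G X (B, A, \<phi>) (T, \<chi>)) (S, \<psi>))"
  by (auto simp: orbit_groth_def oplax_groth_def homset_mk_cat ltree_oplax_def retr_cat_def)

text \<open>Labels and roots are preserved by construction, and equivariance on new edges is
  automatic because labelings are equivariant and the action carries roots to roots. What remains is
  equivariance on old edges and, over each point, the criterion \<open>tree_map_P_iff\<close>, whose
  second half is \<open>compat\<close>.\<close>

lemma mk_garr_in_iff:
  assumes s: "(A, T, \<chi>) \<in> Obj (orbit_groth G X)" and t: "(B, S, \<psi>) \<in> Obj (orbit_groth G X)"
  shows "mk_garr (A, T, \<chi>) (B, S, \<psi>) \<phi> k \<in> homset (orbit_groth G X) (A, T, \<chi>) (B, S, \<psi>) \<longleftrightarrow>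
    retr_map G X B A \<phi> \<and> fam_arr T S k \<in> homset (Omega_orbit G X) T S \<and>
    compat (A, T, \<chi>) (B, S, \<psi>) \<phi> k"
proof (cases "retr_map G X B A \<phi>")
  case \<phi>: True
  have A: "is_retr G X A" "T \<in> Obj (Omega_orbit G X)" "labeling G X A T \<chi>"
    and B: "is_retr G X B" "S \<in> Obj (Omega_orbit G X)" "labeling G X B S \<psi>"
    using s t by (auto simp: Obj_orbit_groth)
  interpret graft_family G X A T \<chi> B \<phi>
    by unfold_locales (use A B \<phi> in auto)
  let ?PT = "mk_fam P Pact"
  let ?k = "\<lambda>i. on_graft (k i) (\<lambda>b. snd (\<psi> b)) (tree_root (Fob S i))"
  let ?\<eta> = "fam_arr ?PT S ?k"
  have E: "Fob ?PT i = P i" if "i \<in> points X" for i using that by (simp add: mk_fam_simps)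
  have lab_ok: "edge_map ?\<eta> (proj B b) (New b) = snd (\<psi> b)" if "b \<in> labels X B" for b
  proof -
    have i: "proj B b \<in> points X" using proj_in[OF B(1)] labels_in[OF B(1)] that by blast
    have "New b \<in> edges (P (proj B b))" using that by (simp add: edges_P[OF i])
    then show ?thesis using i by (simp add: edge_map_fam_arr E on_graft_def)
  qed
  have root_ok: "edge_map ?\<eta> i (tree_root (Fob ?PT i)) = tree_root (Fob S i)" if "i \<in> points X" for i
    using that by (simp add: E root_P edge_map_fam_arr edges_P on_graft_def)
  have "mk_garr (A, T, \<chi>) (B, S, \<psi>) \<phi> k \<in> homset (orbit_groth G X) (A, T, \<chi>) (B, S, \<psi>) \<longleftrightarrow>
      ((?PT, \<lambda>a\<in>labels X B. (proj B a, New a)), (S, \<psi>), ?\<eta>) \<in>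
        homset (ltree_cat G X B) (?PT, \<lambda>a\<in>labels X B. (proj B a, New a)) (S, \<psi>)"
    using s t \<phi> by (simp add: homset_orbit_groth mk_garr_def ltree_arr_eq graft_obj_eq)
  also have "\<dots> \<longleftrightarrow> ?\<eta> \<in> homset (Omega_orbit G X) ?PT S"
    using fam_P labeling_P B lab_ok root_ok by (simp add: homset_ltree Obj_ltree)
  also have "\<dots> \<longleftrightarrow>
      (\<forall>i\<in>points X. tree_map (P i) (Fob S i) (\<lambda>e\<in>edges (P i). ?k i e)) \<and>
      (\<forall>x\<in>carrier G. \<forall>i\<in>points X. \<forall>e\<in>edges (P i). ?k (gact X x i) (Pact x i e) = tact S x i (?k i e))"
    using fam_P B E by (simp add: fam_arr_hom mk_fam_simps cong: ball_cong)
  also have "(\<forall>x\<in>carrier G. \<forall>i\<in>points X. \<forall>e\<in>edges (P i). ?k (gact X x i) (Pact x i e) = tact S x i (?k i e)) \<longleftrightarrow>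
      (\<forall>x\<in>carrier G. \<forall>i\<in>points X. \<forall>e\<in>edges (Fob T i). k (gact X x i) (tact T x i e) = tact S x i (k i e))"
  proof (rule ball_cong[OF refl], rule ball_cong[OF refl])
    fix x i
    assume x: "x \<in> carrier G" and i: "i \<in> points X"
    have "?k (gact X x i) (Pact x i NewRoot) = tact S x i (?k i NewRoot)"
      by (simp add: Pact_simps i on_graft_def tact_root[OF B(2) x i])
    moreover have "?k (gact X x i) (Pact x i (New b)) = tact S x i (?k i (New b))"
      if "b \<in> labels X B" "proj B b = i" for b
      using that label_act[OF B x] by (simp add: Pact_simps i on_graft_def)
    moreover have "?k (gact X x i) (Pact x i (Old e)) = k (gact X x i) (tact T x i e)" "?k i (Old e) = k i e"
      if "e \<in> edges (Fob T i)" for e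
      using that by (simp_all add: Pact_simps i on_graft_def)
    ultimately show "(\<forall>e\<in>edges (P i). ?k (gact X x i) (Pact x i e) = tact S x i (?k i e)) \<longleftrightarrow>
        (\<forall>e\<in>edges (Fob T i). k (gact X x i) (tact T x i e) = tact S x i (k i e))"
      unfolding ball_P[OF i] by auto
  qed
  also have "(\<forall>i\<in>points X. tree_map (P i) (Fob S i) (\<lambda>e\<in>edges (P i). ?k i e)) \<longleftrightarrow>
      (\<forall>i\<in>points X. tree_map (Fob T i) (Fob S i) (\<lambda>e\<in>edges (Fob T i). k i e)) \<and>
      compat (A, T, \<chi>) (B, S, \<psi>) \<phi> k"
  proof -
    have "tree_map (P i) (Fob S i) (\<lambda>e\<in>edges (P i). ?k i e) \<longleftrightarrow>
        tree_map (Fob T i) (Fob S i) (\<lambda>e\<in>edges (Fob T i). k i e) \<and>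
        (\<forall>b\<in>labels X B. \<forall>a\<in>labels X A. proj B b = i \<longrightarrow> proj A a = i \<longrightarrow>
          (\<phi> b = a \<longleftrightarrow> above (Fob S i) (snd (\<psi> b)) (k i (snd (\<chi> a)))))"
      if i: "i \<in> points X" for i
      using tree_map_P_iff[OF i fam_rooted[OF B(2) i] labeling_bij[OF B i]] .
    \<comment> \<open>Every label lies over some point, so the conditions for all \<open>i\<close>
      together are \<open>compat\<close>.\<close>
    moreover have "(\<forall>i\<in>points X. \<forall>b\<in>labels X B. \<forall>a\<in>labels X A. proj B b = i \<longrightarrow> proj A a = i \<longrightarrow>
        (\<phi> b = a \<longleftrightarrow> above (Fob S i) (snd (\<psi> b)) (k i (snd (\<chi> a))))) \<longleftrightarrow>
        compat (A, T, \<chi>) (B, S, \<psi>) \<phi> k"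
      unfolding compat_def prod.case by (metis proj_in[OF B(1)] labels_in[OF B(1)])
    ultimately show ?thesis by auto
  qed
  finally show ?thesis using \<phi> A B by (auto simp: fam_arr_hom)
next
  case False
  then show ?thesis by (auto simp: homset_orbit_groth mk_garr_def)
qed

lemma old_part_mk_garr:
  assumes s: "(A, T, \<chi>) \<in> Obj (orbit_groth G X)" and t: "(B, S, \<psi>) \<in> Obj (orbit_groth G X)"
    and \<phi>: "retr_map G X B A \<phi>"
  shows "old_part (mk_garr (A, T, \<chi>) (B, S, \<psi>) \<phi> k) = fam_arr T S k"
proof -
  interpret graft_family G X A T \<chi> B \<phi>
    by unfold_locales (use s t \<phi> in \<open>auto simp: Obj_orbit_groth\<close>)
  have "edge_map (fam_arr (mk_fam P Pact) S (\<lambda>i. on_graft (k i) h (r i))) i (Old e) = k i e"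
    if "i \<in> points X" "e \<in> edges (Fob T i)" for i e h r
    using that by (simp add: edge_map_fam_arr mk_fam_simps edges_P on_graft_def)
  then show ?thesis
    by (auto simp: old_part_def mk_garr_def ltree_arr_eq graft_obj_eq intro!: fam_arr_cong)
qed

lemma mk_garr_cong:
  assumes s: "(A, T, \<chi>) \<in> Obj (orbit_groth G X)" and t: "(B, S, \<psi>) \<in> Obj (orbit_groth G X)"
    and \<phi>: "retr_map G X B A \<phi>"
    and k: "\<And>i e. i \<in> points X \<Longrightarrow> e \<in> edges (Fob T i) \<Longrightarrow> k i e = k' i e"
  shows "mk_garr (A, T, \<chi>) (B, S, \<psi>) \<phi> k = mk_garr (A, T, \<chi>) (B, S, \<psi>) \<phi> k'"
proof -
  interpret graft_family G X A T \<chi> B \<phi>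
    by unfold_locales (use s t \<phi> in \<open>auto simp: Obj_orbit_groth\<close>)
  show ?thesis
    by (auto simp: mk_garr_def ltree_arr_eq graft_obj_eq mk_fam_simps edges_P k on_graft_def
        intro!: fam_arr_cong)
qed

text \<open>Take for \<open>k\<close> the restriction of the given arrow to old edges; on the new
  ones, agreement with the normal form is preservation of labels and roots.\<close>

lemma hom_mk_garr:
  assumes f: "f \<in> homset (orbit_groth G X) (A, T, \<chi>) (B, S, \<psi>)"
  shows "\<exists>\<phi> k. f = mk_garr (A, T, \<chi>) (B, S, \<psi>) \<phi> k \<and> retr_map G X B A \<phi> \<and>
    fam_arr T S k \<in> homset (Omega_orbit G X) T S \<and> compat (A, T, \<chi>) (B, S, \<psi>) \<phi> k"
proof -
  from f obtain \<phi> \<alpha> where s: "(A, T, \<chi>) \<in> Obj (orbit_groth G X)" and t: "(B, S, \<psi>) \<in> Obj (orbit_groth G X)"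
    and f_eq: "f = ((A, T, \<chi>), (B, S, \<psi>), ((B, A, \<phi>), \<alpha>))" and \<phi>: "retr_map G X B A \<phi>"
    and \<alpha>: "\<alpha> \<in> homset (ltree_cat G X B) (graft_obj G X (B, A, \<phi>) (T, \<chi>)) (S, \<psi>)"
    by (auto simp: homset_orbit_groth)
  interpret graft_family G X A T \<chi> B \<phi>
    by unfold_locales (use s t \<phi> in \<open>auto simp: Obj_orbit_groth\<close>)
  let ?PT = "mk_fam P Pact"
  obtain \<eta> where \<eta>: "\<eta> \<in> homset (Omega_orbit G X) ?PT S"
      "\<alpha> = (graft_obj G X (B, A, \<phi>) (T, \<chi>), (S, \<psi>), \<eta>)"
      "\<And>b. b \<in> labels X B \<Longrightarrow> edge_map \<eta> (proj B b) (New b) = snd (\<psi> b)"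
      "\<And>i. i \<in> points X \<Longrightarrow> edge_map \<eta> i (tree_root (Fob ?PT i)) = tree_root (Fob S i)"
    using \<alpha> by (auto simp: graft_obj_eq homset_ltree)
  define k where "k = (\<lambda>i e. edge_map \<eta> i (Old e))"
  have "\<eta> = fam_arr ?PT S (edge_map \<eta>)" using hom_fam_arr[OF \<eta>(1)] .
  also have "\<dots> = fam_arr ?PT S (\<lambda>i. on_graft (k i) (\<lambda>b. snd (\<psi> b)) (tree_root (Fob S i)))"
  proof (rule fam_arr_cong)
    fix i e
    assume i: "i \<in> points X" and e: "e \<in> edges (Fob ?PT i)"
    then have "e \<in> edges (P i)" by (simp add: mk_fam_simps)
    then show "edge_map \<eta> i e = on_graft (k i) (\<lambda>b. snd (\<psi> b)) (tree_root (Fob S i)) e"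
      using i
    proof (cases rule: edges_P_cases)
      case NewRoot
      then show ?thesis using \<eta>(4)[OF i] i by (simp add: on_graft_def mk_fam_simps root_P)
    qed (use \<eta>(3) in \<open>auto simp: on_graft_def k_def\<close>)
  qed
  finally have "f = mk_garr (A, T, \<chi>) (B, S, \<psi>) \<phi> k"
    by (simp add: f_eq mk_garr_def \<eta>(2) ltree_arr_eq graft_obj_eq)
  then show ?thesis using f mk_garr_in_iff[OF s t] by blast
qed

text \<open>For a label \<open>b\<close>, \<open>compat\<close> decides of each label
  \<open>a\<close> over the same point whether it is the value at \<open>b\<close>; if none is, the
  value can only be the section point of that fiber.\<close>

lemma compat_unique:
  assumes s: "(A, T, \<chi>) \<in> Obj (orbit_groth G X)" and t: "(B, S, \<psi>) \<in> Obj (orbit_groth G X)"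
    and \<phi>: "retr_map G X B A \<phi>" "compat (A, T, \<chi>) (B, S, \<psi>) \<phi> k"
    and \<phi>': "retr_map G X B A \<phi>'" "compat (A, T, \<chi>) (B, S, \<psi>) \<phi>' k'"
    and k: "\<And>i e. i \<in> points X \<Longrightarrow> e \<in> edges (Fob T i) \<Longrightarrow> k i e = k' i e"
  shows "\<phi> = \<phi>'"
proof (rule extensionalityI[where A = "pts B"])
  have A: "is_retr G X A" "T \<in> Obj (Omega_orbit G X)" "labeling G X A T \<chi>"
    and B: "is_retr G X B"
    using s t by (auto simp: Obj_orbit_groth)
  show "\<phi> \<in> extensional (pts B)" "\<phi>' \<in> extensional (pts B)"
    using \<phi> \<phi>' by (auto simp: retr_map_def PiE_iff)
  fix b
  assume b: "b \<in> pts B"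
  have im: "\<phi> b \<in> pts A" "\<phi>' b \<in> pts A" "proj A (\<phi> b) = proj B b" "proj A (\<phi>' b) = proj B b"
    using \<phi> \<phi>' b by (auto simp: retr_map_def)
  from pts_cases[OF B b] show "\<phi> b = \<phi>' b"
  proof
    assume bl: "b \<in> labels X B"
    have eq: "\<phi> b = a \<longleftrightarrow> \<phi>' b = a" if "a \<in> labels X A" "proj A a = proj B b" for a
    proof -
      have "k (proj B b) (snd (\<chi> a)) = k' (proj B b) (snd (\<chi> a))"
        using k proj_in[OF B b] label_edge[OF A that(1)] that(2) by simp
      then show ?thesis using \<phi>(2) \<phi>'(2) bl that by (simp add: compat_def)
    qed
    show ?thesis
      using pts_cases[OF A(1) im(1)] pts_cases[OF A(1) im(2)] eq im by metis
  next
    assume "b = sect B (proj B b) \<and> proj B b \<in> points X"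
    then show ?thesis using \<phi> \<phi>' by (metis retr_map_def)
  qed
qed

text \<open>The point is that at most one leaf of \<open>T\<close> has its image below a given leaf
  of \<open>S\<close>: such images form a chain, comparability is reflected, and comparable leaves
  coincide. The resulting \<phi> is equivariant because the action preserves the order and commutes
  with \<open>k\<close>.\<close>

lemma compat_exists:
  assumes s: "(A, T, \<chi>) \<in> Obj (orbit_groth G X)" and t: "(B, S, \<psi>) \<in> Obj (orbit_groth G X)"
    and k: "fam_arr T S k \<in> homset (Omega_orbit G X) T S"
  shows "\<exists>\<phi>. retr_map G X B A \<phi> \<and> compat (A, T, \<chi>) (B, S, \<psi>) \<phi> k"
proof -
  have A: "is_retr G X A" "T \<in> Obj (Omega_orbit G X)" "labeling G X A T \<chi>"
    and B: "is_retr G X B" "S \<in> Obj (Omega_orbit G X)" "labeling G X B S \<psi>"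
    using s t by (auto simp: Obj_orbit_groth)
  have km: "tree_map (Fob T i) (Fob S i) (\<lambda>e\<in>edges (Fob T i). k i e)" if "i \<in> points X" for i
    using k that by (simp add: fam_arr_hom)
  have keq: "k (gact X x i) (tact T x i e) = tact S x i (k i e)"
    if "x \<in> carrier G" "i \<in> points X" "e \<in> edges (Fob T i)" for x i e
    using k that by (simp add: fam_arr_hom)
  define R where "R b a \<longleftrightarrow> a \<in> labels X A \<and> proj A a = proj B b \<and>
      above (Fob S (proj B b)) (snd (\<psi> b)) (k (proj B b) (snd (\<chi> a)))" for b a
  have R_unique: "a = a'" if b: "b \<in> labels X B" and a: "R b a" "R b a'" for a a' b
  proof -
    let ?i = "proj B b"
    have i: "?i \<in> points X" using proj_in[OF B(1)] labels_in[OF B(1)] b by blast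
    have al: "a \<in> labels X A" "a' \<in> labels X A" "proj A a = ?i" "proj A a' = ?i"
      using a by (auto simp: R_def)
    have e: "snd (\<chi> a) \<in> edges (Fob T ?i)" "snd (\<chi> a') \<in> edges (Fob T ?i)"
      using label_edge[OF A] al by metis+
    have "above (Fob S ?i) (k ?i (snd (\<chi> a))) (k ?i (snd (\<chi> a'))) \<or>
        above (Fob S ?i) (k ?i (snd (\<chi> a'))) (k ?i (snd (\<chi> a)))"
      using above_chain[OF fam_rooted[OF B(2) i]] a unfolding R_def by blast
    then have "above (Fob T ?i) (snd (\<chi> a)) (snd (\<chi> a')) \<or> above (Fob T ?i) (snd (\<chi> a')) (snd (\<chi> a))"
      using tree_map_incomparable[OF fam_rooted[OF A(2) i] fam_rooted[OF B(2) i] km[OF i]] e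
      by (metis restrict_apply')
    then have "snd (\<chi> a) = snd (\<chi> a')"
      using label_above[OF A] al by metis
    then show ?thesis using label_inj[OF A] al by simp
  qed
  have R_act: "R (ract B x b) (ract A x a)" if x: "x \<in> carrier G" and b: "b \<in> labels X B" and a: "R b a" for x a b
  proof -
    let ?i = "proj B b"
    have i: "?i \<in> points X" using proj_in[OF B(1)] labels_in[OF B(1)] b by blast
    have al: "a \<in> labels X A" "proj A a = ?i" using a by (auto simp: R_def)
    have e: "snd (\<chi> a) \<in> edges (Fob T ?i)" using label_edge[OF A] al by metis
    have "above (Fob S (gact X x ?i)) (tact S x ?i (snd (\<psi> b))) (tact S x ?i (k ?i (snd (\<chi> a))))"
      using tact_above[OF B(2) x i] a by (simp add: R_def)
    moreover have "tact S x ?i (snd (\<psi> b)) = snd (\<psi> (ract B x b))" using label_act[OF B x b] by simp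
    moreover have "tact S x ?i (k ?i (snd (\<chi> a))) = k (gact X x ?i) (snd (\<chi> (ract A x a)))"
      using keq[OF x i e] label_act[OF A x al(1)] al(2) by simp
    moreover have "proj B (ract B x b) = gact X x ?i" "proj A (ract A x a) = gact X x ?i"
      using retr_facts(7)[OF B(1) x] retr_facts(7)[OF A(1) x] labels_in[OF B(1) b] labels_in[OF A(1) al(1)] al(2)
      by auto
    ultimately show ?thesis using labels_act[OF A(1) x al(1)] by (simp add: R_def)
  qed
  \<comment> \<open>The default serves the section points of \<open>B\<close> as well as the labels
    whose leaf lies above no image of a leaf; each goes to the base point of its own fiber, so
    \<phi> is a map over \<open>X\<close>.\<close>
  define \<phi> where "\<phi> = (\<lambda>b\<in>pts B. if b \<in> labels X B \<and> (\<exists>a. R b a) then (SOME a. R b a) else sect A (proj B b))"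
  have \<phi>R: "\<phi> b = a" if "b \<in> labels X B" "R b a" for a b
    using that R_unique[OF that(1)] labels_in[OF B(1)] by (auto simp: \<phi>_def intro: some_equality)
  have \<phi>0: "\<phi> b = sect A (proj B b)" if "b \<in> pts B" "\<not> (b \<in> labels X B \<and> (\<exists>a. R b a))" for b
    by (simp only: \<phi>_def restrict_apply that if_True if_False)
  have cases: "(\<exists>a. b \<in> labels X B \<and> R b a \<and> \<phi> b = a) \<or>
      (\<not> (b \<in> labels X B \<and> (\<exists>a. R b a)) \<and> \<phi> b = sect A (proj B b))" if "b \<in> pts B" for b
    using \<phi>R \<phi>0 that by blast
  have "retr_map G X B A \<phi>"
    unfolding retr_map_def
  proof (intro conjI ballI)
    have "\<phi> b \<in> pts A" if "b \<in> pts B" for b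
      using cases[OF that] sect_in[OF A(1) proj_in[OF B(1) that]] labels_in[OF A(1)] by (auto simp: R_def)
    then show "\<phi> \<in> pts B \<rightarrow>\<^sub>E pts A" by (auto simp: \<phi>_def)
    show "proj A (\<phi> b) = proj B b" if "b \<in> pts B" for b
      using cases[OF that] retr_facts(8)[OF A(1) proj_in[OF B(1) that]] by (auto simp: R_def)
    show "\<phi> (sect B i) = sect A i" if "i \<in> points X" for i
    proof -
      have "sect B i \<notin> labels X B" using that by (simp add: labels_def)
      then show ?thesis
        using \<phi>0[of "sect B i"] sect_in[OF B(1) that] retr_facts(8)[OF B(1) that] by simp
    qed
    show "\<phi> (ract B x b) = ract A x (\<phi> b)" if x: "x \<in> carrier G" and b: "b \<in> pts B" for x b
      using cases[OF b]
    proof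
      assume "\<exists>a. b \<in> labels X B \<and> R b a \<and> \<phi> b = a"
      then show ?thesis using \<phi>R R_act[OF x] labels_act[OF B(1) x] by blast
    next
      assume h: "\<not> (b \<in> labels X B \<and> (\<exists>a. R b a)) \<and> \<phi> b = sect A (proj B b)"
      \<comment> \<open>A partner of the translate would be moved back by \<open>inv x\<close> to a
        partner of \<open>b\<close>.\<close>
      have "\<not> (ract B x b \<in> labels X B \<and> (\<exists>a. R (ract B x b) a))"
      proof
        assume "ract B x b \<in> labels X B \<and> (\<exists>a. R (ract B x b) a)"
        then obtain a where "ract B x b \<in> labels X B" "R (ract B x b) a" by blast
        then have "b \<in> labels X B" "R b (ract A (inv x) a)"
          using labels_act[OF B(1) inv_closed[OF x]] R_act[OF inv_closed[OF x]] ract_inv[OF B(1) x b] by metis+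
        then show False using h by blast
      qed
      then have "\<phi> (ract B x b) = sect A (proj B (ract B x b))"
        using \<phi>0[OF ract_in[OF B(1) x b]] by blast
      then show ?thesis
        using h retr_facts(7)[OF B(1) x b] retr_facts(6)[OF A(1) x proj_in[OF B(1) b]] by simp
    qed
  qed
  moreover have "compat (A, T, \<chi>) (B, S, \<psi>) \<phi> k"
  proof -
    have "\<phi> b = a \<longleftrightarrow> above (Fob S (proj B b)) (snd (\<psi> b)) (k (proj B b) (snd (\<chi> a)))"
      if b: "b \<in> labels X B" and a: "a \<in> labels X A" "proj B b = proj A a" for a b
    proof
      assume "\<phi> b = a"
      moreover have "a \<noteq> sect A (proj B b)"
        using a proj_in[OF B(1) labels_in[OF B(1) b]] by (auto simp: labels_def)
      ultimately show "above (Fob S (proj B b)) (snd (\<psi> b)) (k (proj B b) (snd (\<chi> a)))"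
        using cases[OF labels_in[OF B(1) b]] by (auto simp: R_def)
    next
      assume "above (Fob S (proj B b)) (snd (\<psi> b)) (k (proj B b) (snd (\<chi> a)))"
      then show "\<phi> b = a" using \<phi>R[OF b] a by (simp add: R_def)
    qed
    then show ?thesis by (simp add: compat_def)
  qed
  ultimately show ?thesis by blast
qed

text \<open>From left to right, apply the monotone \<open>m\<close> to the first relation and chain
  it with the second; \<open>\<gamma> c\<close> is a label because \<phi> sends section points to
  section points. From right to left, lift the leaf labeled \<open>c\<close> through
  \<open>m\<close> to a leaf of \<open>S\<close> above the \<open>k\<close>-image of the leaf
  labeled \<open>a\<close>; its label is the intermediate value.\<close>

lemma compat_compose:
  assumes s: "(A, T, \<chi>) \<in> Obj (orbit_groth G X)" and t: "(B, S, \<psi>) \<in> Obj (orbit_groth G X)"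
    and u: "(C, R, \<omega>) \<in> Obj (orbit_groth G X)"
    and \<phi>: "retr_map G X B A \<phi>" "fam_arr T S k \<in> homset (Omega_orbit G X) T S" "compat (A, T, \<chi>) (B, S, \<psi>) \<phi> k"
    and \<gamma>: "retr_map G X C B \<gamma>" "fam_arr S R m \<in> homset (Omega_orbit G X) S R" "compat (B, S, \<psi>) (C, R, \<omega>) \<gamma> m"
  shows "compat (A, T, \<chi>) (C, R, \<omega>) (compose (pts C) \<phi> \<gamma>) (\<lambda>i e. m i (k i e))"
proof -
  have A: "is_retr G X A" "T \<in> Obj (Omega_orbit G X)" "labeling G X A T \<chi>"
    and B: "is_retr G X B" "S \<in> Obj (Omega_orbit G X)" "labeling G X B S \<psi>"
    and C: "is_retr G X C" "R \<in> Obj (Omega_orbit G X)" "labeling G X C R \<omega>"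
    using s t u by (auto simp: Obj_orbit_groth)
  have km: "tree_map (Fob T i) (Fob S i) (\<lambda>e\<in>edges (Fob T i). k i e)"
    and mm: "tree_map (Fob S i) (Fob R i) (\<lambda>e\<in>edges (Fob S i). m i e)" if "i \<in> points X" for i
    using \<phi>(2) \<gamma>(2) that by (auto simp: fam_arr_hom)
  have kin: "k i e \<in> edges (Fob S i)" if "i \<in> points X" "e \<in> edges (Fob T i)" for i e
    using km[OF that(1)] that(2) by (auto simp: tree_map_def PiE_iff)
  have "\<phi> (\<gamma> c) = a \<longleftrightarrow> above (Fob R (proj C c)) (snd (\<omega> c)) (m (proj C c) (k (proj C c) (snd (\<chi> a))))"
    if c: "c \<in> labels X C" and a: "a \<in> labels X A" and ca: "proj C c = proj A a" for a c
  proof -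
    let ?i = "proj C c"
    have i: "?i \<in> points X" using proj_in[OF C(1)] labels_in[OF C(1)] c by blast
    have e: "snd (\<chi> a) \<in> edges (Fob T ?i)" using label_edge[OF A a] ca by simp
    have \<gamma>c: "\<gamma> c \<in> pts B" "proj B (\<gamma> c) = ?i"
      using \<gamma>(1) labels_in[OF C(1) c] by (auto simp: retr_map_def)
    note R = fam_rooted[OF C(2) i] and S = fam_rooted[OF B(2) i]
    show ?thesis
    proof
      assume h: "\<phi> (\<gamma> c) = a"
      have b: "\<gamma> c \<in> labels X B"
        using pts_cases[OF B(1) \<gamma>c(1)]
      proof
        assume "\<gamma> c = sect B (proj B (\<gamma> c)) \<and> proj B (\<gamma> c) \<in> points X"
        then have "\<phi> (\<gamma> c) \<in> sect A ` points X" using \<phi>(1) by (metis imageI retr_map_def)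
        then show ?thesis using h a by (simp add: labels_def)
      qed
      have "above (Fob S ?i) (snd (\<psi> (\<gamma> c))) (k ?i (snd (\<chi> a)))"
        using \<phi>(3) b a h \<gamma>c ca unfolding compat_def by auto
      then have "above (Fob R ?i) (m ?i (snd (\<psi> (\<gamma> c)))) (m ?i (k ?i (snd (\<chi> a))))"
        using tree_map_above[OF S R mm[OF i]] kin[OF i e] label_edge[OF B b] \<gamma>c(2) by (metis restrict_apply')
      moreover have "above (Fob R ?i) (snd (\<omega> c)) (m ?i (snd (\<psi> (\<gamma> c))))"
        using compatD[OF \<gamma>(3) c b \<gamma>c(2)[symmetric]] by blast
      ultimately show "above (Fob R ?i) (snd (\<omega> c)) (m ?i (k ?i (snd (\<chi> a))))"
        by (meson rtrancl_trans)
    next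
      assume h: "above (Fob R ?i) (snd (\<omega> c)) (m ?i (k ?i (snd (\<chi> a))))"
      obtain y where y: "y \<in> leaves (Fob S ?i)" "above (Fob S ?i) y (k ?i (snd (\<chi> a)))"
          "above (Fob R ?i) (snd (\<omega> c)) (m ?i y)"
        using tree_map_lift_leaf[OF S R mm[OF i] kin[OF i e] label_leaf[OF C c]] h kin[OF i e]
        by (auto simp: leaves_def)
      then obtain b where b: "b \<in> labels X B" "proj B b = ?i" "snd (\<psi> b) = y"
        using label_surj[OF B i] by blast
      then have "\<gamma> c = b" "\<phi> b = a"
        using compatD[OF \<gamma>(3) c b(1)] compatD[OF \<phi>(3) b(1) a] y ca by auto
      then show "\<phi> (\<gamma> c) = a" by simp
    qed
  qed
  then show ?thesis using labels_in[OF C(1)] by (simp add: compat_def compose_def)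
qed

lemma retr_map_compose:
  assumes "is_retr G X C" "retr_map G X B A \<phi>" "retr_map G X C B \<gamma>"
  shows "retr_map G X C A (compose (pts C) \<phi> \<gamma>)"
proof -
  have "ract C x c \<in> pts C" if "x \<in> carrier G" "c \<in> pts C" for x c
    using ract_in[OF assms(1) that] .
  moreover have "sect C i \<in> pts C" if "i \<in> points X" for i using sect_in[OF assms(1) that] .
  ultimately show ?thesis
    using assms(2,3) by (auto simp: retr_map_def compose_def PiE_iff)
qed

text \<open>An old edge \<open>d\<close> travels through \<open>Old (Old d)\<close> and
  \<open>Old (k i d)\<close> to \<open>m i (k i d)\<close>, while new leaves and the new root stay
  new until the last arrow sends them to the leaves with their labels and to the root. On old edges
  only the composite of \<open>k\<close> and \<open>m\<close> is visible.\<close>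

lemma mk_garr_comp:
  assumes s: "(A, T, \<chi>) \<in> Obj (orbit_groth G X)" and t: "(B, S, \<psi>) \<in> Obj (orbit_groth G X)"
    and u: "(C, R, \<omega>) \<in> Obj (orbit_groth G X)"
    and \<phi>: "retr_map G X B A \<phi>" "fam_arr T S k \<in> homset (Omega_orbit G X) T S"
    and \<gamma>: "retr_map G X C B \<gamma>"
  shows "Comp (orbit_groth G X) (mk_garr (B, S, \<psi>) (C, R, \<omega>) \<gamma> m) (mk_garr (A, T, \<chi>) (B, S, \<psi>) \<phi> k) =
    mk_garr (A, T, \<chi>) (C, R, \<omega>) (compose (pts C) \<phi> \<gamma>) (\<lambda>i e. m i (k i e))"
proof -
  have A: "is_retr G X A" "T \<in> Obj (Omega_orbit G X)" "labeling G X A T \<chi>"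
    and B: "is_retr G X B" "S \<in> Obj (Omega_orbit G X)" "labeling G X B S \<psi>"
    and C: "is_retr G X C" "R \<in> Obj (Omega_orbit G X)" "labeling G X C R \<omega>"
    using s t u by (auto simp: Obj_orbit_groth)
  interpret g1: graft_family G X A T \<chi> B \<phi>
    by unfold_locales (use A B \<phi> in auto)
  interpret g0: graft_family G X A T \<chi> C "compose (pts C) \<phi> \<gamma>"
    by unfold_locales (use A C retr_map_compose[OF C(1) \<phi>(1) \<gamma>] in auto)
  interpret g3: graft_family G X B S \<psi> C \<gamma>
    by unfold_locales (use B C \<gamma> in auto)
  let ?T1 = "mk_fam g1.P g1.Pact" and ?\<chi>1 = "\<lambda>a\<in>labels X B. (proj B a, New a)"
  interpret g2: graft_family G X B ?T1 ?\<chi>1 C \<gamma>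
    by unfold_locales (use B C \<gamma> g1.fam_P g1.labeling_P in auto)
  let ?T0 = "mk_fam g0.P g0.Pact" and ?T2 = "mk_fam g2.P g2.Pact" and ?T3 = "mk_fam g3.P g3.Pact"
  let ?k = "\<lambda>i. on_graft (k i) (\<lambda>b. snd (\<psi> b)) (tree_root (Fob S i))"
  let ?m = "\<lambda>i. on_graft (m i) (\<lambda>c. snd (\<omega> c)) (tree_root (Fob R i))"
  \<comment> \<open>\<open>?h1\<close> is the oplax structure map, \<open>?h2\<close> the first
    arrow grafted along \<gamma>; the second arrow \<open>?m\<close> is applied last.\<close>
  let ?h1 = "\<lambda>i::nat. on_graft (\<lambda>e. Old (Old e)) New NewRoot"
  let ?h2 = "\<lambda>i. on_graft (\<lambda>e. Old (edge_map (fam_arr ?T1 S ?k) i e)) New NewRoot"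
  have kin: "k i e \<in> edges (Fob S i)" if "i \<in> points X" "e \<in> edges (Fob T i)" for i e
    using \<phi>(2) that by (auto simp: fam_arr_hom tree_map_def PiE_iff)
  have E1: "edge_map (fam_arr ?T1 S ?k) i (Old e) = k i e" if "i \<in> points X" "e \<in> edges (Fob T i)" for i e
    using that by (simp add: edge_map_fam_arr mk_fam_simps g1.edges_P on_graft_def)
  have mid1: "?h1 i e \<in> edges (Fob ?T2 i)"
    and mid2: "?h2 i (?h1 i e) \<in> edges (Fob ?T3 i)"
    and fin: "?m i (?h2 i (?h1 i e)) = on_graft (\<lambda>e. m i (k i e)) (\<lambda>c. snd (\<omega> c)) (tree_root (Fob R i)) e"
    if i: "i \<in> points X" and e: "e \<in> edges (Fob ?T0 i)" for i e
  proof -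
    have "e \<in> edges (g0.P i)" using i e by (simp add: mk_fam_simps)
    then have "?h1 i e \<in> edges (Fob ?T2 i) \<and> ?h2 i (?h1 i e) \<in> edges (Fob ?T3 i) \<and>
        ?m i (?h2 i (?h1 i e)) = on_graft (\<lambda>e. m i (k i e)) (\<lambda>c. snd (\<omega> c)) (tree_root (Fob R i)) e"
      using i
    proof (cases rule: g0.edges_P_cases)
      case (Old d)
      then show ?thesis
        using E1[OF i] kin[OF i]
        by (simp add: on_graft_def mk_fam_simps i g2.edges_P g1.edges_P g3.edges_P)
    qed (simp_all add: on_graft_def mk_fam_simps i g2.edges_P g3.edges_P)
    then show "?h1 i e \<in> edges (Fob ?T2 i)" "?h2 i (?h1 i e) \<in> edges (Fob ?T3 i)"
      "?m i (?h2 i (?h1 i e)) = on_graft (\<lambda>e. m i (k i e)) (\<lambda>c. snd (\<omega> c)) (tree_root (Fob R i)) e"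
      by blast+
  qed
  have "Comp (Omega_orbit G X) (fam_arr ?T3 R ?m) (Comp (Omega_orbit G X) (fam_arr ?T2 ?T3 ?h2) (fam_arr ?T0 ?T2 ?h1)) =
      Comp (Omega_orbit G X) (fam_arr ?T3 R ?m) (fam_arr ?T0 ?T3 (\<lambda>i e. ?h2 i (?h1 i e)))"
    using fam_arr_Comp[OF mid1] by simp
  also have "\<dots> = fam_arr ?T0 R (\<lambda>i e. ?m i (?h2 i (?h1 i e)))"
    by (rule fam_arr_Comp[OF mid2])
  also have "\<dots> = fam_arr ?T0 R (\<lambda>i. on_graft (\<lambda>e. m i (k i e)) (\<lambda>c. snd (\<omega> c)) (tree_root (Fob R i)))"
    by (rule fam_arr_cong[OF fin])
  finally show ?thesis
    by (simp add: orbit_groth_def oplax_groth_def mk_garr_def ltree_oplax_def retr_cat_def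
        g0.graft_obj_eq g1.graft_obj_eq g2.graft_obj_eq g3.graft_obj_eq ltree_arr_eq graft_arr_def
        ltree_cat_def)
qed

lemma retr_map_id: "is_retr G X A \<Longrightarrow> retr_map G X A A (\<lambda>a\<in>pts A. a)"
  using ract_in[of A] sect_in[of A] by (simp add: retr_map_def)

text \<open>Identities and the structure isomorphisms of the pseudofunctor are all relabelings; in
  normal form they are the identity on old edges, so \<open>old_funct\<close> does not see
  them.\<close>

lemma relabel_eq: "relabel G X s t f = mk_garr s t (\<lambda>b\<in>pts (fst t). f b) (\<lambda>i e. e)"
  by (simp add: relabel_def mk_garr_def Let_def)

text \<open>With \<open>k\<close> the identity, \<open>compat\<close> asks whether one leaf of
  \<open>T\<close> lies above another, that is, whether they are equal; so it says that
  \<open>f\<close> respects the labelings.\<close>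

lemma relabel_in:
  assumes s: "(A, T, \<chi>) \<in> Obj (orbit_groth G X)" and t: "(B, T, \<psi>) \<in> Obj (orbit_groth G X)"
    and f: "retr_map G X B A (\<lambda>b\<in>pts B. f b)"
    and lab: "\<And>b. b \<in> labels X B \<Longrightarrow> f b \<in> labels X A \<and> snd (\<chi> (f b)) = snd (\<psi> b)"
  shows "relabel G X (A, T, \<chi>) (B, T, \<psi>) f \<in> homset (orbit_groth G X) (A, T, \<chi>) (B, T, \<psi>)"
    and "old_part (relabel G X (A, T, \<chi>) (B, T, \<psi>) f) = fam_arr T T (\<lambda>i e. e)"
proof -
  have A: "is_retr G X A" "T \<in> Obj (Omega_orbit G X)" "labeling G X A T \<chi>" and B: "is_retr G X B"
    using s t by (auto simp: Obj_orbit_groth)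
  have "compat (A, T, \<chi>) (B, T, \<psi>) (\<lambda>b\<in>pts B. f b) (\<lambda>i e. e)"
  proof -
    have "f b = a \<longleftrightarrow> above (Fob T (proj B b)) (snd (\<psi> b)) (snd (\<chi> a))"
      if b: "b \<in> labels X B" and a: "a \<in> labels X A" "proj B b = proj A a" for a b
    proof -
      have fb: "proj A (f b) = proj A a" using f labels_in[OF B b] a by (auto simp: retr_map_def)
      show ?thesis
        using lab[OF b] a label_above[OF A a(1)] label_inj[OF A _ a(1) fb] by auto
    qed
    then show ?thesis using labels_in[OF B] by (simp add: compat_def)
  qed
  moreover have "fam_arr T T (\<lambda>i e. e) \<in> homset (Omega_orbit G X) T T"
    using category.Ident_in[OF category_Omega_orbit A(2)] by (simp add: fam_arr_Ident)
  ultimately show "relabel G X (A, T, \<chi>) (B, T, \<psi>) f \<in> homset (orbit_groth G X) (A, T, \<chi>) (B, T, \<psi>)"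
    using mk_garr_in_iff[OF s t] f by (simp add: relabel_eq)
  show "old_part (relabel G X (A, T, \<chi>) (B, T, \<psi>) f) = fam_arr T T (\<lambda>i e. e)"
    using old_part_mk_garr[OF s t f] by (simp add: relabel_eq)
qed

lemma Ident_orbit_groth: "Ident (orbit_groth G X) s = relabel G X s s (\<lambda>a. a)"
  by (cases s) (simp add: orbit_groth_def oplax_groth_def relabel_eq mk_garr_def ltree_oplax_def retr_cat_def)

definition old_funct :: "('a gobj, 'a garr, 'a treefam, 'a treefam_arr) funct" where
  "old_funct = \<lparr>Fob = (\<lambda>s. fst (snd s)), Far = old_part\<rparr>"

text \<open>Fullness is \<open>compat_exists\<close>, faithfulness is \<open>compat_unique\<close>,
  closure under composition is \<open>compat_compose\<close>, functoriality is
  \<open>mk_garr_comp\<close>. That \<open>orbit_groth\<close> satisfies the laws of a category is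
  then a consequence, by \<open>category_D\<close>.\<close>

lemma fully_faithful_old: "fully_faithful (Omega_orbit G X) (orbit_groth G X) old_funct"
proof -
  interpret O: category "Omega_orbit G X" by (rule category_Omega_orbit)
  let ?D = "orbit_groth G X"
  show ?thesis
  proof
    fix f
    assume "f \<in> Arr ?D"
    then show "Dom ?D f \<in> Obj ?D" "Cod ?D f \<in> Obj ?D"
      by (simp_all add: orbit_groth_def oplax_groth_def Arr_mk_cat)
  next
    fix s
    assume s: "s \<in> Obj ?D"
    obtain A T \<chi> where s_eq: "s = (A, T, \<chi>)" by (cases s)
    have A: "is_retr G X A" "T \<in> Obj (Omega_orbit G X)" using s by (auto simp: s_eq Obj_orbit_groth)
    note id = relabel_in[OF s[unfolded s_eq] s[unfolded s_eq], of "\<lambda>a. a"] retr_map_id[OF A(1)]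
    show "Ident ?D s \<in> homset ?D s s" "Far old_funct (Ident ?D s) = Ident (Omega_orbit G X) (Fob old_funct s)"
      using id by (simp_all add: Ident_orbit_groth s_eq old_funct_def fam_arr_Ident)
    show "Fob old_funct s \<in> Obj (Omega_orbit G X)" using A by (simp add: old_funct_def s_eq)
  next
    fix f g s t u
    assume f: "f \<in> homset ?D s t" and g: "g \<in> homset ?D t u"
    obtain A T \<chi> where s_eq: "s = (A, T, \<chi>)" by (cases s)
    obtain B S \<psi> where t_eq: "t = (B, S, \<psi>)" by (cases t)
    obtain C R \<omega> where u_eq: "u = (C, R, \<omega>)" by (cases u)
    have s: "(A, T, \<chi>) \<in> Obj ?D" and t: "(B, S, \<psi>) \<in> Obj ?D" and u: "(C, R, \<omega>) \<in> Obj ?D"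
      using f g by (auto simp: s_eq t_eq u_eq homset_orbit_groth)
    obtain \<phi> k where f_eq: "f = mk_garr (A, T, \<chi>) (B, S, \<psi>) \<phi> k"
      and \<phi>: "retr_map G X B A \<phi>" "fam_arr T S k \<in> homset (Omega_orbit G X) T S"
        "compat (A, T, \<chi>) (B, S, \<psi>) \<phi> k"
      using hom_mk_garr f unfolding s_eq t_eq by metis
    obtain \<gamma> m where g_eq: "g = mk_garr (B, S, \<psi>) (C, R, \<omega>) \<gamma> m"
      and \<gamma>: "retr_map G X C B \<gamma>" "fam_arr S R m \<in> homset (Omega_orbit G X) S R"
        "compat (B, S, \<psi>) (C, R, \<omega>) \<gamma> m"
      using hom_mk_garr g unfolding t_eq u_eq by metis
    have C: "is_retr G X C" using u by (simp add: Obj_orbit_groth)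
    have comp: "Comp ?D g f = mk_garr (A, T, \<chi>) (C, R, \<omega>) (compose (pts C) \<phi> \<gamma>) (\<lambda>i e. m i (k i e))"
      unfolding f_eq g_eq by (rule mk_garr_comp[OF s t u \<phi>(1,2) \<gamma>(1)])
    have kin: "k i e \<in> edges (Fob S i)" if "i \<in> points X" "e \<in> edges (Fob T i)" for i e
      using \<phi>(2) that by (auto simp: fam_arr_hom tree_map_def PiE_iff)
    have fc: "Comp (Omega_orbit G X) (fam_arr S R m) (fam_arr T S k) = fam_arr T R (\<lambda>i e. m i (k i e))"
      by (rule fam_arr_Comp[OF kin])
    have h: "fam_arr T R (\<lambda>i e. m i (k i e)) \<in> homset (Omega_orbit G X) T R"
      using O.Comp_in[OF \<phi>(2) \<gamma>(2)] fc by simp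
    show "Comp ?D g f \<in> homset ?D s u"
      unfolding comp s_eq u_eq
      using mk_garr_in_iff[OF s u] retr_map_compose[OF C \<phi>(1) \<gamma>(1)] h compat_compose[OF s t u \<phi> \<gamma>] by blast
    show "Far old_funct (Comp ?D g f) = Comp (Omega_orbit G X) (Far old_funct g) (Far old_funct f)"
      using old_part_mk_garr[OF s u retr_map_compose[OF C \<phi>(1) \<gamma>(1)]] old_part_mk_garr[OF s t \<phi>(1)]
        old_part_mk_garr[OF t u \<gamma>(1)] fc
      unfolding comp by (simp add: old_funct_def f_eq g_eq)
  next
    fix s t
    assume "s \<in> Obj ?D" "t \<in> Obj ?D"
    moreover obtain A T \<chi> where s_eq: "s = (A, T, \<chi>)" by (cases s)
    moreover obtain B S \<psi> where t_eq: "t = (B, S, \<psi>)" by (cases t)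
    ultimately have s: "(A, T, \<chi>) \<in> Obj ?D" and t: "(B, S, \<psi>) \<in> Obj ?D" by auto
    show "bij_betw (Far old_funct) (homset ?D s t) (homset (Omega_orbit G X) (Fob old_funct s) (Fob old_funct t))"
      unfolding bij_betw_def
    proof
      show "inj_on (Far old_funct) (homset ?D s t)"
      proof (rule inj_onI)
        fix f g
        assume f: "f \<in> homset ?D s t" and g: "g \<in> homset ?D s t" and eq: "Far old_funct f = Far old_funct g"
        obtain \<phi> k where f_eq: "f = mk_garr (A, T, \<chi>) (B, S, \<psi>) \<phi> k"
          and \<phi>: "retr_map G X B A \<phi>" "compat (A, T, \<chi>) (B, S, \<psi>) \<phi> k"
          using hom_mk_garr f unfolding s_eq t_eq by metis
        obtain \<gamma> m where g_eq: "g = mk_garr (A, T, \<chi>) (B, S, \<psi>) \<gamma> m"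
          and \<gamma>: "retr_map G X B A \<gamma>" "compat (A, T, \<chi>) (B, S, \<psi>) \<gamma> m"
          using hom_mk_garr g unfolding s_eq t_eq by metis
        have km: "k i e = m i e" if "i \<in> points X" "e \<in> edges (Fob T i)" for i e
          using eq that old_part_mk_garr[OF s t \<phi>(1)] old_part_mk_garr[OF s t \<gamma>(1)]
          by (simp add: f_eq g_eq old_funct_def fam_arr_eq_iff)
        have "\<phi> = \<gamma>" by (rule compat_unique[OF s t \<phi> \<gamma> km])
        then show "f = g" using mk_garr_cong[OF s t \<phi>(1) km] by (simp add: f_eq g_eq)
      qed
      show "Far old_funct ` homset ?D s t = homset (Omega_orbit G X) (Fob old_funct s) (Fob old_funct t)"
      proof (intro equalityI subsetI)
        fix h
        assume "h \<in> Far old_funct ` homset ?D s t"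
        then obtain f where f: "f \<in> homset ?D s t" "h = old_part f" by (auto simp: old_funct_def)
        then obtain \<phi> k where "f = mk_garr (A, T, \<chi>) (B, S, \<psi>) \<phi> k" "retr_map G X B A \<phi>"
          "fam_arr T S k \<in> homset (Omega_orbit G X) T S"
          using hom_mk_garr unfolding s_eq t_eq by metis
        then show "h \<in> homset (Omega_orbit G X) (Fob old_funct s) (Fob old_funct t)"
          using old_part_mk_garr[OF s t] f by (simp add: old_funct_def s_eq t_eq)
      next
        fix h
        assume "h \<in> homset (Omega_orbit G X) (Fob old_funct s) (Fob old_funct t)"
        then have h: "h \<in> homset (Omega_orbit G X) T S" by (simp add: old_funct_def s_eq t_eq)
        define k where "k = edge_map h"
        have h_eq: "h = fam_arr T S k" using hom_fam_arr[OF h] by (simp add: k_def)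
        obtain \<phi> where \<phi>: "retr_map G X B A \<phi>" "compat (A, T, \<chi>) (B, S, \<psi>) \<phi> k"
          using compat_exists[OF s t h[unfolded h_eq]] by blast
        then have "mk_garr (A, T, \<chi>) (B, S, \<psi>) \<phi> k \<in> homset ?D s t"
          using mk_garr_in_iff[OF s t] h by (simp add: h_eq s_eq t_eq)
        moreover have "h = Far old_funct (mk_garr (A, T, \<chi>) (B, S, \<psi>) \<phi> k)"
          using old_part_mk_garr[OF s t \<phi>(1)] by (simp add: old_funct_def h_eq)
        ultimately show "h \<in> Far old_funct ` homset ?D s t" by blast
      qed
    qed
  qed
qed

text \<open>The old part of a relabeling is an identity, which is its own inverse;
  \<open>lift_inverse\<close> then gives the type and the old part of the inverse without a formula
  for it.\<close>

lemma inverse_relabel: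
  assumes s: "(A, T, \<chi>) \<in> Obj (orbit_groth G X)" and t: "(B, T, \<psi>) \<in> Obj (orbit_groth G X)"
    and f: "retr_map G X B A (\<lambda>b\<in>pts B. f b)"
    and lab: "\<And>b. b \<in> labels X B \<Longrightarrow> f b \<in> labels X A \<and> snd (\<chi> (f b)) = snd (\<psi> b)"
  shows "inverse_arr (orbit_groth G X) (relabel G X (A, T, \<chi>) (B, T, \<psi>) f) \<in>
      homset (orbit_groth G X) (B, T, \<psi>) (A, T, \<chi>)"
    and "old_part (inverse_arr (orbit_groth G X) (relabel G X (A, T, \<chi>) (B, T, \<psi>) f)) = fam_arr T T (\<lambda>i e. e)"
proof -
  interpret ff: fully_faithful "Omega_orbit G X" "orbit_groth G X" old_funct by (rule fully_faithful_old)
  note r = relabel_in[OF s t f lab]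
  have T: "T \<in> Obj (Omega_orbit G X)" using s by (simp add: Obj_orbit_groth)
  have "is_inverse (Omega_orbit G X) (Far old_funct (relabel G X (A, T, \<chi>) (B, T, \<psi>) f)) (fam_arr T T (\<lambda>i e. e))"
    using ff.is_inverse_Ident[OF T] r(2) by (simp add: old_funct_def fam_arr_Ident)
  from ff.lift_inverse[OF r(1) this]
  show "inverse_arr (orbit_groth G X) (relabel G X (A, T, \<chi>) (B, T, \<psi>) f) \<in>
      homset (orbit_groth G X) (B, T, \<psi>) (A, T, \<chi>)"
    "old_part (inverse_arr (orbit_groth G X) (relabel G X (A, T, \<chi>) (B, T, \<psi>) f)) = fam_arr T T (\<lambda>i e. e)"
    by (simp_all add: old_funct_def)
qed

end

section \<open>Pullbacks along maps of G-sets\<close>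

locale gset_map = X: gset G X + Y: gset G Y
  for G (structure) and X Y :: "'a ordgset" +
  fixes p :: "'a ordgset_arr"
  assumes p: "p \<in> homset (functor_cat (BG G) finset_cat) X Y"
begin

abbreviation q :: "nat \<Rightarrow> nat" where "q \<equiv> gmap p"

lemma p_eq: "p = (X, Y, \<lambda>_. (Fob X (), Fob Y (), q))"
  and q_ext: "q \<in> points X \<rightarrow>\<^sub>E points Y"
  and q_act: "x \<in> carrier G \<Longrightarrow> i \<in> points X \<Longrightarrow> q (gact X x i) = gact Y x (q i)"
proof -
  obtain \<theta> where \<theta>: "p = (X, Y, \<theta>)" "\<theta> () \<in> homset finset_cat (Fob X ()) (Fob Y ())"
      "\<And>x. x \<in> carrier G \<Longrightarrow> Comp finset_cat (\<theta> ()) (Far X x) = Comp finset_cat (Far Y x) (\<theta> ())"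
    using p by (auto simp: homset_functor_cat)
  then have \<theta>0: "\<theta> () = (Fob X (), Fob Y (), q)" "q \<in> {1..Fob X ()} \<rightarrow>\<^sub>E {1..Fob Y ()}"
    by (auto simp: homset_finset gmap_def)
  then show "p = (X, Y, \<lambda>_. (Fob X (), Fob Y (), q))"
    using \<theta>(1) by (auto simp: fun_eq_iff)
  show "q \<in> points X \<rightarrow>\<^sub>E points Y" using \<theta>0 by (simp add: points_def)
  show "q (gact X x i) = gact Y x (q i)" if x: "x \<in> carrier G" and i: "i \<in> points X"
  proof -
    have "compose {1..Fob X ()} q (gact X x) = compose {1..Fob X ()} (gact Y x) q"
      using \<theta>(3)[OF x] \<theta>0 X.Far_X[OF x] Y.Far_X[OF x] by (simp add: Comp_finset)
    then have "compose {1..Fob X ()} q (gact X x) i = compose {1..Fob X ()} (gact Y x) q i"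
      by simp
    then show ?thesis using i by (simp add: compose_def points_def)
  qed
qed

lemma fst_p: "fst p = X"
  by (subst p_eq) simp

lemma q_in: "i \<in> points X \<Longrightarrow> q i \<in> points Y"
  using q_ext by blast

definition pb_fam :: "'a treefam \<Rightarrow> 'a treefam" where
  "pb_fam T = X.mk_fam (\<lambda>i. Fob T (q i)) (\<lambda>x i. tact T x (q i))"

lemma Fob_pb_fam: "i \<in> points X \<Longrightarrow> Fob (pb_fam T) i = Fob T (q i)"
  by (simp add: pb_fam_def X.mk_fam_simps)

lemma tact_pb_fam: "x \<in> carrier G \<Longrightarrow> i \<in> points X \<Longrightarrow> tact (pb_fam T) x i = tact T x (q i)"
  by (simp add: pb_fam_def X.mk_fam_simps)

lemma pb_fam_in:
  assumes T: "T \<in> Obj (Omega_orbit G Y)"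
  shows "pb_fam T \<in> Obj (Omega_orbit G X)"
  unfolding pb_fam_def
proof (rule X.mk_fam_in)
  show "rooted (Fob T (q i))" if "i \<in> points X" for i
    using Y.fam_rooted[OF T q_in[OF that]] .
  show "tree_map (Fob T (q i)) (Fob T (q (gact X x i))) (tact T x (q i))"
    if "x \<in> carrier G" "i \<in> points X" for x i
    using Y.tact_map[OF T that(1) q_in[OF that(2)]] q_act[OF that] by simp
  show "tact T \<one> (q i) = (\<lambda>e\<in>edges (Fob T (q i)). e)" if "i \<in> points X" for i
    using Y.tact_one'[OF T q_in[OF that]] .
  show "tact T (y \<otimes> x) (q i) = compose (edges (Fob T (q i))) (tact T y (q (gact X x i))) (tact T x (q i))"
    if "x \<in> carrier G" "y \<in> carrier G" "i \<in> points X" for x y i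
    using Y.tact_mult'[OF T that(1,2) q_in[OF that(3)]] q_act[OF that(1,3)] by simp
qed

lemma pb_fam_arr:
  assumes k: "Y.fam_arr T S k \<in> homset (Omega_orbit G Y) T S"
  shows "X.fam_arr (pb_fam T) (pb_fam S) (\<lambda>i. k (q i)) \<in> homset (Omega_orbit G X) (pb_fam T) (pb_fam S)"
  using k pb_fam_in q_in q_act
  by (simp add: X.fam_arr_hom Y.fam_arr_hom Fob_pb_fam tact_pb_fam)

context
  fixes A
  assumes A: "is_retr G Y A"
begin

lemma pts_pb: "pts (pb_retr G p A) = {Prd i a | i a. i \<in> points X \<and> a \<in> pts A \<and> proj A a = q i}"
  by (simp add: pb_retr_def Let_def fst_p)

lemma Prd_in_pb: "Prd i a \<in> pts (pb_retr G p A) \<longleftrightarrow> i \<in> points X \<and> a \<in> pts A \<and> proj A a = q i"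
  by (auto simp: pts_pb)

lemma pb_simps:
  "x \<in> carrier G \<Longrightarrow> i \<in> points X \<Longrightarrow> a \<in> pts A \<Longrightarrow> proj A a = q i \<Longrightarrow>
    ract (pb_retr G p A) x (Prd i a) = Prd (gact X x i) (ract A x a)"
  "i \<in> points X \<Longrightarrow> sect (pb_retr G p A) i = Prd i (sect A (q i))"
  "i \<in> points X \<Longrightarrow> a \<in> pts A \<Longrightarrow> proj A a = q i \<Longrightarrow> proj (pb_retr G p A) (Prd i a) = i"
  by (auto simp: pb_retr_def Let_def fst_p)

lemma pb_retr_in: "is_retr G X (pb_retr G p A)"
proof -
  note fA = Y.retr_facts[OF A]
  let ?A = "pb_retr G p A"
  have act: "ract A x a \<in> pts A" "proj A (ract A x a) = q (gact X x i)"
    if "x \<in> carrier G" "i \<in> points X" "a \<in> pts A" "proj A a = q i" for x i a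
    using that Y.ract_in[OF A] fA(7) q_act by auto
  have "finite (pts ?A)"
  proof (rule finite_subset)
    show "pts ?A \<subseteq> (\<lambda>(i, a). Prd i a) ` (points X \<times> pts A)" by (auto simp: pts_pb)
    show "finite ((\<lambda>(i, a). Prd i a) ` (points X \<times> pts A))" using fA(1) by (simp add: points_def)
  qed
  moreover have "group_action G (pts ?A) (ract ?A)"
  proof (rule X.group_actionI)
    show "ract ?A x \<in> pts ?A \<rightarrow>\<^sub>E pts ?A" if x: "x \<in> carrier G" for x
    proof (rule PiE_I)
      fix c
      assume "c \<in> pts ?A"
      then obtain i a where "c = Prd i a" "i \<in> points X" "a \<in> pts A" "proj A a = q i" by (auto simp: pts_pb)
      then show "ract ?A x c \<in> pts ?A"
        using act[OF x] X.gact_in[OF x] x by (simp add: pb_simps Prd_in_pb)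
    next
      fix c
      assume "c \<notin> pts ?A"
      then show "ract ?A x c = undefined" using x unfolding pts_pb
          by (auto simp: pb_retr_def Let_def fst_p)
    qed
    show "ract ?A \<one> c = c" if "c \<in> pts ?A" for c
      using that X.gact_one Y.ract_one[OF A] by (auto simp: pts_pb pb_simps)
    show "ract ?A (y \<otimes> x) c = ract ?A y (ract ?A x c)"
      if x: "x \<in> carrier G" and y: "y \<in> carrier G" and c: "c \<in> pts ?A" for x y c
    proof -
      obtain i a where c: "c = Prd i a" "i \<in> points X" "a \<in> pts A" "proj A a = q i"
        using c by (auto simp: pts_pb)
      then show ?thesis
        using act[OF x c(2-4)] X.gact_in[OF x c(2)] x y
        by (simp add: pb_simps X.gact_mult Y.ract_mult[OF A])
    qed
  qed
  moreover have "sect ?A \<in> points X \<rightarrow>\<^sub>E pts ?A"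
    using q_in Y.sect_in[OF A] fA(8)
    by (auto simp: pb_retr_def Let_def fst_p)
  moreover have "proj ?A \<in> pts ?A \<rightarrow>\<^sub>E points X"
    by (auto simp: pb_retr_def Let_def fst_p)
  moreover have "ract ?A \<in> extensional (carrier G)"
    by (simp add: pb_retr_def Let_def)
  moreover have "sect ?A (gact X x i) = ract ?A x (sect ?A i)" if "x \<in> carrier G" "i \<in> points X" for x i
    using that X.gact_in[OF that] Y.sect_in[OF A q_in] fA(8)[OF q_in] fA(6)[OF that(1) q_in] q_act[OF that]
    by (simp add: pb_simps)
  moreover have "proj ?A (ract ?A x c) = gact X x (proj ?A c)" if x: "x \<in> carrier G" and c: "c \<in> pts ?A" for x c
  proof -
    obtain i a where c: "c = Prd i a" "i \<in> points X" "a \<in> pts A" "proj A a = q i"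
      using c by (auto simp: pts_pb)
    then show ?thesis
      using act[OF x c(2-4)] X.gact_in[OF x c(2)] x by (simp add: pb_simps)
  qed
  moreover have "proj ?A (sect ?A i) = i" if "i \<in> points X" for i
    using that Y.sect_in[OF A q_in] fA(8)[OF q_in] by (simp add: pb_simps)
  ultimately show ?thesis unfolding is_retr_def by blast
qed

lemma labels_pb: "labels X (pb_retr G p A) = {Prd i a | i a. i \<in> points X \<and> a \<in> labels Y A \<and> proj A a = q i}"
proof -
  have "Prd i a \<in> sect (pb_retr G p A) ` points X \<longleftrightarrow> a \<in> sect A ` points Y"
    if "i \<in> points X" "proj A a = q i" for i a
  proof
    assume "Prd i a \<in> sect (pb_retr G p A) ` points X"
    then show "a \<in> sect A ` points Y" using q_in by (auto simp: pb_simps)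
  next
    assume "a \<in> sect A ` points Y"
    \<comment> \<open>\<open>proj A\<close> is a left inverse of the section, so a section point
      over \<open>q i\<close> has index \<open>q i\<close>.\<close>
    then have "a = sect A (q i)" using that Y.retr_facts(8)[OF A] by auto
    then show "Prd i a \<in> sect (pb_retr G p A) ` points X"
      using that(1) by (force simp: pb_simps)
  qed
  then show ?thesis by (auto simp: labels_def pts_pb)
qed

lemma proj_pb: "c \<in> labels X (pb_retr G p A) \<Longrightarrow> proj (pb_retr G p A) c = prd_fst c"
  using Y.labels_in[OF A] by (auto simp: labels_pb pb_simps)

end

definition pb_lab :: "'a retr \<Rightarrow> (tok \<Rightarrow> nat \<times> tok) \<Rightarrow> tok \<Rightarrow> nat \<times> tok" where
  "pb_lab A \<chi> = (\<lambda>c\<in>labels X (pb_retr G p A). (prd_fst c, snd (\<chi> (prd_snd c))))"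

lemma pb_obj_eq:
  assumes T: "T \<in> Obj (Omega_orbit G Y)"
  shows "pb_obj G p (A, T, \<chi>) = (pb_retr G p A, pb_fam T, pb_lab A \<chi>)"
proof -
  have "Far T (x, q i) = (Fob T (q i), Fob T (q (gact X x i)), tact T x (q i))"
    if "x \<in> carrier G" "i \<in> points X" for x i
    using Y.Far_fam[OF T that(1) q_in[OF that(2)]] q_act[OF that] by simp
  then have "(\<lambda>(x, i)\<in>carrier G \<times> points X. Far T (x, q i)) =
      (\<lambda>(x, i)\<in>carrier G \<times> points X. (Fob T (q i), Fob T (q (gact X x i)), tact T x (q i)))"
    by (intro restrict_ext) auto
  then show ?thesis
    by (simp add: pb_obj_def Let_def fst_p pb_fam_def X.mk_fam_def pb_lab_def)
qed

text \<open>The fiber of the pullback over \<open>i\<close> is a copy of the fiber of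
  \<open>A\<close> over \<open>q i\<close>, and the tree over \<open>i\<close> is the tree over
  \<open>q i\<close>, so the labeling is inherited fiber by fiber.\<close>

lemma pb_obj_in:
  assumes s: "(A, T, \<chi>) \<in> Obj (orbit_groth G Y)"
  shows "(pb_retr G p A, pb_fam T, pb_lab A \<chi>) \<in> Obj (orbit_groth G X)"
proof -
  have A: "is_retr G Y A" "T \<in> Obj (Omega_orbit G Y)" "labeling G Y A T \<chi>"
    using s by (auto simp: Y.Obj_orbit_groth)
  let ?A = "pb_retr G p A"
  have lab: "labeling G X ?A (pb_fam T) (\<lambda>c\<in>labels X ?A. (proj ?A c, snd (\<chi> (prd_snd c))))"
  proof (rule X.labelingI[OF pb_retr_in[OF A(1)] pb_fam_in[OF A(2)]])
    fix i
    assume i: "i \<in> points X"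
    have fib: "{c \<in> labels X ?A. proj ?A c = i} = Prd i ` {a \<in> labels Y A. proj A a = q i}"
      using i Y.labels_in[OF A(1)] by (auto simp: labels_pb[OF A(1)] pb_simps[OF A(1)])
    have "bij_betw prd_snd (Prd i ` {a \<in> labels Y A. proj A a = q i}) {a \<in> labels Y A. proj A a = q i}"
      by (rule bij_betw_byWitness[where f' = "Prd i"]) auto
    from bij_betw_trans[OF this Y.labeling_bij[OF A q_in[OF i]]]
    show "bij_betw (\<lambda>c. snd (\<chi> (prd_snd c))) {c \<in> labels X ?A. proj ?A c = i} (leaves (Fob (pb_fam T) i))"
      using i by (simp add: fib Fob_pb_fam comp_def)
  next
    fix x c
    assume x: "x \<in> carrier G" and "c \<in> labels X ?A"
    then obtain i a where c: "c = Prd i a" "i \<in> points X" "a \<in> labels Y A" "proj A a = q i"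
      by (auto simp: labels_pb[OF A(1)])
    then show "snd (\<chi> (prd_snd (ract ?A x c))) = tact (pb_fam T) x (proj ?A c) (snd (\<chi> (prd_snd c)))"
      using x Y.labels_in[OF A(1) c(3)] Y.label_act[OF A x c(3)]
      by (simp add: pb_simps[OF A(1)] tact_pb_fam)
  qed
  also have "(\<lambda>c\<in>labels X ?A. (proj ?A c, snd (\<chi> (prd_snd c)))) = pb_lab A \<chi>"
    unfolding pb_lab_def by (rule restrict_ext) (simp add: proj_pb[OF A(1)])
  finally show ?thesis
    using pb_retr_in[OF A(1)] pb_fam_in[OF A(2)] by (simp add: X.Obj_orbit_groth)
qed

text \<open>On normal forms, pulling back means to pull back \<phi> and to reindex \<open>k\<close>
  by \<open>q\<close>; \<open>compat\<close> at a label \<open>Prd i b\<close> is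
  \<open>compat\<close> of the original data at \<open>b\<close>.\<close>

lemma pb_arr_mk_garr:
  assumes s: "(A, T, \<chi>) \<in> Obj (orbit_groth G Y)" and t: "(B, S, \<psi>) \<in> Obj (orbit_groth G Y)"
    and \<phi>: "retr_map G Y B A \<phi>" and k: "Y.fam_arr T S k \<in> homset (Omega_orbit G Y) T S"
    and compat: "Y.compat (A, T, \<chi>) (B, S, \<psi>) \<phi> k"
  shows "pb_arr G p (Y.mk_garr (A, T, \<chi>) (B, S, \<psi>) \<phi> k) \<in>
      homset (orbit_groth G X) (pb_obj G p (A, T, \<chi>)) (pb_obj G p (B, S, \<psi>))"
    and "X.old_part (pb_arr G p (Y.mk_garr (A, T, \<chi>) (B, S, \<psi>) \<phi> k)) =
      X.fam_arr (pb_fam T) (pb_fam S) (\<lambda>i. k (q i))"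
proof -
  have A: "is_retr G Y A" "T \<in> Obj (Omega_orbit G Y)" "labeling G Y A T \<chi>"
    and B: "is_retr G Y B" "S \<in> Obj (Omega_orbit G Y)" "labeling G Y B S \<psi>"
    using s t by (auto simp: Y.Obj_orbit_groth)
  let ?A = "pb_retr G p A" and ?B = "pb_retr G p B"
  let ?\<phi> = "\<lambda>c\<in>pts ?B. Prd (prd_fst c) (\<phi> (prd_snd c))"
  note s' = pb_obj_in[OF s] and t' = pb_obj_in[OF t]
  have \<phi>f: "\<And>b. b \<in> pts B \<Longrightarrow> \<phi> b \<in> pts A \<and> proj A (\<phi> b) = proj B b"
      "\<And>x b. x \<in> carrier G \<Longrightarrow> b \<in> pts B \<Longrightarrow> \<phi> (ract B x b) = ract A x (\<phi> b)"
      "\<And>i. i \<in> points Y \<Longrightarrow> \<phi> (sect B i) = sect A i"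
    using \<phi> by (auto simp: retr_map_def)
  have \<phi>': "retr_map G X ?B ?A ?\<phi>"
    unfolding retr_map_def
  proof (intro conjI ballI)
    show "?\<phi> \<in> pts ?B \<rightarrow>\<^sub>E pts ?A"
      using \<phi>f(1) by (auto simp: pts_pb[OF A(1)] pts_pb[OF B(1)])
    fix c
    assume "c \<in> pts ?B"
    then obtain i b where c: "c = Prd i b" "i \<in> points X" "b \<in> pts B" "proj B b = q i"
      by (auto simp: pts_pb[OF B(1)])
    then have c': "Prd i b \<in> pts ?B" by (simp add: Prd_in_pb[OF B(1)])
    show "proj ?A (?\<phi> c) = proj ?B c"
      using c c' \<phi>f(1)[OF c(3)] by (simp add: pb_simps[OF A(1)] pb_simps[OF B(1)])
    show "?\<phi> (ract ?B x c) = ract ?A x (?\<phi> c)" if x: "x \<in> carrier G" for x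
    proof -
      have "ract ?B x c \<in> pts ?B" using X.ract_in[OF pb_retr_in[OF B(1)] x] c c' by simp
      then show ?thesis
        using c c' \<phi>f(1)[OF c(3)] \<phi>f(2)[OF x c(3)] x
        by (simp add: pb_simps[OF A(1)] pb_simps[OF B(1)])
    qed
  next
    fix i
    assume i: "i \<in> points X"
    then have "sect ?B i \<in> pts ?B" using X.sect_in[OF pb_retr_in[OF B(1)]] by blast
    then show "?\<phi> (sect ?B i) = sect ?A i"
      using i \<phi>f(3)[OF q_in[OF i]] by (simp add: pb_simps[OF A(1)] pb_simps[OF B(1)])
  qed
  have "X.compat (?A, pb_fam T, pb_lab A \<chi>) (?B, pb_fam S, pb_lab B \<psi>) ?\<phi> (\<lambda>i. k (q i))"
  proof -
    have "?\<phi> c = d \<longleftrightarrow> above (Fob (pb_fam S) (proj ?B c)) (snd (pb_lab B \<psi> c))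
        (k (q (proj ?B c)) (snd (pb_lab A \<chi> d)))"
      if c: "c \<in> labels X ?B" and d: "d \<in> labels X ?A" and cd: "proj ?B c = proj ?A d" for c d
    proof -
      obtain i b where cb: "c = Prd i b" "i \<in> points X" "b \<in> labels Y B" "proj B b = q i"
        using c by (auto simp: labels_pb[OF B(1)])
      obtain j a where da: "d = Prd j a" "j \<in> points X" "a \<in> labels Y A" "proj A a = q j"
        using d by (auto simp: labels_pb[OF A(1)])
      have ij: "i = j" using cd proj_pb[OF A(1) d] proj_pb[OF B(1) c] cb da by simp
      have "?\<phi> c = d \<longleftrightarrow> \<phi> b = a"
        using cb da ij X.labels_in[OF pb_retr_in[OF B(1)] c] by simp
      also have "\<dots> \<longleftrightarrow> above (Fob S (q i)) (snd (\<psi> b)) (k (q i) (snd (\<chi> a)))"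
        using Y.compatD[OF compat cb(3) da(3)] cb(4) da(4) ij by simp
      finally show ?thesis
        using c d proj_pb[OF B(1) c] cb da by (simp add: pb_lab_def Fob_pb_fam)
    qed
    then show ?thesis by (simp add: X.compat_def)
  qed
  then have hom: "X.mk_garr (?A, pb_fam T, pb_lab A \<chi>) (?B, pb_fam S, pb_lab B \<psi>) ?\<phi> (\<lambda>i. k (q i)) \<in>
      homset (orbit_groth G X) (?A, pb_fam T, pb_lab A \<chi>) (?B, pb_fam S, pb_lab B \<psi>)"
    using X.mk_garr_in_iff[OF s' t'] \<phi>' pb_fam_arr[OF k] by blast
  interpret g: graft_family G Y A T \<chi> B \<phi>
    by unfold_locales (use A B \<phi> in auto)
  interpret g': graft_family G X ?A "pb_fam T" "pb_lab A \<chi>" ?B ?\<phi>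
    by unfold_locales (use s' t' \<phi>' in \<open>auto simp: X.Obj_orbit_groth\<close>)
  let ?\<eta> = "Y.fam_arr (Y.mk_fam g.P g.Pact) S (\<lambda>i. on_graft (k i) (\<lambda>b. snd (\<psi> b)) (tree_root (Fob S i)))"
  \<comment> \<open>The inner \<open>on_graft\<close> is the canonical isomorphism in
    \<open>pb_arr\<close>, which strips the index from a new leaf; after it the arrow takes the
    values of a normal form on all three kinds of edges.\<close>
  have "edge_map ?\<eta> (q i) (on_graft Old (\<lambda>c. New (prd_snd c)) NewRoot e) =
      on_graft (k (q i)) (\<lambda>b. snd (pb_lab B \<psi> b)) (tree_root (Fob (pb_fam S) i)) e"
    if i: "i \<in> points X" and e: "e \<in> edges (g'.P i)" for i e
    using e i
  proof (cases rule: g'.edges_P_cases)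
    case (Old d)
    then show ?thesis
      using q_in[OF i] i
      by (simp add: on_graft_def Fob_pb_fam Y.edge_map_fam_arr Y.mk_fam_simps g.edges_P)
  next
    case (New c)
    then obtain b where c: "c = Prd i b" "b \<in> labels Y B" "proj B b = q i"
      using proj_pb[OF B(1)] by (auto simp: labels_pb[OF B(1)])
    then show ?thesis
      using New q_in[OF i] i
      by (simp add: on_graft_def pb_lab_def Y.edge_map_fam_arr Y.mk_fam_simps g.edges_P)
  next
    case NewRoot
    then show ?thesis
      using q_in[OF i] i
      by (simp add: on_graft_def Fob_pb_fam Y.edge_map_fam_arr Y.mk_fam_simps g.edges_P)
  qed
  then have "X.fam_arr (X.mk_fam g'.P g'.Pact) (pb_fam S)
        (\<lambda>i e. edge_map ?\<eta> (q i) (on_graft Old (\<lambda>c. New (prd_snd c)) NewRoot e)) =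
      X.fam_arr (X.mk_fam g'.P g'.Pact) (pb_fam S)
        (\<lambda>i. on_graft (k (q i)) (\<lambda>b. snd (pb_lab B \<psi> b)) (tree_root (Fob (pb_fam S) i)))"
    by (intro X.fam_arr_cong) (simp add: X.mk_fam_simps)
  then have eq: "pb_arr G p (Y.mk_garr (A, T, \<chi>) (B, S, \<psi>) \<phi> k) =
      X.mk_garr (?A, pb_fam T, pb_lab A \<chi>) (?B, pb_fam S, pb_lab B \<psi>) ?\<phi> (\<lambda>i. k (q i))"
    by (simp add: pb_arr_def Let_def Y.mk_garr_def X.mk_garr_def pb_obj_eq A B fst_p
        X.ltree_arr_eq Y.ltree_arr_eq g.graft_obj_eq g'.graft_obj_eq)
  show "pb_arr G p (Y.mk_garr (A, T, \<chi>) (B, S, \<psi>) \<phi> k) \<in>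
      homset (orbit_groth G X) (pb_obj G p (A, T, \<chi>)) (pb_obj G p (B, S, \<psi>))"
    using hom by (simp add: eq pb_obj_eq A B)
  show "X.old_part (pb_arr G p (Y.mk_garr (A, T, \<chi>) (B, S, \<psi>) \<phi> k)) =
      X.fam_arr (pb_fam T) (pb_fam S) (\<lambda>i. k (q i))"
    using X.old_part_mk_garr[OF s' t' \<phi>'] by (simp add: eq)
qed

end

lemma gmap_Comp: "gmap (Comp (functor_cat (BG G) finset_cat) r p) =
    compose {1..fst (datum p ())} (gmap r) (gmap p)"
  by (simp add: gmap_def Comp_functor_cat Comp_finset)

lemma gmap_Ident: "gmap (Ident (functor_cat (BG G) finset_cat) X) = (\<lambda>i\<in>points X. i)"
  by (simp add: gmap_def Ident_functor_cat finset_cat_def points_def)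

context gset_map
begin

lemma gmap_eq_datum: "fst (datum p ()) = Fob X ()"
  by (subst p_eq) simp

text \<open>Brings maps into a pulled back family to the shape that the tree part of a forest map
  has in \<open>forest_hom\<close>.\<close>

lemma homset_pb_fam:
  assumes T: "T \<in> Obj (Omega_orbit G X)" and S: "S \<in> Obj (Omega_orbit G Y)"
  shows "h \<in> homset (Omega_orbit G X) T (pb_fam S) \<longleftrightarrow>
    (\<exists>f\<in>extensional (points X). h = (T, pb_fam S, f) \<and>
      (\<forall>i\<in>points X. f i \<in> homset Omega (Fob T i) (Fob S (q i))) \<and>
      (\<forall>x\<in>carrier G. \<forall>i\<in>points X.
        Comp Omega (f (gact X x i)) (Far T (x, i)) = Comp Omega (Far S (x, q i)) (f i)))"
proof -
  have Far: "Far (pb_fam S) (x, i) = Far S (x, q i)" if "x \<in> carrier G" "i \<in> points X" for x i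
    using X.Far_fam[OF pb_fam_in[OF S] that] Y.Far_fam[OF S that(1) q_in[OF that(2)]]
      Fob_pb_fam[OF that(2)] Fob_pb_fam[OF X.gact_in[OF that]] tact_pb_fam[OF that] q_act[OF that]
    by metis
  have "(\<forall>a\<in>points X. f a \<in> homset Omega (Fob T a) (Fob (pb_fam S) a)) \<longleftrightarrow>
      (\<forall>i\<in>points X. f i \<in> homset Omega (Fob T i) (Fob S (q i)))" for f
    by (simp add: Fob_pb_fam cong: ball_cong)
  moreover have "(\<forall>g a b. g \<in> homset (action_groupoid G X) a b \<longrightarrow>
        Comp Omega (f b) (Far T g) = Comp Omega (Far (pb_fam S) g) (f a)) \<longleftrightarrow>
      (\<forall>x\<in>carrier G. \<forall>i\<in>points X.
        Comp Omega (f (gact X x i)) (Far T (x, i)) = Comp Omega (Far S (x, q i)) (f i))" for f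
    using Far by (auto simp: X.homset_groupoid)
  ultimately show ?thesis
    using T pb_fam_in[OF S] by (simp add: Omega_orbit_def homset_functor_cat X.groupoid_simps)
qed

end

section \<open>The structure isomorphisms of the pseudofunctor\<close>

locale gset_map_pair = XY: gset_map G X Y p + YZ: gset_map G Y Z r
  for G (structure) and X Y Z :: "'a ordgset" and p r :: "'a ordgset_arr"
begin

abbreviation rp :: "'a ordgset_arr" where
  "rp \<equiv> Comp (functor_cat (BG G) finset_cat) r p"

lemma rp_in: "rp \<in> homset (functor_cat (BG G) finset_cat) X Z"
  using category.Comp_in[OF category_functor_cat[OF category_BG category_finset] XY.p YZ.p] XY.X.is_group
  by blast

sublocale XZ: gset_map G X Z rp
  by unfold_locales (rule rp_in)

lemma gmap_rp: "i \<in> points X \<Longrightarrow> gmap rp i = gmap r (gmap p i)"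
  using XY.gmap_eq_datum by (simp add: gmap_Comp compose_def points_def)

text \<open>Precomposition is strictly functorial, so pulling back in two stages changes only the
  set of labels, up to isomorphism. This is why the structure map is a relabeling of one and the
  same family.\<close>

lemma pb_fam_rp: "XZ.pb_fam T = XY.pb_fam (YZ.pb_fam T)"
  unfolding XZ.pb_fam_def XY.pb_fam_def
  by (rule XY.X.mk_fam_cong) (simp_all add: gmap_rp XY.q_in YZ.Fob_pb_fam YZ.tact_pb_fam)

lemma Tcomp_facts:
  assumes u: "(A, T, \<chi>) \<in> Obj (orbit_groth G Z)"
  defines "E \<equiv> orbit_groth G X"
    and "\<tau> \<equiv> relabel G X (pb_obj G rp (A, T, \<chi>)) (pb_obj G p (pb_obj G r (A, T, \<chi>)))
      (\<lambda>c. Prd (prd_fst c) (prd_snd (prd_snd c)))"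
  shows "inverse_arr E \<tau> \<in> homset E (pb_obj G p (pb_obj G r (A, T, \<chi>))) (pb_obj G rp (A, T, \<chi>))"
    and "XY.X.old_part (inverse_arr E \<tau>) = XY.X.fam_arr (XZ.pb_fam T) (XZ.pb_fam T) (\<lambda>i e. e)"
proof -
  have A: "is_retr G Z A" and T: "T \<in> Obj (Omega_orbit G Z)"
    using u by (auto simp: YZ.Y.Obj_orbit_groth)
  let ?f = "\<lambda>c. Prd (prd_fst c) (prd_snd (prd_snd c))"
  let ?A0 = "pb_retr G rp A" and ?A1 = "pb_retr G r A"
  let ?A2 = "pb_retr G p ?A1"
  note A1 = YZ.pb_retr_in[OF A] and T1 = YZ.pb_fam_in[OF T]
  note s = XZ.pb_obj_in[OF u] and t = XY.pb_obj_in[OF YZ.pb_obj_in[OF u]]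
  \<comment> \<open>In the iterated pullback the middle index is forced to be
    \<open>gmap p i\<close>, so \<open>?f\<close> loses nothing by dropping it.\<close>
  have pts2: "c \<in> pts ?A2 \<longleftrightarrow> (\<exists>i a. c = Prd i (Prd (gmap p i) a) \<and> i \<in> points X \<and> a \<in> pts A \<and> proj A a = gmap rp i)" for c
    using XY.q_in by (auto simp: XY.pts_pb[OF A1] YZ.pts_pb[OF A] YZ.pb_simps[OF A] gmap_rp)
  have lab2: "c \<in> labels X ?A2 \<longleftrightarrow> (\<exists>i a. c = Prd i (Prd (gmap p i) a) \<and> i \<in> points X \<and> a \<in> labels Z A \<and> proj A a = gmap rp i)" for c
    using XY.q_in YZ.Y.labels_in[OF A]
    by (auto simp: XY.labels_pb[OF A1] YZ.labels_pb[OF A] YZ.pb_simps[OF A] gmap_rp)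
  have f: "retr_map G X ?A2 ?A0 (\<lambda>c\<in>pts ?A2. ?f c)"
    unfolding retr_map_def
  proof (intro conjI ballI)
    show "(\<lambda>c\<in>pts ?A2. ?f c) \<in> pts ?A2 \<rightarrow>\<^sub>E pts ?A0"
      by (auto simp: pts2 XZ.Prd_in_pb[OF A])
    fix c
    assume c2: "c \<in> pts ?A2"
    then obtain i a where c: "c = Prd i (Prd (gmap p i) a)" "i \<in> points X" "a \<in> pts A" "proj A a = gmap rp i"
      by (auto simp: pts2)
    then have a1: "Prd (gmap p i) a \<in> pts ?A1" "proj ?A1 (Prd (gmap p i) a) = gmap p i"
        "proj A a = gmap r (gmap p i)"
      using XY.q_in gmap_rp by (auto simp: YZ.Prd_in_pb[OF A] YZ.pb_simps[OF A])
    show "proj ?A0 ((\<lambda>c\<in>pts ?A2. ?f c) c) = proj ?A2 c"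
      using c a1 c2 by (simp add: XZ.pb_simps[OF A] XY.pb_simps[OF A1])
    show "(\<lambda>c\<in>pts ?A2. ?f c) (ract ?A2 x c) = ract ?A0 x ((\<lambda>c\<in>pts ?A2. ?f c) c)" if x: "x \<in> carrier G" for x
    proof -
      have "ract ?A2 x c = Prd (gact X x i) (Prd (gact Y x (gmap p i)) (ract A x a))"
        using c a1 x XY.q_in by (simp add: XY.pb_simps[OF A1] YZ.pb_simps[OF A])
      moreover have "ract ?A2 x c \<in> pts ?A2"
        using XY.X.ract_in[OF XY.pb_retr_in[OF A1] x c2] .
      ultimately show ?thesis using c2 c x by (simp add: XZ.pb_simps[OF A])
    qed
  next
    fix i
    assume i: "i \<in> points X"
    have "sect ?A2 i \<in> pts ?A2" using XY.X.sect_in[OF XY.pb_retr_in[OF A1] i] .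
    then show "(\<lambda>c\<in>pts ?A2. ?f c) (sect ?A2 i) = sect ?A0 i"
      using i XY.q_in[OF i]
      by (simp add: XY.pb_simps[OF A1] YZ.pb_simps[OF A] XZ.pb_simps[OF A] gmap_rp)
  qed
  have lab: "?f c \<in> labels X ?A0 \<and> snd (XZ.pb_lab A \<chi> (?f c)) = snd (XY.pb_lab ?A1 (YZ.pb_lab A \<chi>) c)"
    if c2: "c \<in> labels X ?A2" for c
  proof -
    obtain i a where c: "c = Prd i (Prd (gmap p i) a)" "i \<in> points X" "a \<in> labels Z A" "proj A a = gmap rp i"
      using c2 by (auto simp: lab2)
    then have "Prd i a \<in> labels X ?A0" by (auto simp: XZ.labels_pb[OF A])
    moreover have "Prd (gmap p i) a \<in> labels Y ?A1"
      using c XY.q_in gmap_rp by (auto simp: YZ.labels_pb[OF A])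
    ultimately show ?thesis
      using c c2 by (simp add: XZ.pb_lab_def XY.pb_lab_def YZ.pb_lab_def)
  qed
  note inv = XY.X.inverse_relabel[OF s, of ?A2 "XY.pb_lab ?A1 (YZ.pb_lab A \<chi>)" ?f]
  show "inverse_arr E \<tau> \<in> homset E (pb_obj G p (pb_obj G r (A, T, \<chi>))) (pb_obj G rp (A, T, \<chi>))"
    "XY.X.old_part (inverse_arr E \<tau>) = XY.X.fam_arr (XZ.pb_fam T) (XZ.pb_fam T) (\<lambda>i e. e)"
    using inv[OF _ f lab] t
    by (simp_all add: E_def \<tau>_def XZ.pb_obj_eq[OF T] YZ.pb_obj_eq[OF T] XY.pb_obj_eq[OF T1] pb_fam_rp)
qed

end

context gset
begin

abbreviation idX :: "'a ordgset_arr" where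
  "idX \<equiv> Ident (functor_cat (BG G) finset_cat) X"

lemma idX_in: "idX \<in> homset (functor_cat (BG G) finset_cat) X X"
  using category.Ident_in[OF category_functor_cat[OF category_BG category_finset] X] is_group by blast

lemma gset_map_id: "gset_map G X X idX"
  by unfold_locales (rule idX_in)

text \<open>Pulling back along the identity leaves the family unchanged and only pairs each label
  with its index, so \<open>inverse_relabel\<close> applies.\<close>

lemma Tid_facts:
  assumes s: "(A, T, \<chi>) \<in> Obj (orbit_groth G X)"
  defines "E \<equiv> orbit_groth G X"
    and "\<tau> \<equiv> relabel G X (pb_obj G idX (A, T, \<chi>)) (A, T, \<chi>) (\<lambda>a. Prd (proj A a) a)"
  shows "inverse_arr E \<tau> \<in> homset E (A, T, \<chi>) (pb_obj G idX (A, T, \<chi>))"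
    and "old_part (inverse_arr E \<tau>) = fam_arr T T (\<lambda>i e. e)"
proof -
  interpret m: gset_map G X X idX by (rule gset_map_id)
  have A: "is_retr G X A" and T: "T \<in> Obj (Omega_orbit G X)"
    using s by (auto simp: Obj_orbit_groth)
  have q: "gmap idX i = i" if "i \<in> points X" for i using that by (simp add: gmap_Ident)
  have T_eq: "m.pb_fam T = T"
  proof -
    have "m.pb_fam T = mk_fam (Fob T) (tact T)"
      unfolding m.pb_fam_def by (rule mk_fam_cong) (simp_all add: q)
    then show ?thesis using mk_fam_eq[OF T] by simp
  qed
  let ?A0 = "pb_retr G idX A"
  note fA = retr_facts[OF A]
  have f: "retr_map G X A ?A0 (\<lambda>a\<in>pts A. Prd (proj A a) a)"
    unfolding retr_map_def
    using proj_in[OF A] ract_in[OF A] sect_in[OF A] fA(6-8)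
    by (auto simp: m.Prd_in_pb[OF A] m.pb_simps[OF A] q)
  have lab: "Prd (proj A a) a \<in> labels X ?A0 \<and> snd (m.pb_lab A \<chi> (Prd (proj A a) a)) = snd (\<chi> a)"
    if "a \<in> labels X A" for a
  proof -
    have "Prd (proj A a) a \<in> labels X ?A0"
      using that proj_in[OF A labels_in[OF A that]] by (auto simp: m.labels_pb[OF A] q)
    then show ?thesis by (simp add: m.pb_lab_def)
  qed
  show "inverse_arr E \<tau> \<in> homset E (A, T, \<chi>) (pb_obj G idX (A, T, \<chi>))"
    "old_part (inverse_arr E \<tau>) = fam_arr T T (\<lambda>i e. e)"
    using inverse_relabel[OF m.pb_obj_in[OF s, unfolded T_eq] s f lab]
    by (simp_all add: E_def \<tau>_def m.pb_obj_eq[OF T] T_eq)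
qed

end

section \<open>Equivariant forests\<close>

lemma homset_forest: "h \<in> homset forest_cat (n, T) (m, S) \<longleftrightarrow>
    (n, T) \<in> Obj forest_cat \<and> (m, S) \<in> Obj forest_cat \<and>
    (\<exists>\<phi> f. h = ((n, T), (m, S), (\<phi>, f)) \<and> \<phi> \<in> {1..n} \<rightarrow>\<^sub>E {1..m} \<and> f \<in> extensional {1..n} \<and>
      (\<forall>i\<in>{1..n}. f i \<in> homset Omega (T i) (S (\<phi> i))))"
  by (auto simp: forest_cat_def homset_mk_cat PiE_iff)

lemma Obj_forest: "(n, T) \<in> Obj forest_cat \<longleftrightarrow> n \<ge> 1 \<and> T \<in> extensional {1..n} \<and> (\<forall>i\<in>{1..n}. rooted (T i))"
  by (auto simp: forest_cat_def Obj_Omega PiE_iff)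

lemma Comp_forest: "Comp forest_cat (b, c, (\<psi>, g)) ((n, T), b', (\<phi>, f)) =
    ((n, T), c, (compose {1..n} \<psi> \<phi>, \<lambda>i\<in>{1..n}. Comp Omega (g (\<phi> i)) (f i)))"
  by (simp add: forest_cat_def split: prod.splits)

lemma Ident_forest: "Ident forest_cat (n, T) =
    ((n, T), (n, T), (\<lambda>i\<in>{1..n}. i, \<lambda>i\<in>{1..n}. Ident Omega (T i)))"
  by (simp add: forest_cat_def)

lemma category_forest: "category forest_cat"
proof -
  interpret O: category Omega by (rule category_Omega)
  show ?thesis
  proof
    fix f
    assume "f \<in> Arr forest_cat"
    then show "Dom forest_cat f \<in> Obj forest_cat" "Cod forest_cat f \<in> Obj forest_cat"
      by (simp_all add: forest_cat_def Arr_mk_cat)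
  next
    fix a
    assume a: "a \<in> Obj forest_cat"
    obtain n T where "a = (n, T)" by (cases a)
    then show "Ident forest_cat a \<in> homset forest_cat a a"
      using a by (auto simp: Ident_forest homset_forest Obj_forest Obj_Omega intro!: O.Ident_in)
  next
    fix f g a b c
    assume f: "f \<in> homset forest_cat a b" and g: "g \<in> homset forest_cat b c"
    obtain n T m S l R where eq: "a = (n, T)" "b = (m, S)" "c = (l, R)" by (cases a, cases b, cases c)
    show "Comp forest_cat g f \<in> homset forest_cat a c"
      using f g unfolding eq
      by (auto simp: homset_forest Comp_forest compose_def PiE_iff intro!: O.Comp_in)
  next
    fix f a b
    assume f: "f \<in> homset forest_cat a b"
    obtain n T m S where eq: "a = (n, T)" "b = (m, S)" by (cases a, cases b)
    obtain \<phi> k where k: "f = ((n, T), (m, S), (\<phi>, k))" "\<phi> \<in> {1..n} \<rightarrow>\<^sub>E {1..m}" "k \<in> extensional {1..n}"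
        "\<And>i. i \<in> {1..n} \<Longrightarrow> k i \<in> homset Omega (T i) (S (\<phi> i))"
      using f by (auto simp: eq homset_forest)
    have "compose {1..n} (\<lambda>i\<in>{1..m}. i) \<phi> = \<phi>" "compose {1..n} \<phi> (\<lambda>i\<in>{1..n}. i) = \<phi>"
      by (rule extensionalityI[where A = "{1..n}"]; use k(2) in \<open>auto simp: compose_def PiE_iff\<close>)+
    moreover have "(\<lambda>i\<in>{1..n}. Comp Omega ((\<lambda>i\<in>{1..m}. Ident Omega (S i)) (\<phi> i)) (k i)) = k"
      using k(2) O.Comp_Ident_left[OF k(4)]
      by (intro extensionalityI[OF _ k(3)]) (auto simp: PiE_iff)
    moreover have "(\<lambda>i\<in>{1..n}. Comp Omega (k ((\<lambda>i\<in>{1..n}. i) i)) ((\<lambda>i\<in>{1..n}. Ident Omega (T i)) i)) = k"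
      using O.Comp_Ident_right[OF k(4)]
      by (intro extensionalityI[OF _ k(3)]) auto
    ultimately show "Comp forest_cat (Ident forest_cat b) f = f" "Comp forest_cat f (Ident forest_cat a) = f"
      by (simp_all only: eq k(1) Ident_forest Comp_forest)
  next
    fix f g h a b c d
    assume f: "f \<in> homset forest_cat a b" and g: "g \<in> homset forest_cat b c" and h: "h \<in> homset forest_cat c d"
    obtain n T m S l R j Q where eq: "a = (n, T)" "b = (m, S)" "c = (l, R)" "d = (j, Q)"
      by (cases a, cases b, cases c, cases d)
    obtain \<phi> k where k: "f = ((n, T), (m, S), (\<phi>, k))" "\<phi> \<in> {1..n} \<rightarrow>\<^sub>E {1..m}"
        "\<And>i. i \<in> {1..n} \<Longrightarrow> k i \<in> homset Omega (T i) (S (\<phi> i))"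
      using f by (auto simp: eq homset_forest)
    obtain \<gamma> k' where k': "g = ((m, S), (l, R), (\<gamma>, k'))" "\<gamma> \<in> {1..m} \<rightarrow>\<^sub>E {1..l}"
        "\<And>i. i \<in> {1..m} \<Longrightarrow> k' i \<in> homset Omega (S i) (R (\<gamma> i))"
      using g by (auto simp: eq homset_forest)
    obtain \<delta> k'' where k'': "h = ((l, R), (j, Q), (\<delta>, k''))"
        "\<And>i. i \<in> {1..l} \<Longrightarrow> k'' i \<in> homset Omega (R i) (Q (\<delta> i))"
      using h by (auto simp: eq homset_forest)
    have in_m: "\<phi> i \<in> {1..m}" "\<gamma> (\<phi> i) \<in> {1..l}" if "i \<in> {1..n}" for i
      using that k(2) k'(2) by blast+
    have "compose {1..n} \<delta> (compose {1..n} \<gamma> \<phi>) = compose {1..n} (compose {1..m} \<delta> \<gamma>) \<phi>"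
      using in_m by (auto simp: compose_def intro!: restrict_ext)
    moreover have "(\<lambda>i\<in>{1..n}. Comp Omega (k'' (compose {1..n} \<gamma> \<phi> i))
          ((\<lambda>i\<in>{1..n}. Comp Omega (k' (\<phi> i)) (k i)) i)) =
        (\<lambda>i\<in>{1..n}. Comp Omega ((\<lambda>i\<in>{1..m}. Comp Omega (k'' (\<gamma> i)) (k' i)) (\<phi> i)) (k i))"
      using in_m O.Comp_assoc[OF k(3) k'(3) k''(2)]
      by (intro restrict_ext) (simp add: compose_def del: atLeastAtMost_iff)
    ultimately show "Comp forest_cat h (Comp forest_cat g f) = Comp forest_cat (Comp forest_cat h g) f"
      by (simp only: k(1) k'(1) k''(1) Comp_forest)
  qed
qed

text \<open>The action on a forest consists of an action on its roots, supplied by \<open>X\<close>,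
  and of maps between its trees, supplied by \<open>T\<close>.\<close>

definition forest_of :: "('g, 'm) monoid_scheme \<Rightarrow> 'g ordgset \<Rightarrow> 'g treefam \<Rightarrow> 'g gforest" where
  "forest_of G X T = (let F = (Fob X (), Fob T) in
     \<lparr>Fob = (\<lambda>_. F), Far = (\<lambda>x\<in>carrier G. (F, F, (gact X x, \<lambda>i\<in>points X. Far T (x, i))))\<rparr>)"

lemma forest_of_simps:
  "Fob (forest_of G X T) u = (Fob X (), Fob T)"
  "x \<in> carrier G \<Longrightarrow> Far (forest_of G X T) x =
    ((Fob X (), Fob T), (Fob X (), Fob T), (gact X x, \<lambda>i\<in>points X. Far T (x, i)))"
  by (simp_all add: forest_of_def Let_def)

lemma transitive_forest_of:
  "transitive G (comp_funct roots_funct (forest_of G X T)) \<longleftrightarrow> transitive G X"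
  by (auto simp: transitive_def comp_funct_def roots_funct_def points_def gact_def forest_of_simps)

context gset
begin

lemma points_eq: "points X = {1..Fob X ()}"
  by (simp add: points_def)

lemma Fob_X_ge: "Fob X () \<ge> 1"
proof -
  interpret X: cat_functor "BG G" finset_cat X by (rule X_functor)
  show ?thesis using X.Fob_in[of "()"] by (simp add: finset_cat_def)
qed

context
  fixes T
  assumes T: "T \<in> Obj (Omega_orbit G X)"
begin

lemma Fob_forest_in: "(Fob X (), Fob T) \<in> Obj forest_cat"
  using T Fob_X_ge fam_rooted[OF T]
  by (simp add: Obj_forest points_eq Omega_orbit_def Obj_functor_cat groupoid_simps)

lemma forest_of_in: "forest_of G X T \<in> Obj (functor_cat (BG G) forest_cat)"
proof -
  interpret B: category "BG G" by (rule category_BG[OF is_group])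
  interpret F: category forest_cat by (rule category_forest)
  have "cat_functor (BG G) forest_cat (forest_of G X T)"
  proof
    show "Fob (forest_of G X T) a \<in> Obj forest_cat" for a
      using Fob_forest_in by (simp add: forest_of_simps)
    show "Far (forest_of G X T) x \<in> homset forest_cat (Fob (forest_of G X T) a) (Fob (forest_of G X T) b)"
      if "x \<in> homset (BG G) a b" for x a b
    proof -
      have x: "x \<in> carrier G" using that by simp
      have "Far T (x, i) \<in> homset Omega (Fob T i) (Fob T (gact X x i))" if "i \<in> points X" for i
        using Far_fam[OF T x that] fam_rooted[OF T that] fam_rooted[OF T gact_in[OF x that]]
        by (auto simp: homset_Omega)
      then show ?thesis
        using Fob_forest_in Far_X[OF x] x by (simp add: forest_of_simps homset_forest points_eq)
    qed
    show "Far (forest_of G X T) (Ident (BG G) a) = Ident forest_cat (Fob (forest_of G X T) a)" for a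
    proof -
      have "gact X \<one> = (\<lambda>i\<in>points X. i)"
        by (rule extensionalityI[where A = "points X"])
          (use Far_X[OF one_closed] gact_one in \<open>auto simp: PiE_iff\<close>)
      moreover have "(\<lambda>i\<in>points X. Far T (\<one>, i)) = (\<lambda>i\<in>points X. Ident Omega (Fob T i))"
        using Far_fam[OF T one_closed] gact_one tact_one'[OF T]
        by (intro restrict_ext) (simp add: Ident_Omega)
      ultimately show ?thesis by (simp add: forest_of_simps Ident_forest points_eq)
    qed
    show "Far (forest_of G X T) (Comp (BG G) y x) = Comp forest_cat (Far (forest_of G X T) y) (Far (forest_of G X T) x)"
      if "x \<in> homset (BG G) a b" "y \<in> homset (BG G) b c" for x y a b c
    proof -
      have x: "x \<in> carrier G" and y: "y \<in> carrier G" using that by simp_all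
      have "gact X (y \<otimes> x) = compose (points X) (gact X y) (gact X x)"
        by (rule extensionalityI[where A = "points X"])
          (use Far_X[OF m_closed[OF y x]] gact_mult[OF x y] in \<open>auto simp: PiE_iff compose_def\<close>)
      moreover have "(\<lambda>i\<in>points X. Far T (y \<otimes> x, i)) =
          (\<lambda>i\<in>points X. Comp Omega ((\<lambda>i\<in>points X. Far T (y, i)) (gact X x i)) ((\<lambda>i\<in>points X. Far T (x, i)) i))"
      proof (rule restrict_ext)
        fix i
        assume i: "i \<in> points X"
        have "Far T (y \<otimes> x, i) = Comp Omega (Far T (y, gact X x i)) (Far T (x, i))"
          using cat_functor.Far_Comp[OF fam_functor[OF T], of "(x, i)" i "gact X x i" "(y, gact X x i)" "gact X y (gact X x i)"]
            x y i gact_in by (auto simp: homset_groupoid groupoid_simps)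
        then show "Far T (y \<otimes> x, i) = Comp Omega ((\<lambda>i\<in>points X. Far T (y, i)) (gact X x i)) ((\<lambda>i\<in>points X. Far T (x, i)) i)"
          using i gact_in[OF x i] by simp
      qed
      ultimately show ?thesis
        using x y by (simp add: forest_of_simps Comp_forest points_eq)
    qed
  qed
  then show ?thesis by (simp add: Obj_functor_cat forest_of_def Let_def extensional_def)
qed

end

end

lemma restrict_eq_iff: "restrict f A = restrict g A \<longleftrightarrow> (\<forall>x\<in>A. f x = g x)"
  by (metis restrict_apply' restrict_ext)

text \<open>Naturality of a forest map splits in two: the map of roots is equivariant, and the maps
  of trees are natural into the family pulled back along it, as in
  \<open>homset_pb_fam\<close>.\<close>

lemma forest_hom:
  fixes G (structure)
  assumes "gset G X" and "gset G Y" and T: "T \<in> Obj (Omega_orbit G X)" and S: "S \<in> Obj (Omega_orbit G Y)"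
  shows "h \<in> homset (functor_cat (BG G) forest_cat) (forest_of G X T) (forest_of G Y S) \<longleftrightarrow>
    (\<exists>\<phi> f. h = (forest_of G X T, forest_of G Y S, \<lambda>_. ((Fob X (), Fob T), (Fob Y (), Fob S), (\<phi>, f))) \<and>
      \<phi> \<in> points X \<rightarrow>\<^sub>E points Y \<and> (\<forall>x\<in>carrier G. \<forall>i\<in>points X. \<phi> (gact X x i) = gact Y x (\<phi> i)) \<and>
      f \<in> extensional (points X) \<and>
      (\<forall>i\<in>points X. f i \<in> homset Omega (Fob T i) (Fob S (\<phi> i))) \<and>
      (\<forall>x\<in>carrier G. \<forall>i\<in>points X.
        Comp Omega (f (gact X x i)) (Far T (x, i)) = Comp Omega (Far S (x, \<phi> i)) (f i)))"
proof -
  interpret X: gset G X by fact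
  interpret Y: gset G Y by fact
  let ?M = "(Fob X (), Fob T)" and ?N = "(Fob Y (), Fob S)"
  have nat: "Comp forest_cat (?M, ?N, (\<phi>, f)) (Far (forest_of G X T) x) =
      Comp forest_cat (Far (forest_of G Y S) x) (?M, ?N, (\<phi>, f)) \<longleftrightarrow>
      (\<forall>i\<in>points X. \<phi> (gact X x i) = gact Y x (\<phi> i)) \<and>
      (\<forall>i\<in>points X. Comp Omega (f (gact X x i)) (Far T (x, i)) = Comp Omega (Far S (x, \<phi> i)) (f i))"
    if x: "x \<in> carrier G" and \<phi>: "\<phi> \<in> points X \<rightarrow>\<^sub>E points Y" for x \<phi> f
  proof -
    have \<phi>i: "\<phi> i \<in> points Y" if "i \<in> points X" for i using \<phi> that by blast
    show ?thesis
      unfolding forest_of_simps(2)[OF x] Comp_forest prod.inject X.points_eq[symmetric] compose_def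
        restrict_eq_iff
      using \<phi>i X.gact_in[OF x] by auto
  qed
  have "h \<in> homset (functor_cat (BG G) forest_cat) (forest_of G X T) (forest_of G Y S) \<longleftrightarrow>
    (\<exists>\<theta>. h = (forest_of G X T, forest_of G Y S, \<theta>) \<and> \<theta> () \<in> homset forest_cat ?M ?N \<and>
      (\<forall>x\<in>carrier G. Comp forest_cat (\<theta> ()) (Far (forest_of G X T) x) =
        Comp forest_cat (Far (forest_of G Y S) x) (\<theta> ())))"
    using X.forest_of_in[OF T] Y.forest_of_in[OF S] by (auto simp: homset_functor_cat forest_of_simps)
  also have "\<dots> \<longleftrightarrow> (\<exists>d. h = (forest_of G X T, forest_of G Y S, \<lambda>_. d) \<and> d \<in> homset forest_cat ?M ?N \<and>
      (\<forall>x\<in>carrier G. Comp forest_cat d (Far (forest_of G X T) x) =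
        Comp forest_cat (Far (forest_of G Y S) x) d))"
  proof -
    \<comment> \<open>\<open>BG\<close> has a single object, so a transformation is given by a
      single arrow.\<close>
    have "(\<exists>\<theta>. R \<theta>) \<longleftrightarrow> (\<exists>d. R (\<lambda>_. d))" for R :: "(unit \<Rightarrow> forest_arr) \<Rightarrow> bool"
    proof
      assume "\<exists>\<theta>. R \<theta>"
      then obtain \<theta> where "R \<theta>" ..
      moreover have "\<theta> = (\<lambda>_. \<theta> ())" by (simp add: fun_eq_iff)
      ultimately have "R (\<lambda>_. \<theta> ())" by simp
      then show "\<exists>d. R (\<lambda>_. d)" ..
    qed blast
    then show ?thesis by (rule trans) (rule refl)
  qed
  also have "\<dots> \<longleftrightarrow> (\<exists>\<phi> f. h = (forest_of G X T, forest_of G Y S, \<lambda>_. (?M, ?N, (\<phi>, f))) \<and>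
      \<phi> \<in> points X \<rightarrow>\<^sub>E points Y \<and> f \<in> extensional (points X) \<and>
      (\<forall>i\<in>points X. f i \<in> homset Omega (Fob T i) (Fob S (\<phi> i))) \<and>
      (\<forall>x\<in>carrier G. Comp forest_cat (?M, ?N, (\<phi>, f)) (Far (forest_of G X T) x) =
        Comp forest_cat (Far (forest_of G Y S) x) (?M, ?N, (\<phi>, f))))"
    using X.Fob_forest_in[OF T] Y.Fob_forest_in[OF S]
    unfolding homset_forest X.points_eq Y.points_eq by blast
  finally show ?thesis using nat by blast
qed

context gset
begin

context
  fixes T
  assumes T: "T \<in> Obj (Omega_orbit G X)"
begin

text \<open>If the image \<open>?z\<close> of \<open>e\<close> were the outgoing edge of a vertex,
  the map back would send the incoming edges to a cover of the leaf \<open>e\<close>, hence one of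
  them to \<open>e\<close>; carried forth again, that incoming edge would equal
  \<open>?z\<close>.\<close>

lemma tact_leaf:
  assumes x: "x \<in> carrier G" and i: "i \<in> points X" and e: "e \<in> leaves (Fob T i)"
  shows "tact T x i e \<in> leaves (Fob T (gact X x i))"
proof -
  let ?j = "gact X x i"
  let ?z = "tact T x i e" and ?g = "tact T (inv x) ?j"
  have j: "?j \<in> points X" using gact_in x i by blast
  have Tj: "rooted (Fob T ?j)" and Ti: "rooted (Fob T i)" using fam_rooted[OF T] i j by auto
  have eE: "e \<in> edges (Fob T i)" using e by (simp add: leaves_def)
  have gz: "?g ?z = e" using tact_inv[OF T x i eE] .
  have g: "tree_map (Fob T ?j) (Fob T i) ?g"
    using tact_map[OF T inv_closed[OF x] j] gact_inv[OF x i] by simp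
  have "False" if nl: "?z \<notin> leaves (Fob T ?j)"
  proof -
    obtain v where v: "v \<in> verts (Fob T ?j)" "?z = out_edge (Fob T ?j) v"
      using edge_cases[OF Tj tact_in[OF T x i eE]] nl by metis
    then have "cover (Fob T i) e (?g ` in_edges (Fob T ?j) v)"
      using g gz by (auto simp: tree_map_iff_cover[OF Ti])
    then obtain d where d: "d \<in> in_edges (Fob T ?j) v" "above (Fob T i) (?g d) e"
      using e unfolding cover_def by blast
    then have "?g d = e" using above_leaf[OF Ti] e by (simp add: leaves_def)
    moreover have "d \<in> edges (Fob T ?j)" using d by (simp add: in_edges_def)
    ultimately have "d = ?z" using tact_inv'[OF T x i, of d] by simp
    moreover have "(d, ?z) \<in> step (Fob T ?j)" using d v in_edges_iff[OF Tj] by simp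
    ultimately show False using not_above_step[OF Tj] by blast
  qed
  then show ?thesis by blast
qed

text \<open>Over \<open>i\<close> the points are the leaves of the tree, tagged by
  \<open>Old\<close>, and the base point \<open>NewRoot\<close>. The index in \<open>Prd\<close>
  keeps apart the leaves of different trees, which may be the same token.\<close>

lemma ex_labeling: "\<exists>A \<chi>. (A, T, \<chi>) \<in> Obj (orbit_groth G X)"
proof -
  define E where "E = {Prd i t | i t. i \<in> points X \<and> (t = NewRoot \<or> (\<exists>e\<in>leaves (Fob T i). t = Old e))}"
  \<comment> \<open>On \<open>E\<close> the default case is met only by \<open>NewRoot\<close>, so
    base points go to base points.\<close>
  define act where "act x c = Prd (gact X x (prd_fst c))
      (case prd_snd c of Old e \<Rightarrow> Old (tact T x (prd_fst c) e) | _ \<Rightarrow> NewRoot)" for x c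
  define A :: "'a retr" where "A = \<lparr>pts = E, ract = (\<lambda>x\<in>carrier G. \<lambda>c\<in>E. act x c),
      sect = (\<lambda>i\<in>points X. Prd i NewRoot), proj = (\<lambda>c\<in>E. prd_fst c)\<rparr>"
  have E_cases: "(\<exists>i\<in>points X. c = Prd i NewRoot) \<or> (\<exists>i\<in>points X. \<exists>e\<in>leaves (Fob T i). c = Prd i (Old e))"
    if "c \<in> E" for c
    using that by (auto simp: E_def)
  have in_E: "Prd i NewRoot \<in> E" "e \<in> leaves (Fob T i) \<Longrightarrow> Prd i (Old e) \<in> E" if "i \<in> points X" for i e
    using that by (auto simp: E_def)
  have act_simps: "act x (Prd i NewRoot) = Prd (gact X x i) NewRoot"
      "act x (Prd i (Old e)) = Prd (gact X x i) (Old (tact T x i e))" for x i e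
    by (simp_all add: act_def)
  have leaf_edge: "e \<in> edges (Fob T i)" if "e \<in> leaves (Fob T i)" for e i
    using that by (simp add: leaves_def)
  have act_in: "act x c \<in> E" if "x \<in> carrier G" "c \<in> E" for x c
    using E_cases[OF that(2)] that(1) in_E gact_in tact_leaf by (auto simp: act_simps)
  have prd_fst_act: "prd_fst (act x c) = gact X x (prd_fst c)" for x c by (simp add: act_def)
  have prd_fst_in: "prd_fst c \<in> points X" if "c \<in> E" for c using that by (auto simp: E_def)
  have "finite E"
  proof (rule finite_subset)
    show "E \<subseteq> (\<lambda>i. Prd i NewRoot) ` points X \<union> (\<Union>i\<in>points X. (\<lambda>e. Prd i (Old e)) ` edges (Fob T i))"
      using leaf_edge by (auto simp: E_def)
    show "finite ((\<lambda>i. Prd i NewRoot) ` points X \<union> (\<Union>i\<in>points X. (\<lambda>e. Prd i (Old e)) ` edges (Fob T i)))"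
      using rooted_finite[OF fam_rooted[OF T]] by (simp add: points_def)
  qed
  moreover have "group_action G E (\<lambda>x\<in>carrier G. \<lambda>c\<in>E. act x c)"
  proof (rule group_actionI)
    show "(\<lambda>x\<in>carrier G. \<lambda>c\<in>E. act x c) x \<in> E \<rightarrow>\<^sub>E E" if "x \<in> carrier G" for x
      using that act_in by auto
    show "(\<lambda>x\<in>carrier G. \<lambda>c\<in>E. act x c) \<one> c = c" if "c \<in> E" for c
      using E_cases[OF that] that gact_one tact_one[OF T] leaf_edge by (auto simp: act_simps)
    show "(\<lambda>x\<in>carrier G. \<lambda>c\<in>E. act x c) (y \<otimes> x) c =
        (\<lambda>x\<in>carrier G. \<lambda>c\<in>E. act x c) y ((\<lambda>x\<in>carrier G. \<lambda>c\<in>E. act x c) x c)"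
      if x: "x \<in> carrier G" and y: "y \<in> carrier G" and c: "c \<in> E" for x y c
    proof -
      have "act (y \<otimes> x) c = act y (act x c)"
        using E_cases[OF c] gact_mult[OF x y] tact_mult[OF T x y] leaf_edge by (auto simp: act_simps)
      then show ?thesis using x y c act_in by simp
    qed
  qed
  moreover have "(\<lambda>i\<in>points X. Prd i NewRoot) \<in> points X \<rightarrow>\<^sub>E E" using in_E by auto
  moreover have "(\<lambda>c\<in>E. prd_fst c) \<in> E \<rightarrow>\<^sub>E points X" using prd_fst_in by auto
  ultimately have A: "is_retr G X A"
    unfolding is_retr_def A_def
    using in_E gact_in by (simp add: act_in prd_fst_act act_simps)
  have labels: "labels X A = {Prd i (Old e) | i e. i \<in> points X \<and> e \<in> leaves (Fob T i)}"
    by (auto simp: labels_def A_def E_def)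
  have A_simps: "proj A (Prd i (Old e)) = i"
      "x \<in> carrier G \<Longrightarrow> ract A x (Prd i (Old e)) = Prd (gact X x i) (Old (tact T x i e))"
    if "i \<in> points X" "e \<in> leaves (Fob T i)" for x i e
    using in_E(2)[OF that] by (simp_all add: A_def act_simps)
  define l where "l c = (case prd_snd c of Old e \<Rightarrow> e | _ \<Rightarrow> undefined)" for c
  have l: "l (Prd i (Old e)) = e" for i e by (simp add: l_def)
  have "labeling G X A T (\<lambda>c\<in>labels X A. (proj A c, l c))"
  proof (rule labelingI[OF A T])
    fix i
    assume i: "i \<in> points X"
    then have "{c \<in> labels X A. proj A c = i} = (\<lambda>e. Prd i (Old e)) ` leaves (Fob T i)"
      by (auto simp: labels A_simps)
    then show "bij_betw l {c \<in> labels X A. proj A c = i} (leaves (Fob T i))"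
      by (auto intro!: bij_betw_byWitness[where f' = "\<lambda>e. Prd i (Old e)"] simp: l)
  next
    fix x c
    assume x: "x \<in> carrier G" and "c \<in> labels X A"
    then obtain i e where "c = Prd i (Old e)" "i \<in> points X" "e \<in> leaves (Fob T i)" by (auto simp: labels)
    then show "l (ract A x c) = tact T x (proj A c) (l c)"
      using x by (simp add: A_simps l)
  qed
  then show ?thesis using A T by (auto simp: Obj_orbit_groth)
qed

end

end

text \<open>Splitting the action of each group element into its root part and its tree parts gives
  \<open>X\<close> and \<open>T\<close>. Extensionality makes the reassembled forest equal to
  \<open>M\<close>, not just isomorphic, as \<open>equivalent_if_surj\<close> demands.\<close>

lemma ex_forest_of:
  assumes G: "group G" and M: "M \<in> Obj (functor_cat (BG G) forest_cat)"
  shows "\<exists>X T. X \<in> Obj (functor_cat (BG G) finset_cat) \<and> T \<in> Obj (Omega_orbit G X) \<and> M = forest_of G X T"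
proof -
  interpret G: group G by (rule G)
  interpret B: category "BG G" by (rule category_BG[OF G])
  interpret F: category finset_cat by (rule category_finset)
  have Mf: "cat_functor (BG G) forest_cat M" and Mext: "Far M \<in> extensional (carrier G)"
    using M by (auto simp: Obj_functor_cat)
  interpret M: cat_functor "BG G" forest_cat M by (rule Mf)
  obtain n F where nF: "Fob M () = (n, F)" by (cases "Fob M ()")
  have n: "n \<ge> 1" "F \<in> extensional {1..n}" "\<And>i. i \<in> {1..n} \<Longrightarrow> rooted (F i)"
    using M.Fob_in[of "()"] by (auto simp: nF Obj_forest)
  define \<phi> where "\<phi> x = fst (datum (Far M x))" for x
  define f where "f x = snd (datum (Far M x))" for x
  have FarM: "Far M x = ((n, F), (n, F), (\<phi> x, f x))" "\<phi> x \<in> {1..n} \<rightarrow>\<^sub>E {1..n}" "f x \<in> extensional {1..n}"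
      "\<And>i. i \<in> {1..n} \<Longrightarrow> f x i \<in> homset Omega (F i) (F (\<phi> x i))" if "x \<in> carrier G" for x
    using M.Far_in[of x "()" "()"] that by (auto simp: nF homset_forest \<phi>_def f_def)
  have one: "\<phi> \<one>\<^bsub>G\<^esub> = (\<lambda>i\<in>{1..n}. i)" "f \<one>\<^bsub>G\<^esub> = (\<lambda>i\<in>{1..n}. Ident Omega (F i))"
    using M.Far_Ident[of "()"] by (simp_all add: nF Ident_forest \<phi>_def f_def)
  have mult: "\<phi> (y \<otimes>\<^bsub>G\<^esub> x) = compose {1..n} (\<phi> y) (\<phi> x)"
      "f (y \<otimes>\<^bsub>G\<^esub> x) = (\<lambda>i\<in>{1..n}. Comp Omega (f y (\<phi> x i)) (f x i))"
    if x: "x \<in> carrier G" and y: "y \<in> carrier G" for x y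
  proof -
    have "Far M (y \<otimes>\<^bsub>G\<^esub> x) = Comp forest_cat (Far M y) (Far M x)"
      using M.Far_Comp[of x "()" "()" y "()"] x y by simp
    then have "((n, F), (n, F), (\<phi> (y \<otimes>\<^bsub>G\<^esub> x), f (y \<otimes>\<^bsub>G\<^esub> x))) =
        ((n, F), (n, F), (compose {1..n} (\<phi> y) (\<phi> x), \<lambda>i\<in>{1..n}. Comp Omega (f y (\<phi> x i)) (f x i)))"
      unfolding FarM(1)[OF x] FarM(1)[OF y] FarM(1)[OF G.m_closed[OF y x]] Comp_forest .
    then show "\<phi> (y \<otimes>\<^bsub>G\<^esub> x) = compose {1..n} (\<phi> y) (\<phi> x)"
      "f (y \<otimes>\<^bsub>G\<^esub> x) = (\<lambda>i\<in>{1..n}. Comp Omega (f y (\<phi> x i)) (f x i))"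
      by (simp_all only: prod.inject)
  qed
  define X :: "'a ordgset" where "X = \<lparr>Fob = (\<lambda>_. n), Far = (\<lambda>x\<in>carrier G. (n, n, \<phi> x))\<rparr>"
  have X: "X \<in> Obj (functor_cat (BG G) finset_cat)"
  proof -
    have "cat_functor (BG G) finset_cat X"
    proof
      show "Fob X a \<in> Obj finset_cat" for a using n by (simp add: X_def finset_cat_def)
      show "Far X x \<in> homset finset_cat (Fob X a) (Fob X b)" if "x \<in> homset (BG G) a b" for x a b
        using that n(1) FarM(2) by (simp add: X_def homset_finset)
      show "Far X (Ident (BG G) a) = Ident finset_cat (Fob X a)" for a
        by (simp add: X_def one finset_cat_def)
      show "Far X (Comp (BG G) y x) = Comp finset_cat (Far X y) (Far X x)"
        if "x \<in> homset (BG G) a b" "y \<in> homset (BG G) b c" for x y a b c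
        using that by (simp add: X_def mult Comp_finset)
    qed
    then show ?thesis by (simp add: Obj_functor_cat X_def extensional_def)
  qed
  interpret X: gset G X by unfold_locales (rule X)
  have pX: "points X = {1..n}" by (simp add: points_def X_def)
  have gX: "gact X x = \<phi> x" if "x \<in> carrier G" for x using that by (simp add: gact_def X_def)
  define m where "m x i = datum (f x i)" for x i
  have fm: "f x i = (F i, F (\<phi> x i), m x i)" "tree_map (F i) (F (\<phi> x i)) (m x i)"
    if "x \<in> carrier G" "i \<in> points X" for x i
    using FarM(4)[OF that(1), of i] that(2) unfolding pX by (auto simp: homset_Omega m_def)
  define T where "T = X.mk_fam F m"
  have T: "T \<in> Obj (Omega_orbit G X)"
    unfolding T_def
  proof (rule X.mk_fam_in)
    show "rooted (F i)" if "i \<in> points X" for i using n(3) that unfolding pX .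
    show "tree_map (F i) (F (gact X x i)) (m x i)" if "x \<in> carrier G" "i \<in> points X" for x i
      using fm(2)[OF that] gX[OF that(1)] by simp
    show "m \<one>\<^bsub>G\<^esub> i = (\<lambda>e\<in>edges (F i). e)" if "i \<in> points X" for i
      using that unfolding pX by (simp add: m_def one Ident_Omega)
    show "m (y \<otimes>\<^bsub>G\<^esub> x) i = compose (edges (F i)) (m y (gact X x i)) (m x i)"
      if x: "x \<in> carrier G" and y: "y \<in> carrier G" and i: "i \<in> points X" for x y i
    proof -
      have "f (y \<otimes>\<^bsub>G\<^esub> x) i = Comp Omega (f y (\<phi> x i)) (f x i)"
        using i unfolding mult(2)[OF x y] pX by simp
      then have "m (y \<otimes>\<^bsub>G\<^esub> x) i = compose (edges (fst (f x i))) (m y (\<phi> x i)) (m x i)"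
        by (simp add: m_def Comp_Omega)
      then show ?thesis by (simp add: fm(1)[OF x i] gX[OF x])
    qed
  qed
  have "M = forest_of G X T"
  proof -
    have FT: "Fob T = F"
      by (rule extensionalityI[where A = "points X"])
        (use n(2) in \<open>simp_all add: T_def X.mk_fam_def pX\<close>)
    have "Far M = Far (forest_of G X T)"
    proof (rule extensionalityI[OF Mext])
      show "Far (forest_of G X T) \<in> extensional (carrier G)" by (simp add: forest_of_def Let_def)
      fix x
      assume x: "x \<in> carrier G"
      have "f x = (\<lambda>i\<in>points X. Far T (x, i))"
        by (rule extensionalityI[where A = "points X"])
          (use FarM(3)[OF x] fm(1)[OF x] gX[OF x] x in \<open>simp_all add: T_def X.mk_fam_def pX\<close>)
      then show "Far M x = Far (forest_of G X T) x"
        using x by (simp add: forest_of_simps FarM(1)[OF x] FT gX) (simp add: X_def)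
    qed
    moreover have "Fob M = Fob (forest_of G X T)"
      using nF by (auto simp: fun_eq_iff forest_of_simps FT X_def)
    ultimately show ?thesis by (metis funct.surjective old.unit.exhaust)
  qed
  then show ?thesis using X T by blast
qed

section \<open>The equivalence\<close>

definition forest_funct :: "('g, 'm) monoid_scheme \<Rightarrow>
    ('g ordgset \<times> 'g gobj, ('g ordgset \<times> 'g gobj, 'g ordgset_arr \<times> 'g garr) arr,
     'g gforest, ('g gforest, unit \<Rightarrow> forest_arr) arr) funct" where
  "forest_funct G = \<lparr>
     Fob = (\<lambda>(X, A, T, \<chi>). forest_of G X T),
     Far = (\<lambda>((X, A, T, \<chi>), (Y, B, S, \<psi>), (p, \<alpha>)).
       (forest_of G X T, forest_of G Y S,
        \<lambda>_. ((Fob X (), Fob T), (Fob Y (), Fob S), (gmap p, datum (gset.old_part X \<alpha>)))))\<rparr>"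

context group
begin

abbreviation Gset :: "('a ordgset, 'a ordgset_arr) cat" where
  "Gset \<equiv> functor_cat (BG G) finset_cat"

abbreviation D where "D \<equiv> pseudo_groth (orbit_cat G) (orbit_pseudo G)"

lemma category_Omega_G: "category (Omega_G G)"
  unfolding Omega_G_def
  by (rule category_full_subcat[OF category_functor_cat[OF category_BG category_forest]]) (rule is_group)

lemma Obj_orbit: "X \<in> Obj (orbit_cat G) \<longleftrightarrow> gset G X \<and> transitive G X"
  by (auto simp: orbit_cat_def gset_def gset_axioms_def is_group)

lemma homset_orbit: "p \<in> homset (orbit_cat G) X Y \<longleftrightarrow> gset_map G X Y p \<and> transitive G X \<and> transitive G Y"
  by (auto simp: orbit_cat_def homset_full_subcat gset_map_def gset_map_axioms_def gset_def gset_axioms_def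
      is_group homset_functor_cat)

lemma Obj_D: "(X, s) \<in> Obj D \<longleftrightarrow> gset G X \<and> transitive G X \<and> s \<in> Obj (orbit_groth G X)"
  by (simp add: pseudo_groth_def orbit_pseudo_def Obj_orbit)

lemma homset_D: "f \<in> homset D (X, s) (Y, t) \<longleftrightarrow> (X, s) \<in> Obj D \<and> (Y, t) \<in> Obj D \<and>
    (\<exists>p \<alpha>. f = ((X, s), (Y, t), (p, \<alpha>)) \<and> gset_map G X Y p \<and>
      \<alpha> \<in> homset (orbit_groth G X) s (pb_obj G p t))"
  by (auto simp: pseudo_groth_def orbit_pseudo_def homset_mk_cat Obj_orbit homset_orbit)

lemma Ident_D: "Ident D (X, s) = ((X, s), (X, s),
    (Ident Gset X, inverse_arr (orbit_groth G X)
      (relabel G X (pb_obj G (Ident Gset X) s) s (\<lambda>a. Prd (proj (fst s) a) a))))"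
  by (simp add: pseudo_groth_def orbit_pseudo_def orbit_cat_def)

lemma Comp_D: "Comp D ((Y, t), (Z, u), (r, \<beta>)) ((X, s), (Y', t'), (p, \<alpha>)) = ((X, s), (Z, u),
    (Comp Gset r p,
     Comp (orbit_groth G X)
       (inverse_arr (orbit_groth G X)
         (relabel G (fst p) (pb_obj G (Comp Gset r p) u) (pb_obj G p (pb_obj G r u))
           (\<lambda>c. Prd (prd_fst c) (prd_snd (prd_snd c)))))
       (Comp (orbit_groth G X) (pb_arr G p \<beta>) \<alpha>)))"
  by (simp add: pseudo_groth_def orbit_pseudo_def orbit_cat_def)

lemma homset_Omega_G: "h \<in> homset (Omega_G G) (forest_of G X T) (forest_of G Y S) \<longleftrightarrow>
    h \<in> homset (functor_cat (BG G) forest_cat) (forest_of G X T) (forest_of G Y S) \<and>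
    transitive G X \<and> transitive G Y"
  by (simp add: Omega_G_def homset_full_subcat transitive_forest_of)

text \<open>An arrow of \<open>D\<close> is a map \<open>p\<close> of roots with an arrow over
  \<open>X\<close>, which by \<open>fully_faithful_old\<close> amounts to a map of families into the
  pullback along \<open>p\<close>; \<open>forest_hom\<close> decomposes forest maps in the same way.
  The structure isomorphisms in identities and composites have identity old parts and so
  disappear.\<close>

lemma fully_faithful_forest: "fully_faithful (Omega_G G) D (forest_funct G)"
proof -
  interpret O: category "Omega_G G" by (rule category_Omega_G)
  show ?thesis
  proof
    fix f
    assume "f \<in> Arr D"
    then show "Dom D f \<in> Obj D" "Cod D f \<in> Obj D"
      by (simp_all add: pseudo_groth_def Arr_mk_cat)
  next
    fix a
    assume a: "a \<in> Obj D"
    obtain X A T \<chi> where a_eq: "a = (X, A, T, \<chi>)" by (cases a)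
    have X: "gset G X" "transitive G X" and s: "(A, T, \<chi>) \<in> Obj (orbit_groth G X)"
      using a by (auto simp: a_eq Obj_D)
    interpret X: gset G X by (rule X)
    have T: "T \<in> Obj (Omega_orbit G X)" using s by (simp add: X.Obj_orbit_groth)
    show "Ident D a \<in> homset D a a"
      using a X.gset_map_id X.Tid_facts(1)[OF s] by (simp add: a_eq homset_D Ident_D)
    show "Fob (forest_funct G) a \<in> Obj (Omega_G G)"
      using X.forest_of_in[OF T] X(2)
      by (simp add: Omega_G_def transitive_forest_of a_eq forest_funct_def)
    have "datum (X.fam_arr T T (\<lambda>i e. e)) = (\<lambda>i\<in>points X. Ident Omega (Fob T i))"
      by (auto simp: X.fam_arr_def Ident_Omega)
    then have "Far (forest_funct G) (Ident D a) = (forest_of G X T, forest_of G X T,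
        \<lambda>_. ((Fob X (), Fob T), (Fob X (), Fob T), (\<lambda>i\<in>points X. i, \<lambda>i\<in>points X. Ident Omega (Fob T i))))"
      using X.Tid_facts(2)[OF s] by (simp add: a_eq Ident_D forest_funct_def gmap_Ident)
    also have "\<dots> = Ident (Omega_G G) (forest_of G X T)"
      unfolding Omega_G_def full_subcat_simps Ident_functor_cat forest_of_simps Ident_forest X.points_eq
      by (simp add: fun_eq_iff)
    finally show "Far (forest_funct G) (Ident D a) = Ident (Omega_G G) (Fob (forest_funct G) a)"
      by (simp add: a_eq forest_funct_def)
  next
    fix f g a b c
    assume f: "f \<in> homset D a b" and g: "g \<in> homset D b c"
    obtain X A T \<chi> where a_eq: "a = (X, A, T, \<chi>)" by (cases a)
    obtain Y B S \<psi> where b_eq: "b = (Y, B, S, \<psi>)" by (cases b)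
    obtain Z C R \<omega> where c_eq: "c = (Z, C, R, \<omega>)" by (cases c)
    obtain p \<alpha> where f_eq: "f = (a, b, (p, \<alpha>))" and p: "gset_map G X Y p"
      and \<alpha>: "\<alpha> \<in> homset (orbit_groth G X) (A, T, \<chi>) (pb_obj G p (B, S, \<psi>))"
      using f by (auto simp: a_eq b_eq homset_D)
    obtain r \<beta> where g_eq: "g = (b, c, (r, \<beta>))" and r: "gset_map G Y Z r"
      and \<beta>: "\<beta> \<in> homset (orbit_groth G Y) (B, S, \<psi>) (pb_obj G r (C, R, \<omega>))"
      using g by (auto simp: b_eq c_eq homset_D)
    have a: "a \<in> Obj D" and b: "b \<in> Obj D" and c: "c \<in> Obj D"
      using f g by (auto simp: a_eq b_eq c_eq homset_D)
    have s: "(A, T, \<chi>) \<in> Obj (orbit_groth G X)" and t: "(B, S, \<psi>) \<in> Obj (orbit_groth G Y)"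
      and u: "(C, R, \<omega>) \<in> Obj (orbit_groth G Z)"
      using a b c by (auto simp: a_eq b_eq c_eq Obj_D)
    interpret XY: gset_map G X Y p by (rule p)
    interpret YZ: gset_map G Y Z r by (rule r)
    interpret gset_map_pair G X Y Z p r by unfold_locales
    interpret ff: fully_faithful "Omega_orbit G X" "orbit_groth G X" XY.X.old_funct
      by (rule XY.X.fully_faithful_old)
    have T: "T \<in> Obj (Omega_orbit G X)" and S: "S \<in> Obj (Omega_orbit G Y)" and R: "R \<in> Obj (Omega_orbit G Z)"
      using s t u by (auto simp: XY.X.Obj_orbit_groth XY.Y.Obj_orbit_groth YZ.Y.Obj_orbit_groth)
    note pbS = XY.pb_obj_eq[OF S] and pbR = YZ.pb_obj_eq[OF R]
    obtain \<phi> k where \<alpha>_eq: "\<alpha> = XY.X.mk_garr (A, T, \<chi>) (pb_obj G p (B, S, \<psi>)) \<phi> k"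
      and \<phi>: "retr_map G X (pb_retr G p B) A \<phi>"
      and k: "XY.X.fam_arr T (XY.pb_fam S) k \<in> homset (Omega_orbit G X) T (XY.pb_fam S)"
      using XY.X.hom_mk_garr \<alpha> unfolding pbS by metis
    obtain \<gamma> m where \<beta>_eq: "\<beta> = XY.Y.mk_garr (B, S, \<psi>) (pb_obj G r (C, R, \<omega>)) \<gamma> m"
      and \<gamma>: "retr_map G Y (pb_retr G r C) B \<gamma>"
      and m: "XY.Y.fam_arr S (YZ.pb_fam R) m \<in> homset (Omega_orbit G Y) S (YZ.pb_fam R)"
      and mc: "XY.Y.compat (B, S, \<psi>) (pb_retr G r C, YZ.pb_fam R, YZ.pb_lab C \<omega>) \<gamma> m"
      using XY.Y.hom_mk_garr \<beta> unfolding pbR by metis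
    note pb\<beta> = XY.pb_arr_mk_garr[OF t YZ.pb_obj_in[OF u] \<gamma> m mc, folded pbR, folded \<beta>_eq]
    let ?\<tau> = "inverse_arr (orbit_groth G X) (relabel G X (pb_obj G rp (C, R, \<omega>))
        (pb_obj G p (pb_obj G r (C, R, \<omega>))) (\<lambda>c. Prd (prd_fst c) (prd_snd (prd_snd c))))"
    note \<tau> = Tcomp_facts[OF u]
    note comp1 = ff.D_Comp_in[OF \<alpha> pb\<beta>(1)]
    have comp: "Comp D g f = (a, c, (rp, Comp (orbit_groth G X) ?\<tau> (Comp (orbit_groth G X) (pb_arr G p \<beta>) \<alpha>)))"
      by (simp add: f_eq g_eq a_eq b_eq c_eq Comp_D XY.fst_p)
    show "Comp D g f \<in> homset D a c"
      using a c XZ.gset_map_axioms ff.D_Comp_in[OF comp1 \<tau>(1)]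
      unfolding comp a_eq c_eq homset_D by blast
    have old\<alpha>: "XY.X.old_part \<alpha> = XY.X.fam_arr T (XY.pb_fam S) k"
      using XY.X.old_part_mk_garr[OF s XY.pb_obj_in[OF t] \<phi>] by (simp add: \<alpha>_eq pbS)
    have old\<beta>: "XY.Y.old_part \<beta> = XY.Y.fam_arr S (YZ.pb_fam R) m"
      using XY.Y.old_part_mk_garr[OF t YZ.pb_obj_in[OF u] \<gamma>] by (simp add: \<beta>_eq pbR)
    have kin: "k i e \<in> edges (Fob (XY.pb_fam S) i)" if "i \<in> points X" "e \<in> edges (Fob T i)" for i e
      using k that by (auto simp: XY.X.fam_arr_hom tree_map_def PiE_iff)
    have min: "m i e \<in> edges (Fob (YZ.pb_fam R) i)" if "i \<in> points Y" "e \<in> edges (Fob S i)" for i e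
      using m that by (auto simp: XY.Y.fam_arr_hom tree_map_def PiE_iff)
    let ?F = "XZ.pb_fam R"
    let ?mk = "\<lambda>i e. m (gmap p i) (k i e)"
    have mk: "?mk i e \<in> edges (Fob ?F i)" if "i \<in> points X" "e \<in> edges (Fob T i)" for i e
      using kin[OF that] min[OF XY.q_in[OF that(1)]] that(1)
      by (simp add: XY.Fob_pb_fam pb_fam_rp)
    \<comment> \<open>The factors have old parts \<open>k\<close>, \<open>m\<close> reindexed by
      \<open>gmap p\<close>, and the identity; they compose because the family pulled back along
      \<open>rp\<close> equals the one pulled back in two stages.\<close>
    have old: "XY.X.old_part (Comp (orbit_groth G X) ?\<tau> (Comp (orbit_groth G X) (pb_arr G p \<beta>) \<alpha>)) =
        XY.X.fam_arr T ?F ?mk"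
    proof -
      have "XY.X.old_part (Comp (orbit_groth G X) (pb_arr G p \<beta>) \<alpha>) = XY.X.fam_arr T ?F ?mk"
        using ff.U_Comp[OF \<alpha> pb\<beta>(1)] pb\<beta>(2) old\<alpha> XY.X.fam_arr_Comp[OF kin]
        by (simp add: XY.X.old_funct_def pb_fam_rp)
      then show ?thesis
        using ff.U_Comp[OF comp1 \<tau>(1)] \<tau>(2) XY.X.fam_arr_Comp[OF mk]
        by (simp add: XY.X.old_funct_def)
    qed
    have rp_eq: "gmap rp = compose {1..Fob X ()} (gmap r) (gmap p)"
      by (simp add: gmap_Comp XY.gmap_eq_datum)
    \<comment> \<open>Composition of forests applies the second map at the tree with index
      \<open>gmap p i\<close>, which is the same reindexing.\<close>
    have arr: "datum (XY.X.fam_arr T ?F ?mk) = (\<lambda>i\<in>{1..Fob X ()}. Comp Omega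
        (datum (XY.Y.fam_arr S (YZ.pb_fam R) m) (gmap p i)) (datum (XY.X.fam_arr T (XY.pb_fam S) k) i))"
    proof -
      have "(Fob T i, Fob ?F i, \<lambda>e\<in>edges (Fob T i). ?mk i e) = Comp Omega
        (datum (XY.Y.fam_arr S (YZ.pb_fam R) m) (gmap p i)) (datum (XY.X.fam_arr T (XY.pb_fam S) k) i)"
        if "i \<in> points X" for i
        using that kin[OF that] XY.q_in[OF that]
        by (auto simp: XY.X.fam_arr_def XY.Y.fam_arr_def Comp_Omega compose_def pb_fam_rp XY.Fob_pb_fam
            intro!: restrict_ext)
      then show ?thesis by (auto simp: XY.X.fam_arr_def XY.X.points_eq intro!: restrict_ext)
    qed
    have "Far (forest_funct G) (Comp D g f) = (forest_of G X T, forest_of G Z R,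
        \<lambda>_. ((Fob X (), Fob T), (Fob Z (), Fob R), (gmap rp, datum (XY.X.fam_arr T ?F ?mk))))"
      unfolding comp by (simp add: a_eq c_eq forest_funct_def old)
    also have "\<dots> = Comp (Omega_G G)
        (forest_of G Y S, forest_of G Z R, \<lambda>_. ((Fob Y (), Fob S), (Fob Z (), Fob R),
          (gmap r, datum (XY.Y.fam_arr S (YZ.pb_fam R) m))))
        (forest_of G X T, forest_of G Y S, \<lambda>_. ((Fob X (), Fob T), (Fob Y (), Fob S),
          (gmap p, datum (XY.X.fam_arr T (XY.pb_fam S) k))))"
      unfolding rp_eq arr
      unfolding Omega_G_def full_subcat_simps Comp_functor_cat snd_conv fst_conv Comp_forest
      by (simp add: fun_eq_iff)
    finally show "Far (forest_funct G) (Comp D g f) =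
        Comp (Omega_G G) (Far (forest_funct G) g) (Far (forest_funct G) f)"
      by (simp add: f_eq g_eq a_eq b_eq c_eq forest_funct_def old\<alpha> old\<beta>)
  next
    fix a b
    assume a: "a \<in> Obj D" and b: "b \<in> Obj D"
    obtain X A T \<chi> where a_eq: "a = (X, A, T, \<chi>)" by (cases a)
    obtain Y B S \<psi> where b_eq: "b = (Y, B, S, \<psi>)" by (cases b)
    have X: "gset G X" "transitive G X" and s: "(A, T, \<chi>) \<in> Obj (orbit_groth G X)"
      and Y: "gset G Y" "transitive G Y" and t: "(B, S, \<psi>) \<in> Obj (orbit_groth G Y)"
      using a b by (auto simp: a_eq b_eq Obj_D)
    interpret X: gset G X by (rule X)
    interpret Y: gset G Y by (rule Y)
    interpret ff: fully_faithful "Omega_orbit G X" "orbit_groth G X" X.old_funct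
      by (rule X.fully_faithful_old)
    have T: "T \<in> Obj (Omega_orbit G X)" and S: "S \<in> Obj (Omega_orbit G Y)"
      using s t by (auto simp: X.Obj_orbit_groth Y.Obj_orbit_groth)
    note forest_hom = forest_hom[OF X(1) Y(1) T S]
    let ?M = "(Fob X (), Fob T)" and ?N = "(Fob Y (), Fob S)"
    have FobU: "Fob (forest_funct G) a = forest_of G X T" "Fob (forest_funct G) b = forest_of G Y S"
      by (simp_all add: forest_funct_def a_eq b_eq)
    have FarU: "Far (forest_funct G) (a, b, (p, \<alpha>)) =
        (forest_of G X T, forest_of G Y S, \<lambda>_. (?M, ?N, (gmap p, datum (X.old_part \<alpha>))))" for p \<alpha>
      by (simp add: forest_funct_def a_eq b_eq)
    have old_hom: "X.old_part \<alpha> \<in> homset (Omega_orbit G X) T (gset_map.pb_fam G X p S)"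
      if "gset_map G X Y p" "\<alpha> \<in> homset (orbit_groth G X) (A, T, \<chi>) (pb_obj G p (B, S, \<psi>))" for p \<alpha>
    proof -
      interpret p: gset_map G X Y p by fact
      show ?thesis using ff.U_in[OF that(2)] by (simp add: X.old_funct_def p.pb_obj_eq[OF S])
    qed
    show "bij_betw (Far (forest_funct G)) (homset D a b)
        (homset (Omega_G G) (Fob (forest_funct G) a) (Fob (forest_funct G) b))"
      unfolding bij_betw_def
    proof (intro conjI equalityI subsetI)
      show "inj_on (Far (forest_funct G)) (homset D a b)"
      proof (rule inj_onI)
        fix f f'
        assume f: "f \<in> homset D a b" and f': "f' \<in> homset D a b" and eq: "Far (forest_funct G) f = Far (forest_funct G) f'"
        obtain p \<alpha> where p: "f = (a, b, (p, \<alpha>))" "gset_map G X Y p"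
            "\<alpha> \<in> homset (orbit_groth G X) (A, T, \<chi>) (pb_obj G p (B, S, \<psi>))"
          using f by (auto simp: a_eq b_eq homset_D)
        obtain p' \<alpha>' where p': "f' = (a, b, (p', \<alpha>'))" "gset_map G X Y p'"
            "\<alpha>' \<in> homset (orbit_groth G X) (A, T, \<chi>) (pb_obj G p' (B, S, \<psi>))"
          using f' by (auto simp: a_eq b_eq homset_D)
        have "gmap p = gmap p'" and old: "datum (X.old_part \<alpha>) = datum (X.old_part \<alpha>')"
          using eq by (simp_all add: p p' FarU fun_eq_iff)
        then have pp: "p = p'"
          using gset_map.p_eq[OF p(2)] gset_map.p_eq[OF p'(2)] by simp
        \<comment> \<open>Once \<open>p = p'\<close>, both old parts have the same domain and
          codomain, so equality of their data suffices.\<close>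
        have "X.old_part \<alpha> = X.old_part \<alpha>'"
          using old old_hom[OF p(2,3)] old_hom[OF p'(2,3)] unfolding pp
          by (auto simp: Omega_orbit_def homset_functor_cat)
        then have "\<alpha> = \<alpha>'" using ff.U_inj[OF p(3)] p'(3) pp by (simp add: X.old_funct_def)
        then show "f = f'" using pp p p' by simp
      qed
    next
      fix h
      assume "h \<in> Far (forest_funct G) ` homset D a b"
      then obtain p \<alpha> where h: "h = Far (forest_funct G) (a, b, (p, \<alpha>))" and p: "gset_map G X Y p"
          and \<alpha>: "\<alpha> \<in> homset (orbit_groth G X) (A, T, \<chi>) (pb_obj G p (B, S, \<psi>))"
        by (auto simp: a_eq b_eq homset_D)
      interpret p: gset_map G X Y p by (rule p)
      obtain k where "X.old_part \<alpha> = (T, p.pb_fam S, k)" "k \<in> extensional (points X)"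
          "\<forall>i\<in>points X. k i \<in> homset Omega (Fob T i) (Fob S (gmap p i))"
          "\<forall>x\<in>carrier G. \<forall>i\<in>points X. Comp Omega (k (gact X x i)) (Far T (x, i)) = Comp Omega (Far S (x, gmap p i)) (k i)"
        using old_hom[OF p \<alpha>] unfolding p.homset_pb_fam[OF T S] by blast
      then show "h \<in> homset (Omega_G G) (Fob (forest_funct G) a) (Fob (forest_funct G) b)"
        using X(2) Y(2) p.q_ext p.q_act
        unfolding FobU homset_Omega_G forest_hom h FarU
        by (intro conjI exI[of _ "gmap p"] exI[of _ k]) simp_all
    next
      fix h
      assume "h \<in> homset (Omega_G G) (Fob (forest_funct G) a) (Fob (forest_funct G) b)"
      then obtain \<phi> f where h: "h = (forest_of G X T, forest_of G Y S, \<lambda>_. (?M, ?N, (\<phi>, f)))"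
        and \<phi>: "\<phi> \<in> points X \<rightarrow>\<^sub>E points Y" "\<forall>x\<in>carrier G. \<forall>i\<in>points X. \<phi> (gact X x i) = gact Y x (\<phi> i)"
        and f: "f \<in> extensional (points X)" "\<forall>i\<in>points X. f i \<in> homset Omega (Fob T i) (Fob S (\<phi> i))"
          "\<forall>x\<in>carrier G. \<forall>i\<in>points X. Comp Omega (f (gact X x i)) (Far T (x, i)) = Comp Omega (Far S (x, \<phi> i)) (f i)"
        unfolding FobU homset_Omega_G forest_hom by blast
      \<comment> \<open>The root map of \<open>h\<close> as an arrow of G-sets; its naturality is
        the equivariance of \<phi>.\<close>
      define p :: "'a ordgset_arr" where "p = (X, Y, \<lambda>_. (Fob X (), Fob Y (), \<phi>))"
      have gp: "gmap p = \<phi>" by (simp add: p_def gmap_def)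
      have "p \<in> homset Gset X Y"
      proof -
        have "Comp finset_cat (Fob X (), Fob Y (), \<phi>) (Far X x) = Comp finset_cat (Far Y x) (Fob X (), Fob Y (), \<phi>)"
          if x: "x \<in> carrier G" for x
        proof -
          have "compose (points X) \<phi> (gact X x) = compose (points X) (gact Y x) \<phi>"
            using \<phi>(2) x by (auto simp: compose_def intro!: restrict_ext)
          then show ?thesis
            using X.Far_X[OF x] Y.Far_X[OF x] by (simp add: Comp_finset X.points_eq)
        qed
        then show ?thesis
          using X.X Y.X X.Fob_X_ge Y.Fob_X_ge \<phi>(1)
          by (auto simp: homset_functor_cat p_def homset_finset X.points_eq Y.points_eq)
      qed
      then interpret p: gset_map G X Y p by unfold_locales
      have "(T, p.pb_fam S, f) \<in> homset (Omega_orbit G X) T (p.pb_fam S)"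
        using f unfolding p.homset_pb_fam[OF T S] gp by blast
      \<comment> \<open>Fullness over the fixed G-set \<open>X\<close> lifts the tree part of
        \<open>h\<close>.\<close>
      then have "\<exists>\<alpha> \<in> homset (orbit_groth G X) (A, T, \<chi>) (pb_retr G p B, p.pb_fam S, p.pb_lab B \<psi>).
          Far X.old_funct \<alpha> = (T, p.pb_fam S, f)"
        by (intro ff.U_lift[OF s p.pb_obj_in[OF t]]) (simp add: X.old_funct_def)
      then obtain \<alpha> where \<alpha>: "\<alpha> \<in> homset (orbit_groth G X) (A, T, \<chi>) (pb_obj G p (B, S, \<psi>))"
          "X.old_part \<alpha> = (T, p.pb_fam S, f)"
        unfolding X.old_funct_def p.pb_obj_eq[OF S] funct.select_convs by blast
      have "(a, b, (p, \<alpha>)) \<in> homset D a b"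
        using a b p.gset_map_axioms \<alpha>(1) unfolding a_eq b_eq homset_D by blast
      moreover have "h = Far (forest_funct G) (a, b, (p, \<alpha>))"
        by (simp add: h FarU gp \<alpha>(2))
      ultimately show "h \<in> Far (forest_funct G) ` homset D a b" by blast
    qed
  qed
qed

end

theorem theorem1p2:
  fixes G :: "('g, 'm) monoid_scheme"
  assumes "group G" and "finite (carrier G)"
  shows "equivalent_categories (Omega_G G) (pseudo_groth (orbit_cat G) (orbit_pseudo G))"
proof -
  interpret group G by fact
  interpret fully_faithful "Omega_G G" D "forest_funct G" by (rule fully_faithful_forest)
  show ?thesis
  proof (rule equivalent_if_surj)
    fix M
    assume "M \<in> Obj (Omega_G G)"
    then have M: "M \<in> Obj (functor_cat (BG G) forest_cat)" "transitive G (comp_funct roots_funct M)"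
      by (simp_all add: Omega_G_def)
    obtain X T where X: "X \<in> Obj (functor_cat (BG G) finset_cat)" "T \<in> Obj (Omega_orbit G X)"
        "M = forest_of G X T"
      using ex_forest_of[OF assms(1) M(1)] by blast
    interpret X: gset G X by unfold_locales (rule X)
    obtain A \<chi> where "(A, T, \<chi>) \<in> Obj (orbit_groth G X)" using X.ex_labeling[OF X(2)] by blast
    \<comment> \<open>The roots of \<open>M\<close> form the G-set \<open>X\<close>, so
      \<open>X\<close> is transitive because \<open>M\<close> lies in
      \<open>Omega_G G\<close>.\<close>
    then have "(X, A, T, \<chi>) \<in> Obj D"
      using M(2) X(3) by (simp add: Obj_D transitive_forest_of X.gset_axioms)
    moreover have "Fob (forest_funct G) (X, A, T, \<chi>) = M" by (simp add: forest_funct_def X(3))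
    ultimately show "\<exists>a\<in>Obj D. Fob (forest_funct G) a = M" by blast
  qed
qed

end
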